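(* Let $m\ge 1$ be a fixed integer, let $d_1,\dots,d_m>1$, $\lambda_1,\dots,\lambda_m\ge 0$, $\mu\ge 0$ be constants not depending on $n$, and let $n\to\infty$ with $n/p\to\gamma\in(0,\infty)$. Let $\mathbb{P}_{\bm\lambda,\mu}$ be the law of the observed data $(\bm A_1,\dots,\bm A_m,\bm B)$ in the multi-layer contextual stochastic block model with parameters $(\lambda_1,\dots,\lambda_m,\mu)$, and $\mathbb{P}_{\bm 0,0}$ the law with $\lambda_1=\dots=\lambda_m=\mu=0$ (and the same $d_1,\dots,d_m$). (i) If $\lambda_1^2+\cdots+\lambda_m^2+\mu^2/\gamma<1$, then $\mathbb{P}_{\bm\lambda,\mu}$ is contiguous to $\mathbb{P}_{\bm 0,0}$ as $n\to\infty$. (ii) If $\lambda_1^2+\cdots+\lambda_m^2+\mu^2/\gamma>1$, then $\mathbb{P}_{\bm\lambda,\mu}$ and $\mathbb{P}_{\bm 0,0}$ are asymptotically mutually singular.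
   Context: Multi-layer contextual stochastic block model: $\bm\sigma=(\sigma_1,\dots,\sigma_n)$ is uniform on $\{-1,+1\}^n$. Put $a_k=d_k+\lambda_k\sqrt{d_k}$ and $b_k=d_k-\lambda_k\sqrt{d_k}$ (assumed $\ge 0$). Conditionally on $\bm\sigma$, $\bm G_1,\dots,\bm G_m$ are independent undirected simple random graphs on $[n]=\{1,\dots,n\}$; in $\bm G_k$ the edges are independent and $\{i,j\}$ ($i<j$) is present with probability $a_k/n$ if $\sigma_i=\sigma_j$ and $b_k/n$ if $\sigma_i\ne\sigma_j$. $\bm A_k=(A^{(k)}_{ij})\in\{0,1\}^{n\times n}$ is the adjacency matrix of $\bm G_k$. In addition one observes $\bm B=[B_1,\dots,B_n]\in\mathbb{R}^{p\times n}$ with columns $B_i=\sqrt{\mu/n}\,\sigma_i\bm u+\bm Z_i$, where $\bm u\sim N(\bm 0,\bm I_p)$ is latent and $\bm Z_1,\dots,\bm Z_n$ are i.i.d. $N(\bm 0,\bm I_p)$, with $\bm u$, $(\bm Z_i)$, $\bm\sigma$ independent; given $\bm\sigma$, $\bm B$ is independent of $(\bm G_k)_{k\le m}$. All laws depend on $n$. A sequence of laws $Q_n$ is contiguous to $P_n$ if $P_n(E_n)\to0$ implies $Q_n(E_n)\to 0$ for every sequence of events $E_n$. The sequences are asymptotically mutually singular if there are events $E_n$ with $P_n(E_n)\to 0$ and $Q_n(E_n)\to 1$. *)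

theory Defs
  imports "HOL-Probability.Probability"
begin

text \<open>
  Layers are indexed by \<open>{1..m}\<close>, vertices by \<open>{1..n}\<close>, feature coordinates by \<open>{1..p}\<close>;
  the layer parameters \<open>d\<close> and \<open>l\<close> (for lambda) are functions of the layer index.
\<close>

definition a_par :: "real \<Rightarrow> real \<Rightarrow> real" where
  "a_par d l = d + l * sqrt d"

definition b_par :: "real \<Rightarrow> real \<Rightarrow> real" where
  "b_par d l = d - l * sqrt d"

definition labels_pmf :: "nat \<Rightarrow> (nat \<Rightarrow> real) pmf" where
  "labels_pmf n = pmf_of_set ({1..n} \<rightarrow>\<^sub>E {-1, 1})"

text \<open>
  A graph on \<open>{1..n}\<close> is given by its edge indicators on the pairs \<open>(i, j)\<close> with \<open>i < j\<close>.
  \<^const>\<open>bernoulli_pmf\<close> truncates its parameter to \<open>[0, 1]\<close>; when \<open>a_par d l\<close> and \<open>b_par d l\<close>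
  are nonnegative this only matters for the finitely many \<open>n\<close> with \<open>a_par d l > n\<close>.
\<close>

definition vertex_pairs :: "nat \<Rightarrow> (nat \<times> nat) set" where
  "vertex_pairs n = {(i, j). 1 \<le> i \<and> i < j \<and> j \<le> n}"

definition sbm_pmf :: "nat \<Rightarrow> real \<Rightarrow> real \<Rightarrow> (nat \<Rightarrow> real) \<Rightarrow> (nat \<times> nat \<Rightarrow> bool) pmf" where
  "sbm_pmf n a b \<sigma> =
     Pi_pmf (vertex_pairs n) False
       (\<lambda>(i, j). bernoulli_pmf (if \<sigma> i = \<sigma> j then a / real n else b / real n))"

definition multilayer_sbm_pmf ::
  "nat \<Rightarrow> nat \<Rightarrow> (nat \<Rightarrow> real) \<Rightarrow> (nat \<Rightarrow> real) \<Rightarrow> (nat \<Rightarrow> real) \<Rightarrow> (nat \<Rightarrow> nat \<times> nat \<Rightarrow> bool) pmf" where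
  "multilayer_sbm_pmf m n d l \<sigma> =
     Pi_pmf {1..m} (\<lambda>_. False) (\<lambda>k. sbm_pmf n (a_par (d k) (l k)) (b_par (d k) (l k)) \<sigma>)"

definition labelled_graphs_pmf ::
  "nat \<Rightarrow> nat \<Rightarrow> (nat \<Rightarrow> real) \<Rightarrow> (nat \<Rightarrow> real) \<Rightarrow> ((nat \<Rightarrow> real) \<times> (nat \<Rightarrow> nat \<times> nat \<Rightarrow> bool)) pmf" where
  "labelled_graphs_pmf m n d l =
     bind_pmf (labels_pmf n) (\<lambda>\<sigma>. map_pmf (Pair \<sigma>) (multilayer_sbm_pmf m n d l \<sigma>))"

definition std_gaussian :: "nat \<Rightarrow> (nat \<Rightarrow> real) measure" where
  "std_gaussian p = (\<Pi>\<^sub>M r\<in>{1..p}. density lborel (\<lambda>x. ennreal (std_normal_density x)))"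

text \<open>
  The joint law of \<open>((\<sigma>, G), (u, Z))\<close>, where \<open>Z i\<close> is the noise vector of vertex \<open>i\<close>. Since
  \<open>(u, Z)\<close> is independent of \<open>(\<sigma>, G)\<close> and the features depend only on \<open>(\<sigma>, u, Z)\<close>, the graphs
  and the features are conditionally independent given \<open>\<sigma>\<close>.
\<close>

definition latent_law ::
  "nat \<Rightarrow> nat \<Rightarrow> nat \<Rightarrow> (nat \<Rightarrow> real) \<Rightarrow> (nat \<Rightarrow> real) \<Rightarrow>
     (((nat \<Rightarrow> real) \<times> (nat \<Rightarrow> nat \<times> nat \<Rightarrow> bool)) \<times> ((nat \<Rightarrow> real) \<times> (nat \<Rightarrow> nat \<Rightarrow> real))) measure" where
  "latent_law m n p d l =
     measure_pmf (labelled_graphs_pmf m n d l) \<Otimes>\<^sub>M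
       (std_gaussian p \<Otimes>\<^sub>M (\<Pi>\<^sub>M i\<in>{1..n}. std_gaussian p))"

definition adjacency :: "nat \<Rightarrow> (nat \<times> nat \<Rightarrow> bool) \<Rightarrow> nat \<times> nat \<Rightarrow> nat" where
  "adjacency n e = (\<lambda>(i, j)\<in>{1..n} \<times> {1..n}. of_bool (i \<noteq> j \<and> e (min i j, max i j)))"

text \<open>The argument \<open>i\<close> selects the column \<open>B\<^sub>i\<close>, the argument \<open>r\<close> its coordinate.\<close>

definition feature_matrix ::
  "nat \<Rightarrow> nat \<Rightarrow> real \<Rightarrow> (nat \<Rightarrow> real) \<Rightarrow> (nat \<Rightarrow> real) \<Rightarrow> (nat \<Rightarrow> nat \<Rightarrow> real) \<Rightarrow> nat \<Rightarrow> nat \<Rightarrow> real" where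
  "feature_matrix n p \<mu> \<sigma> u Z =
     (\<lambda>i\<in>{1..n}. \<lambda>r\<in>{1..p}. sqrt (\<mu> / real n) * \<sigma> i * u r + Z i r)"

definition obs_space ::
  "nat \<Rightarrow> nat \<Rightarrow> nat \<Rightarrow> ((nat \<Rightarrow> nat \<times> nat \<Rightarrow> nat) \<times> (nat \<Rightarrow> nat \<Rightarrow> real)) measure" where
  "obs_space m n p =
     (\<Pi>\<^sub>M k\<in>{1..m}. \<Pi>\<^sub>M ij\<in>{1..n} \<times> {1..n}. count_space {0, 1}) \<Otimes>\<^sub>M
     (\<Pi>\<^sub>M i\<in>{1..n}. \<Pi>\<^sub>M r\<in>{1..p}. borel)"

definition observe ::
  "nat \<Rightarrow> nat \<Rightarrow> nat \<Rightarrow> real \<Rightarrow>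
     ((nat \<Rightarrow> real) \<times> (nat \<Rightarrow> nat \<times> nat \<Rightarrow> bool)) \<times> ((nat \<Rightarrow> real) \<times> (nat \<Rightarrow> nat \<Rightarrow> real)) \<Rightarrow>
     (nat \<Rightarrow> nat \<times> nat \<Rightarrow> nat) \<times> (nat \<Rightarrow> nat \<Rightarrow> real)" where
  "observe m n p \<mu> = (\<lambda>((\<sigma>, G), (u, Z)).
     (\<lambda>k\<in>{1..m}. adjacency n (G k), feature_matrix n p \<mu> \<sigma> u Z))"

definition csbm_law ::
  "nat \<Rightarrow> nat \<Rightarrow> nat \<Rightarrow> (nat \<Rightarrow> real) \<Rightarrow> (nat \<Rightarrow> real) \<Rightarrow> real \<Rightarrow>
     ((nat \<Rightarrow> nat \<times> nat \<Rightarrow> nat) \<times> (nat \<Rightarrow> nat \<Rightarrow> real)) measure" where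
  "csbm_law m n p d l \<mu> = distr (latent_law m n p d l) (obs_space m n p) (observe m n p \<mu>)"

text \<open>Both notions are meant for sequences with \<open>sets (P n) = sets (Q n)\<close>.\<close>

definition contiguous :: "(nat \<Rightarrow> 'a measure) \<Rightarrow> (nat \<Rightarrow> 'a measure) \<Rightarrow> bool" where
  "contiguous Q P \<longleftrightarrow>
     (\<forall>E. (\<forall>n. E n \<in> sets (P n)) \<longrightarrow>
          (\<lambda>n. measure (P n) (E n)) \<longlonglongrightarrow> 0 \<longrightarrow> (\<lambda>n. measure (Q n) (E n)) \<longlonglongrightarrow> 0)"

definition asymp_mutually_singular :: "(nat \<Rightarrow> 'a measure) \<Rightarrow> (nat \<Rightarrow> 'a measure) \<Rightarrow> bool" where
  "asymp_mutually_singular Q P \<longleftrightarrow>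
     (\<exists>E. (\<forall>n. E n \<in> sets (P n)) \<and>
          (\<lambda>n. measure (P n) (E n)) \<longlonglongrightarrow> 0 \<and> (\<lambda>n. measure (Q n) (E n)) \<longlonglongrightarrow> 1)"

lemma sets_csbm_law: "sets (csbm_law m n p d l \<mu>) = sets (obs_space m n p)"
  by (simp add: csbm_law_def)

lemma prob_space_std_gaussian: "prob_space (std_gaussian p)"
  unfolding std_gaussian_def by (intro prob_space_PiM prob_space_normal_density) simp

lemma prob_space_latent_law: "prob_space (latent_law m n p d l)"
  unfolding latent_law_def
  by (intro prob_space_pair prob_space_measure_pmf prob_space_std_gaussian prob_space_PiM)

lemma measurable_observe [measurable]:
  "observe m n p \<mu> \<in> latent_law m n p d l \<rightarrow>\<^sub>M obs_space m n p"
proof -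
  let ?S = "measure_pmf (labelled_graphs_pmf m n d l)"
  let ?N = "std_gaussian p"
  let ?L = "?S \<Otimes>\<^sub>M (?N \<Otimes>\<^sub>M (\<Pi>\<^sub>M i\<in>{1..n}. ?N))"
  have pmf: "(\<lambda>x. f (fst x)) \<in> ?L \<rightarrow>\<^sub>M M" if "\<And>y. f y \<in> space M"
    for f :: "(nat \<Rightarrow> real) \<times> (nat \<Rightarrow> nat \<times> nat \<Rightarrow> bool) \<Rightarrow> 'b" and M
    by (rule measurable_compose[OF measurable_fst]) (simp add: that)
  have N: "(\<lambda>v. v r) \<in> borel_measurable ?N" if "r \<in> {1..p}" for r
    unfolding std_gaussian_def
    using measurable_component_singleton[OF that, of "\<lambda>_. density lborel (\<lambda>x. ennreal (std_normal_density x))"]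
    by simp
  have "(\<lambda>x. \<lambda>k\<in>{1..m}. adjacency n (snd (fst x) k))
          \<in> ?L \<rightarrow>\<^sub>M (\<Pi>\<^sub>M k\<in>{1..m}. \<Pi>\<^sub>M ij\<in>{1..n} \<times> {1..n}. count_space {0, 1})"
    by (rule pmf) (auto simp: space_PiM PiE_iff extensional_def adjacency_def)
  moreover have "(\<lambda>x. feature_matrix n p \<mu> (fst (fst x)) (fst (snd x)) (snd (snd x)))
          \<in> ?L \<rightarrow>\<^sub>M (\<Pi>\<^sub>M i\<in>{1..n}. \<Pi>\<^sub>M r\<in>{1..p}. borel)"
    unfolding feature_matrix_def
  proof (intro measurable_restrict)
    fix i r assume ir: "i \<in> {1..n}" "r \<in> {1..p}"
    have [measurable]: "(\<lambda>x. fst (fst x) i) \<in> borel_measurable ?L"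
      by (rule pmf) simp
    have [measurable]: "(\<lambda>x. fst (snd x) r) \<in> borel_measurable ?L"
      by (rule measurable_compose[OF _ N[OF ir(2)]]) measurable
    have [measurable]: "(\<lambda>x. snd (snd x) i r) \<in> borel_measurable ?L"
      by (rule measurable_compose[OF _ N[OF ir(2)]])
         (rule measurable_compose[OF _ measurable_component_singleton[OF ir(1)]], measurable)
    show "(\<lambda>x. sqrt (\<mu> / real n) * fst (fst x) i * fst (snd x) r + snd (snd x) i r)
            \<in> borel_measurable ?L"
      by measurable
  qed
  ultimately show ?thesis
    unfolding observe_def latent_law_def obs_space_def case_prod_beta
    by (rule measurable_Pair)
qed

lemma prob_space_csbm_law: "prob_space (csbm_law m n p d l \<mu>)"
  unfolding csbm_law_def
  by (intro prob_space.prob_space_distr prob_space_latent_law measurable_observe)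

end

theory Submission
  imports Defs
begin

text \<open>
  Below the threshold, the likelihood ratio given the labels and \<open>u\<close> is restricted to
  \<open>|u|^2 \<le> (1 + \<epsilon>) p\<close>: without this truncation the second moment can be infinite, and Chernoff's bound
  shows that the excluded event is negligible. For two labellings with overlap \<open>S = \<Sum>i. \<sigma> i * \<sigma>' i\<close> the
  truncated second moment is at most \<open>exp (\<theta> S^2 / (2 n))\<close> with \<open>\<theta> < 1\<close>, and averaging over the
  labels gives at most \<open>1 / sqrt (1 - \<theta>)\<close>.

  Above the threshold, vertices and feature coordinates are the nodes of one graph whose edges carry the
  weighted centred observations. The test statistic is the sum, over the cycles of a fixed even length
  \<open>L\<close>, of the products of these signals. Its mean is 0 under the null law and \<open>M \<ge> \<theta>^(L/2) - o(1)\<close> with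
  \<open>\<theta> > 1\<close> under the planted law, while its variance is \<open>O(L M)\<close> under both, because only coinciding
  cycles are correlated to leading order. Chebyshev's inequality gives errors that vanish as \<open>L\<close> grows.
\<close>

section \<open>Cycles on a finite set of nodes\<close>

text \<open>The weights make the mean and the second moment of a signal agree to leading order. A
  cycle then has mean and second moment close to the product of its weights, and the variance is of
  order \<open>L * M\<close> because \<open>2 * L\<close> rooted oriented cycles share one edge set.
  \<open>M\<close> is close to the trace of the \<open>L\<close>-th power of the weight matrix. On
  vectors constant on vertices and on coordinates this matrix has as largest eigenvalue the larger
  root of \<open>R^2 = \<Lambda> * R + \<mu>^2 * p / n\<close>, with \<open>\<Lambda>\<close> the
  sum of the squared \<open>l k\<close>; it exceeds 1 iff
  \<open>\<Lambda> + \<mu>^2 * p / n > 1\<close>. This is where the threshold comes from. Planted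
  second moments depend on the labels to leading order, so their product around a cycle has to be
  averaged, not bounded factor by factor. Below the threshold \<open>\<mu>\<close> may still exceed
  1, if \<open>\<gamma> > 1\<close>. The Gaussian integral over two copies of \<open>u\<close> then
  diverges for labellings with overlap near \<open>n\<close>. Truncation removes this obstacle at
  the price of a factor \<open>1 + \<epsilon>\<close> before \<open>\<mu>^2 / \<gamma>\<close>,
  which the strict inequality absorbs.\<close>

definition edge :: "nat \<Rightarrow> nat \<Rightarrow> nat \<times> nat" where
  "edge x y = (min x y, max x y)"

lemma edge_eq_iff: "edge x y = edge x' y' \<longleftrightarrow> (x = x' \<and> y = y') \<or> (x = y' \<and> y = x')"
  by (auto simp: edge_def min_def max_def split: if_splits)

text \<open>Cycles are rooted and oriented, so one polygon is counted \<open>2 * L\<close> times.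
  This multiplicity costs a factor linear in \<open>L\<close> in the variance, which the exponential
  growth of the mean outweighs.\<close>

definition cycles :: "nat \<Rightarrow> nat set \<Rightarrow> (nat \<Rightarrow> nat) set" where
  "cycles L N = {c \<in> {..<L} \<rightarrow>\<^sub>E N. inj_on c {..<L}}"

definition step :: "nat \<Rightarrow> (nat \<Rightarrow> nat) \<Rightarrow> nat \<Rightarrow> nat \<times> nat" where
  "step L c i = edge (c i) (c (Suc i mod L))"

definition edges :: "nat \<Rightarrow> (nat \<Rightarrow> nat) \<Rightarrow> (nat \<times> nat) set" where
  "edges L c = step L c ` {..<L}"

lemma finite_cycles [simp]: "finite N \<Longrightarrow> finite (cycles L N)"
  unfolding cycles_def by (auto intro!: finite_PiE)

lemma finite_edges [simp]: "finite (edges L c)"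
  by (simp add: edges_def)

lemma Suc_mod_inj:
  assumes "i < L" "j < L" "Suc i mod L = Suc j mod L"
  shows "i = j"
  using assms by (auto simp: mod_Suc split: if_splits)

text \<open>Two steps on the same pair of nodes in opposite directions would make \<open>i\<close>
  both the successor and the predecessor of \<open>j\<close> modulo \<open>L\<close>, which
  \<open>L \<ge> 3\<close> excludes.\<close>

lemma inj_on_step:
  assumes "L \<ge> 3" and "inj_on c {..<L}"
  shows "inj_on (step L c) {..<L}"
proof (rule inj_onI)
  fix i j assume ij: "i \<in> {..<L}" "j \<in> {..<L}" and eq: "step L c i = step L c j"
  have inj: "a = b" if "c a = c b" "a < L" "b < L" for a b
    using inj_onD[OF assms(2)] that by auto
  have m: "Suc i mod L < L" "Suc j mod L < L" using assms(1) by auto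
  from eq consider "c i = c j" | "c i = c (Suc j mod L)" "c (Suc i mod L) = c j"
    unfolding step_def edge_eq_iff by blast
  then show "i = j"
  proof cases
    case 1 then show ?thesis using inj ij by auto
  next
    case 2
    then have "i = Suc j mod L" "Suc i mod L = j" using inj ij m by auto
    then show ?thesis using assms(1) ij by (auto simp: mod_Suc split: if_splits)
  qed
qed

lemma card_edges: "L \<ge> 3 \<Longrightarrow> inj_on c {..<L} \<Longrightarrow> card (edges L c) = L"
  unfolding edges_def by (simp add: card_image inj_on_step)

lemma card_ordered_pairs_le:
  assumes "finite E"
  shows "card {(x, y). edge x y \<in> E} \<le> 2 * card E" and "finite {(x, y). edge x y \<in> E}"
proof -
  have sub: "{(x, y). edge x y \<in> E} \<subseteq> E \<union> prod.swap ` E"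
    by (force simp: edge_def min_def max_def image_iff split: if_splits)
  show "finite {(x, y). edge x y \<in> E}" using sub assms finite_subset by blast
  have "card {(x, y). edge x y \<in> E} \<le> card (E \<union> prod.swap ` E)"
    using sub assms by (intro card_mono) auto
  also have "\<dots> \<le> card E + card (prod.swap ` E)" by (rule card_Un_le)
  also have "\<dots> \<le> 2 * card E" using card_image_le[OF assms, of prod.swap] by simp
  finally show "card {(x, y). edge x y \<in> E} \<le> 2 * card E" .
qed

text \<open>Two consecutive nodes fix the direction of travel. The edge by which \<open>c'\<close>
  leaves the common node \<open>c (Suc k)\<close> is one of the two edges of \<open>c\<close> there,
  and it is not the one to \<open>c k\<close>, because \<open>c'\<close> would then visit
  \<open>c k\<close> twice.\<close>

lemma cycle_determined:
  assumes "L \<ge> 3" and "c \<in> cycles L N" and "c' \<in> cycles L N"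
    and E: "edges L c = edges L c'" and "c 0 = c' 0" and "c 1 = c' 1"
  shows "c = c'"
proof -
  have inj: "a = b" if "c a = c b" "a < L" "b < L" for a b
    using assms(2) that unfolding cycles_def by (auto dest: inj_onD)
  have inj': "a = b" if "c' a = c' b" "a < L" "b < L" for a b
    using assms(3) that unfolding cycles_def by (auto dest: inj_onD)
  have agree: "c i = c' i" if "i < L" for i
    using that
  proof (induction i rule: less_induct)
    case (less i)
    show ?case
    proof (cases "i < 2")
      case True
      then have "i = 0 \<or> i = 1" by auto
      then show ?thesis using assms by auto
    next
      case False
      then obtain k where k: "i = Suc (Suc k)"
        by (metis One_nat_def Suc_1 add_2_eq_Suc le_add_diff_inverse not_less)
      have h: "c (Suc k) = c' (Suc k)" "c k = c' k" using less k by auto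
      have kL: "Suc (Suc k) < L" using less k by simp
      have "step L c' (Suc k) \<in> edges L c'" using kL by (auto simp: edges_def)
      then obtain j where j: "j < L" "step L c' (Suc k) = step L c j"
        unfolding E[symmetric] by (auto simp: edges_def)
      then have "edge (c' (Suc k)) (c' (Suc (Suc k))) = edge (c j) (c (Suc j mod L))"
        using kL by (simp add: step_def)
      then consider "c' (Suc k) = c j" "c' (Suc (Suc k)) = c (Suc j mod L)"
        | "c' (Suc k) = c (Suc j mod L)" "c' (Suc (Suc k)) = c j"
        unfolding edge_eq_iff by blast
      then show ?thesis
      proof cases
        case 1
        then have "j = Suc k" using inj[of j "Suc k"] h j kL by auto
        then show ?thesis using 1 kL k by simp
      next
        case 2
        have "Suc j mod L < L" using kL by (intro mod_less_divisor) auto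
        then have "Suc j mod L = Suc k mod L" using inj[of "Suc j mod L" "Suc k"] 2 h kL by auto
        then have "j = k" using Suc_mod_inj[OF j(1), of k] kL by auto
        then have "c' (Suc (Suc k)) = c' k" using 2 h by simp
        then have "Suc (Suc k) = k" using inj'[of "Suc (Suc k)" k] kL by auto
        then show ?thesis by simp
      qed
    qed
  qed
  show ?thesis
    using assms(2,3) agree unfolding cycles_def by (intro PiE_ext[of c "{..<L}" "\<lambda>_. N"]) auto
qed

text \<open>The first two nodes determine the cycle, and they form one of the \<open>L\<close> edges
  in one of two orders.\<close>

lemma card_same_edges_le:
  assumes "L \<ge> 3" and "c \<in> cycles L N"
  shows "card {c' \<in> cycles L N. edges L c' = edges L c} \<le> 2 * L"
proof -
  let ?A = "{c' \<in> cycles L N. edges L c' = edges L c}"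
  have "inj_on (\<lambda>c'. (c' 0, c' 1)) ?A"
    by (rule inj_onI) (use assms in \<open>auto intro: cycle_determined\<close>)
  moreover have "(\<lambda>c'. (c' 0, c' 1)) ` ?A \<subseteq> {(x, y). edge x y \<in> edges L c}"
  proof safe
    fix c' assume "edges L c' = edges L c"
    moreover have "step L c' 0 \<in> edges L c'" using assms by (auto simp: edges_def)
    ultimately show "edge (c' 0) (c' 1) \<in> edges L c"
      using assms by (simp add: step_def)
  qed
  ultimately have "card ?A \<le> card {(x, y). edge x y \<in> edges L c}"
    by (rule card_inj_on_le) (simp add: card_ordered_pairs_le)
  also have "\<dots> \<le> 2 * card (edges L c)" by (rule card_ordered_pairs_le) simp
  also have "card (edges L c) = L" using assms by (intro card_edges) (auto simp: cycles_def)
  finally show ?thesis by simp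
qed

section \<open>Counting cycles by the steps they share with a given cycle\<close>

definition shared :: "nat \<Rightarrow> (nat \<Rightarrow> nat) \<Rightarrow> (nat \<Rightarrow> nat) \<Rightarrow> nat set" where
  "shared L c c' = {i \<in> {..<L}. step L c' i \<in> edges L c}"

lemma edges_vertices: "edge x y \<in> edges L c \<Longrightarrow> x \<in> c ` {..<L} \<and> y \<in> c ` {..<L}"
  unfolding edges_def step_def by (auto simp: edge_eq_iff image_iff intro: mod_less_divisor)

lemma card_PiE_if:
  fixes N :: "nat set"
  assumes "P \<subseteq> {..<L}"
  shows "card (\<Pi>\<^sub>E i\<in>{..<L}. if i \<in> P then A else N) = card A ^ card P * card N ^ (L - card P)"
proof -
  have "card (\<Pi>\<^sub>E i\<in>{..<L}. if i \<in> P then A else N) = (\<Prod>i<L. if i \<in> P then card A else card N)"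
    by (simp add: card_PiE if_distrib)
  also have "\<dots> = (\<Prod>i\<in>{..<L} \<inter> P. card A) * (\<Prod>i\<in>{..<L} - P. card N)"
    by (subst prod.If_cases) (auto simp: Diff_eq)
  also have "{..<L} \<inter> P = P" using assms by auto
  also have "(\<Prod>i\<in>{..<L} - P. card N) = card N ^ (L - card P)"
    using assms by (simp add: card_Diff_subset finite_subset)
  finally show "card (\<Pi>\<^sub>E i\<in>{..<L}. if i \<in> P then A else N) = card A ^ card P * card N ^ (L - card P)"
    by simp
qed

text \<open>Start and end points of shared steps lie on \<open>c\<close>. A proper nonempty set
  \<open>S\<close> of positions is not closed under the cyclic successor, so besides the positions
  in \<open>S\<close> one more is confined to \<open>c\<close>; for \<open>S = {}\<close> the common
  node is that one, with \<open>L\<close> choices of its position. The confined positions admit at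
  most \<open>L ^ L\<close> assignments, and the remaining \<open>L - card S - 1\<close> are
  free.\<close>

lemma card_shared_le:
  assumes L: "L \<ge> 3" and c: "c \<in> cycles L N" and N: "finite N" and S: "S \<subset> {..<L}"
  shows "card {c' \<in> cycles L N. c' ` {..<L} \<inter> c ` {..<L} \<noteq> {} \<and> shared L c c' = S}
      \<le> L * (L ^ L * card N ^ (L - card S - 1))" (is "card ?A \<le> _")
proof -
  let ?V = "c ` {..<L}"
  have cV: "card ?V \<le> L" using card_image_le[of "{..<L}" c] by simp
  have fin: "finite (\<Pi>\<^sub>E i\<in>{..<L}. if i \<in> P then ?V else N)" for P
    using N by (intro finite_PiE) auto
  have cS: "card S < L" using psubset_card_mono[OF _ S] by simp
  have bound: "card (\<Pi>\<^sub>E i\<in>{..<L}. if i \<in> P then ?V else N) \<le> L ^ L * card N ^ (L - card S - 1)"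
    if "P \<subseteq> {..<L}" "card P = Suc (card S)" for P
  proof -
    have "card ?V ^ card P \<le> L ^ card P" using cV by (rule power_mono) simp
    also have "\<dots> \<le> L ^ L" using that cS L by (intro power_increasing) auto
    finally show ?thesis using card_PiE_if[OF that(1), of ?V N] that(2) by simp
  qed
  show ?thesis
  proof (cases "S = {}")
    case True
    have "?A \<subseteq> (\<Union>i\<in>{..<L}. \<Pi>\<^sub>E j\<in>{..<L}. if j \<in> {i} then ?V else N)"
    proof
      fix c' assume c': "c' \<in> ?A"
      then obtain i where "i < L" "c' i \<in> ?V" by auto
      then have "c' \<in> (\<Pi>\<^sub>E j\<in>{..<L}. if j \<in> {i} then ?V else N)"
        using c' unfolding cycles_def by (auto simp: PiE_iff)
      then show "c' \<in> (\<Union>i\<in>{..<L}. \<Pi>\<^sub>E j\<in>{..<L}. if j \<in> {i} then ?V else N)"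
        using \<open>i < L\<close> by blast
    qed
    then have "card ?A \<le> card (\<Union>i\<in>{..<L}. \<Pi>\<^sub>E j\<in>{..<L}. if j \<in> {i} then ?V else N)"
      by (intro card_mono finite_UN_I fin) auto
    also have "\<dots> \<le> (\<Sum>i<L. card (\<Pi>\<^sub>E j\<in>{..<L}. if j \<in> {i} then ?V else N))"
      by (intro card_UN_le) auto
    also have "\<dots> \<le> (\<Sum>i<L. L ^ L * card N ^ (L - card S - 1))"
      using True by (intro sum_mono bound) auto
    finally show ?thesis by simp
  next
    case False
    have "\<exists>i\<in>S. Suc i mod L \<notin> S"
    proof (rule ccontr)
      assume "\<not> ?thesis"
      then have cl: "\<And>i. i \<in> S \<Longrightarrow> Suc i mod L \<in> S" by auto
      from False obtain s where s: "s \<in> S" by auto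
      have "(s + k) mod L \<in> S" for k
      proof (induction k)
        case 0 then show ?case using s S by auto
      next
        case (Suc k) then show ?case using cl[OF Suc] by (simp add: mod_Suc_eq)
      qed
      then have *: "(s + ((L - s) + i)) mod L \<in> S" for i .
      have "s < L" using s S by auto
      then have "i \<in> S" if "i < L" for i
        using that *[of i] by simp
      then show False using S by auto
    qed
    then obtain i where i: "i \<in> S" "Suc i mod L \<notin> S" by auto
    let ?P = "insert (Suc i mod L) S"
    have finS: "finite S" using S finite_subset by blast
    have "?A \<subseteq> (\<Pi>\<^sub>E j\<in>{..<L}. if j \<in> ?P then ?V else N)"
    proof
      fix c' assume "c' \<in> ?A"
      then have c': "c' \<in> cycles L N" "shared L c c' = S" by auto
      have "c' j \<in> ?V" if "j \<in> ?P" for j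
        using that c'(2) i(1) unfolding shared_def step_def by (auto dest!: edges_vertices)
      then show "c' \<in> (\<Pi>\<^sub>E j\<in>{..<L}. if j \<in> ?P then ?V else N)"
        using c' unfolding cycles_def by (auto simp: PiE_iff)
    qed
    then have "card ?A \<le> card (\<Pi>\<^sub>E j\<in>{..<L}. if j \<in> ?P then ?V else N)"
      by (intro card_mono fin)
    also have "\<dots> \<le> L ^ L * card N ^ (L - card S - 1)"
      using S i finS L by (intro bound) (auto intro: mod_less_divisor)
    also have "\<dots> \<le> L * (L ^ L * card N ^ (L - card S - 1))" using L by simp
    finally show ?thesis .
  qed
qed

lemma card_edges_Un:
  assumes "L \<ge> 3" "c \<in> cycles L N" "c' \<in> cycles L N"
  shows "card (edges L c \<union> edges L c') = 2 * L - card (shared L c c')"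
    and "card (shared L c c') \<le> L"
    and "card (shared L c c') = L \<Longrightarrow> edges L c' = edges L c"
proof -
  have i: "inj_on c {..<L}" "inj_on c' {..<L}" using assms by (auto simp: cycles_def)
  have *: "edges L c \<inter> edges L c' = step L c' ` shared L c c'"
    unfolding edges_def shared_def by auto
  have sub: "shared L c c' \<subseteq> {..<L}" by (auto simp: shared_def)
  have int: "card (edges L c \<inter> edges L c') = card (shared L c c')"
    unfolding * using inj_on_subset[OF inj_on_step[OF assms(1) i(2)] sub] by (rule card_image)
  show "card (shared L c c') \<le> L" using card_mono[OF _ sub] by simp
  show "card (edges L c \<union> edges L c') = 2 * L - card (shared L c c')"
    using card_Un_Int[of "edges L c" "edges L c'"] int card_edges assms i by simp
  assume "card (shared L c c') = L"
  then have "edges L c \<inter> edges L c' = edges L c" "edges L c \<inter> edges L c' = edges L c'"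
    using int card_edges[OF assms(1)] i by (intro card_subset_eq; simp)+
  then show "edges L c' = edges L c" by simp
qed

text \<open>
  Here \<open>q c c'\<close> stands for the mixed moment of the signals of two cycles and \<open>e c\<close> for a mean. A cycle
  that shares \<open>s\<close> edges with \<open>c\<close>, where \<open>0 < s < L\<close>, has at least \<open>s + 1\<close> of its nodes on \<open>c\<close>, so these
  cycles contribute one factor \<open>1 / n\<close> less than the disjoint ones.
\<close>

lemma sum_pairs_of_cycles_le:
  fixes q :: "(nat \<Rightarrow> nat) \<Rightarrow> (nat \<Rightarrow> nat) \<Rightarrow> real"
  assumes L: "L \<ge> 3" and N: "finite N" and n: "real n \<ge> 1" and cN: "real (card N) \<le> D * real n" and D: "D \<ge> 1"
    and C: "C \<ge> 1" and A: "A \<ge> 0"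
    and disj: "\<And>c c'. c \<in> cycles L N \<Longrightarrow> c' \<in> cycles L N \<Longrightarrow> c ` {..<L} \<inter> c' ` {..<L} = {} \<Longrightarrow> q c c' \<le> e c * e c'"
    and epos: "\<And>c. c \<in> cycles L N \<Longrightarrow> e c \<ge> 0"
    and same: "\<And>c c'. c \<in> cycles L N \<Longrightarrow> c' \<in> cycles L N \<Longrightarrow> edges L c' = edges L c \<Longrightarrow> q c c' \<le> A * w c"
    and wpos: "\<And>c. c \<in> cycles L N \<Longrightarrow> w c \<ge> 0"
    and mixed: "\<And>c c'. c \<in> cycles L N \<Longrightarrow> c' \<in> cycles L N \<Longrightarrow> q c c' \<le> C * (C / real n) ^ card (edges L c \<union> edges L c')"
  shows "(\<Sum>c\<in>cycles L N. \<Sum>c'\<in>cycles L N. q c c')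
    \<le> (\<Sum>c\<in>cycles L N. e c)\<^sup>2 + 2 * real L * A * (\<Sum>c\<in>cycles L N. w c)
       + 2 ^ L * real L * real L ^ L * D ^ (2 * L) * C ^ (2 * L + 1) / real n"
proof -
  let ?Y = "cycles L N"
  \<comment> \<open>All overlapping cycles of one row: \<open>2 ^ L\<close> sets \<open>S\<close> of
    shared positions, each with at most \<open>L * L ^ L * (D * n) ^ (L - s - 1)\<close> cycles,
    each worth at most \<open>C * (C / n) ^ (2 * L - s)\<close>, where \<open>s = card S\<close>.
    The powers of \<open>n\<close> combine to \<open>1 / n ^ (L + 1)\<close> whatever
    \<open>s\<close> is, and the at most \<open>(D * n) ^ L\<close> rows leave
    \<open>1 / n\<close>.\<close>
  define K where "K = 2 ^ L * real L * real L ^ L * D ^ L * C ^ (2 * L + 1) / real n ^ (L + 1)"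
  have row: "(\<Sum>c'\<in>?Y. q c c') \<le> (\<Sum>c'\<in>?Y. e c * e c') + 2 * real L * A * w c + K" if c: "c \<in> ?Y" for c
  proof -
    define Y1 where "Y1 = {c'\<in>?Y. c ` {..<L} \<inter> c' ` {..<L} = {}}"
    define Y2 where "Y2 = {c'\<in>?Y. edges L c' = edges L c}"
    define Y3 where "Y3 S = {c' \<in> ?Y. c' ` {..<L} \<inter> c ` {..<L} \<noteq> {} \<and> shared L c c' = S}" for S
    let ?Ss = "{S. S \<subset> {..<L}}"
    have finSs: "finite ?Ss" by (rule finite_subset[of _ "Pow {..<L}"]) auto
    have [simp]: "finite Y1" "finite Y2" "\<And>S. finite (Y3 S)" using N by (auto simp: Y1_def Y2_def Y3_def)
    have Y: "?Y = Y1 \<union> (Y2 \<union> (\<Union>S\<in>?Ss. Y3 S)) "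
    proof -
      have "c' \<in> Y1 \<or> c' \<in> Y2 \<or> (\<exists>S\<in>?Ss. c' \<in> Y3 S)" if c': "c' \<in> ?Y" for c'
      proof (cases "shared L c c' = {..<L}")
        case True
        then show ?thesis using card_edges_Un(3)[OF L c c'] c' by (auto simp: Y2_def)
      next
        case False
        then have "shared L c c' \<in> ?Ss" by (auto simp: shared_def)
        then show ?thesis using c' by (auto simp: Y1_def Y3_def)
      qed
      then have "?Y \<subseteq> Y1 \<union> (Y2 \<union> (\<Union>S\<in>?Ss. Y3 S))" by blast
      moreover have "Y1 \<subseteq> ?Y" "Y2 \<subseteq> ?Y" "\<And>S. Y3 S \<subseteq> ?Y"
        unfolding Y1_def Y2_def Y3_def by (rule Collect_restrict)+
      then have "Y1 \<union> (Y2 \<union> (\<Union>S\<in>?Ss. Y3 S)) \<subseteq> ?Y"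
        by (intro Un_least UN_least)
      ultimately show ?thesis by (rule equalityI)
    qed
    \<comment> \<open>Every cycle is charged to at least one class. All charges are nonnegative, so
      it does not matter for the upper bound whether the classes overlap.\<close>
    have "(\<Sum>c'\<in>?Y. q c c') \<le> (\<Sum>c'\<in>?Y. (if c' \<in> Y1 then e c * e c' else 0)
        + (if c' \<in> Y2 then A * w c else 0)
        + (\<Sum>S\<in>?Ss. if c' \<in> Y3 S then C * (C / real n) ^ (2 * L - card S) else 0))"
    proof (rule sum_mono)
      fix c' assume c': "c' \<in> ?Y"
      have p3: "0 \<le> (\<Sum>S\<in>?Ss. if c' \<in> Y3 S then C * (C / real n) ^ (2 * L - card S) else 0)"
        using C n by (intro sum_nonneg) auto
      have p1: "0 \<le> e c * e c'" using epos c c' by simp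
      have p2: "0 \<le> A * w c" using wpos c A by simp
      consider "c' \<in> Y1" | "c' \<in> Y2" | S where "S \<in> ?Ss" "c' \<in> Y3 S" using c' Y by auto
      then show "q c c' \<le> (if c' \<in> Y1 then e c * e c' else 0) + (if c' \<in> Y2 then A * w c else 0)
        + (\<Sum>S\<in>?Ss. if c' \<in> Y3 S then C * (C / real n) ^ (2 * L - card S) else 0)"
      proof cases
        case 1
        then have "q c c' \<le> e c * e c'" using disj[OF c c'] by (auto simp: Y1_def)
        then show ?thesis using 1 p2 p3 by auto
      next
        case 2
        then have "q c c' \<le> A * w c" using same[OF c c'] by (auto simp: Y2_def)
        then show ?thesis using 2 p1 p3 by auto
      next
        case 3
        have "q c c' \<le> C * (C / real n) ^ (2 * L - card S)"
          using mixed[OF c c'] card_edges_Un(1)[OF L c c'] 3 by (simp add: Y3_def)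
        also have "\<dots> = (if c' \<in> Y3 S then C * (C / real n) ^ (2 * L - card S) else 0)" using 3 by simp
        also have "\<dots> \<le> (\<Sum>S\<in>?Ss. if c' \<in> Y3 S then C * (C / real n) ^ (2 * L - card S) else 0)"
          using C n finSs by (intro member_le_sum[OF 3(1)]) auto
        finally show ?thesis using p1 p2 by auto
      qed
    qed
    also have "\<dots> = (\<Sum>c'\<in>?Y. if c' \<in> Y1 then e c * e c' else 0) + (\<Sum>c'\<in>?Y. if c' \<in> Y2 then A * w c else 0)
       + (\<Sum>S\<in>?Ss. \<Sum>c'\<in>?Y. if c' \<in> Y3 S then C * (C / real n) ^ (2 * L - card S) else 0)"
      by (subst sum.swap) (simp add: sum.distrib)
    \<comment> \<open>Extending the sum to all \<open>c'\<close> makes the rows add up to the square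
      of the total mean, which the variance subtracts again.\<close>
    also have "(\<Sum>c'\<in>?Y. if c' \<in> Y1 then e c * e c' else 0) \<le> (\<Sum>c'\<in>?Y. e c * e c')"
      using epos c by (intro sum_mono) auto
    also have "(\<Sum>c'\<in>?Y. if c' \<in> Y2 then A * w c else 0) = real (card Y2) * (A * w c)"
      using N by (subst sum.If_cases) (auto simp: Y2_def Int_def intro!: arg_cong[where f=card])
    also have "\<dots> \<le> real (2 * L) * (A * w c)"
      using card_same_edges_le[OF L c] wpos[OF c] A unfolding Y2_def by (intro mult_right_mono) auto
    also have "(\<Sum>S\<in>?Ss. \<Sum>c'\<in>?Y. if c' \<in> Y3 S then C * (C / real n) ^ (2 * L - card S) else 0)
       = (\<Sum>S\<in>?Ss. real (card (Y3 S)) * (C * (C / real n) ^ (2 * L - card S)))"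
    proof (rule sum.cong[OF refl])
      fix S
      have "?Y \<inter> {c'. c' \<in> Y3 S} = Y3 S" by (auto simp: Y3_def)
      then show "(\<Sum>c'\<in>?Y. if c' \<in> Y3 S then C * (C / real n) ^ (2 * L - card S) else 0)
         = real (card (Y3 S)) * (C * (C / real n) ^ (2 * L - card S))"
        using N by (subst sum.If_cases) auto
    qed
    also have "\<dots> \<le> (\<Sum>S\<in>?Ss. K / 2 ^ L)"
    proof (rule sum_mono)
      fix S assume S: "S \<in> ?Ss"
      then have cS: "card S < L" using psubset_card_mono[of "{..<L}" S] by simp
      have "real (card (Y3 S)) \<le> real (L * (L ^ L * card N ^ (L - card S - 1)))"
        unfolding Y3_def using card_shared_le[OF L c N] S by (intro of_nat_mono) auto
      also have "\<dots> = real L * real L ^ L * real (card N) ^ (L - card S - 1)" by simp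
      also have "\<dots> \<le> real L * real L ^ L * (D * real n) ^ (L - card S - 1)"
        using cN by (intro mult_left_mono power_mono) auto
      also have "\<dots> = real L * real L ^ L * D ^ (L - card S - 1) * real n ^ (L - card S - 1)"
        by (simp add: power_mult_distrib)
      also have "\<dots> \<le> real L * real L ^ L * D ^ L * real n ^ (L - card S - 1)"
        using D by (intro mult_right_mono mult_left_mono power_increasing) auto
      finally have 1: "real (card (Y3 S)) \<le> real L * real L ^ L * D ^ L * real n ^ (L - card S - 1)" .
      have 2: "C * (C / real n) ^ (2 * L - card S) \<le> C ^ (2 * L + 1) / real n ^ (2 * L - card S)"
      proof -
        have "C * C ^ (2 * L - card S) = C ^ (2 * L - card S + 1)" by simp
        also have "\<dots> \<le> C ^ (2 * L + 1)" using C by (intro power_increasing) auto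
        finally show ?thesis using n by (simp add: power_divide divide_right_mono)
      qed
      have "real (card (Y3 S)) * (C * (C / real n) ^ (2 * L - card S))
         \<le> (real L * real L ^ L * D ^ L * real n ^ (L - card S - 1)) * (C ^ (2 * L + 1) / real n ^ (2 * L - card S))"
        using 1 2 C n D by (intro mult_mono) auto
      also have "\<dots> = K / 2 ^ L"
      proof -
        have "2 * L - card S = (L - card S - 1) + (L + 1)" using cS by simp
        then have "real n ^ (2 * L - card S) = real n ^ (L - card S - 1) * real n ^ (L + 1)"
          by (simp only: power_add)
        then show ?thesis unfolding K_def using n by (simp add: field_simps)
      qed
      finally show "real (card (Y3 S)) * (C * (C / real n) ^ (2 * L - card S)) \<le> K / 2 ^ L" .
    qed
    also have "\<dots> \<le> K"
    proof -
      have "card ?Ss \<le> card (Pow {..<L})" by (intro card_mono) auto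
      then have "real (card ?Ss) \<le> 2 ^ L" by (simp add: card_Pow numeral_power_le_of_nat_cancel_iff)
      moreover have "K \<ge> 0" using C D n unfolding K_def by auto
      ultimately have "real (card ?Ss) * K \<le> 2 ^ L * K" by (intro mult_right_mono)
      then show ?thesis by (simp add: field_simps)
    qed
    finally show ?thesis by simp
  qed
  have "(\<Sum>c\<in>?Y. \<Sum>c'\<in>?Y. q c c') \<le> (\<Sum>c\<in>?Y. (\<Sum>c'\<in>?Y. e c * e c') + 2 * real L * A * w c + K)"
    by (intro sum_mono row)
  also have "\<dots> = (\<Sum>c\<in>?Y. e c)\<^sup>2 + 2 * real L * A * (\<Sum>c\<in>?Y. w c) + real (card ?Y) * K"
    unfolding power2_eq_square sum_product by (simp add: sum.distrib sum_distrib_left)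
  also have "real (card ?Y) * K \<le> (D * real n) ^ L * K"
  proof (rule mult_right_mono)
    have "card ?Y \<le> card ({..<L} \<rightarrow>\<^sub>E N)" unfolding cycles_def
      using N by (intro card_mono finite_PiE) auto
    then have "real (card ?Y) \<le> real (card N) ^ L" by (simp add: card_PiE flip: of_nat_power)
    also have "\<dots> \<le> (D * real n) ^ L" using cN by (intro power_mono) auto
    finally show "real (card ?Y) \<le> (D * real n) ^ L" .
  qed (use C D n in \<open>auto simp: K_def\<close>)
  also have "(D * real n) ^ L * K = 2 ^ L * real L * real L ^ L * D ^ (2 * L) * C ^ (2 * L + 1) / real n"
  proof -
    have "D ^ (2 * L) = D ^ L * D ^ L" by (simp add: mult_2 power_add)
    then show ?thesis unfolding K_def using n by (simp add: power_mult_distrib)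
  qed
  finally show ?thesis by simp
qed

section \<open>Weighted closed walks\<close>

text \<open>The entries of the \<open>k\<close>-th power of the matrix \<open>w\<close> on
  \<open>N\<close>.\<close>

primrec walk :: "(nat \<Rightarrow> nat \<Rightarrow> real) \<Rightarrow> nat set \<Rightarrow> nat \<Rightarrow> nat \<Rightarrow> nat \<Rightarrow> real" where
  "walk w N 0 x y = of_bool (x = y)"
| "walk w N (Suc k) x y = (\<Sum>z\<in>N. walk w N k x z * w z y)"

lemma sum_PiE_Suc:
  "(\<Sum>c\<in>{..<Suc k} \<rightarrow>\<^sub>E N. f c) = (\<Sum>c\<in>{..<k} \<rightarrow>\<^sub>E N. \<Sum>y\<in>N. f (c(k := y)))"
proof -
  have "inj_on (\<lambda>(y, g). g(k := y)) (N \<times> ({..<k} \<rightarrow>\<^sub>E N))"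
    by (rule inj_combinator) simp
  then have "(\<Sum>c\<in>{..<Suc k} \<rightarrow>\<^sub>E N. f c) = (\<Sum>(y, c)\<in>N \<times> ({..<k} \<rightarrow>\<^sub>E N). f (c(k := y)))"
    unfolding lessThan_Suc PiE_insert_eq by (simp add: sum.reindex case_prod_beta')
  also have "\<dots> = (\<Sum>y\<in>N. \<Sum>c\<in>{..<k} \<rightarrow>\<^sub>E N. f (c(k := y)))"
    by (simp add: sum.cartesian_product)
  also have "\<dots> = (\<Sum>c\<in>{..<k} \<rightarrow>\<^sub>E N. \<Sum>y\<in>N. f (c(k := y)))"
    by (rule sum.swap)
  finally show ?thesis .
qed

text \<open>The function \<open>g\<close> of the two end points carries the induction: the last step
  of the walk is absorbed into it. With \<open>g x y = w y x\<close> it closes the walk, which gives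
  the trace formula.\<close>

lemma sum_walks:
  "(\<Sum>c\<in>{..<Suc k} \<rightarrow>\<^sub>E N. (\<Prod>i<k. w (c i) (c (Suc i))) * g (c 0) (c k))
     = (\<Sum>x\<in>N. \<Sum>y\<in>N. walk w N k x y * g x y)"
proof (induction k arbitrary: g)
  case 0
  have "x \<in> N \<Longrightarrow> (\<Sum>y\<in>N. of_bool (x = y) * g x y) = g x x" if "finite N" for x
    using that by (simp add: of_bool_def if_distrib[of "\<lambda>t. t * _"] cong: if_cong)
  then show ?case by (cases "finite N") (auto simp: sum_PiE_Suc)
next
  case (Suc k)
  have "(\<Sum>c\<in>{..<Suc (Suc k)} \<rightarrow>\<^sub>E N. (\<Prod>i<Suc k. w (c i) (c (Suc i))) * g (c 0) (c (Suc k)))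
      = (\<Sum>c\<in>{..<Suc k} \<rightarrow>\<^sub>E N. (\<Prod>i<k. w (c i) (c (Suc i))) * (\<Sum>z\<in>N. w (c k) z * g (c 0) z))"
    by (subst sum_PiE_Suc) (simp add: sum_distrib_left mult.assoc)
  also have "\<dots> = (\<Sum>x\<in>N. \<Sum>y\<in>N. walk w N k x y * (\<Sum>z\<in>N. w y z * g x z))"
    by (rule Suc)
  also have "\<dots> = (\<Sum>x\<in>N. \<Sum>y\<in>N. \<Sum>z\<in>N. walk w N k x y * w y z * g x z)"
    by (simp add: sum_distrib_left mult.assoc)
  also have "\<dots> = (\<Sum>x\<in>N. \<Sum>z\<in>N. \<Sum>y\<in>N. walk w N k x y * w y z * g x z)"
    by (intro sum.cong[OF refl] sum.swap)
  finally show ?case by (simp add: sum_distrib_right)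
qed

definition cycle_weight :: "nat \<Rightarrow> (nat \<Rightarrow> nat \<Rightarrow> real) \<Rightarrow> (nat \<Rightarrow> nat) \<Rightarrow> real" where
  "cycle_weight L w c = (\<Prod>i<L. w (c i) (c (Suc i mod L)))"

lemma sum_closed_walks:
  assumes "L > 0"
  shows "(\<Sum>c\<in>{..<L} \<rightarrow>\<^sub>E N. cycle_weight L w c) = (\<Sum>x\<in>N. walk w N L x x)"
proof -
  obtain k where L: "L = Suc k" using assms by (cases L) auto
  have "cycle_weight L w c = (\<Prod>i<k. w (c i) (c (Suc i))) * w (c k) (c 0)" for c
    unfolding cycle_weight_def L by simp
  then show ?thesis using sum_walks[where g = "\<lambda>x y. w y x"] unfolding L by simp
qed

lemma walk_nonneg: "(\<And>x y. w x y \<ge> 0) \<Longrightarrow> walk w N k x y \<ge> 0"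
  by (induction k arbitrary: y) (auto intro!: sum_nonneg)

lemma walk_add:
  assumes "finite N" "y \<in> N"
  shows "walk w N (a + b) x y = (\<Sum>z\<in>N. walk w N a x z * walk w N b z y)"
  using assms(2)
proof (induction b arbitrary: y)
  case 0
  then show ?case using assms(1) by (simp add: of_bool_def if_distrib[of "\<lambda>t. _ * t"] cong: if_cong)
next
  case (Suc b)
  have "walk w N (a + Suc b) x y = (\<Sum>t\<in>N. (\<Sum>z\<in>N. walk w N a x z * walk w N b z t) * w t y)"
    using Suc by simp
  also have "\<dots> = (\<Sum>t\<in>N. \<Sum>z\<in>N. walk w N a x z * (walk w N b z t * w t y))"
    by (simp add: sum_distrib_right mult.assoc)
  also have "\<dots> = (\<Sum>z\<in>N. \<Sum>t\<in>N. walk w N a x z * (walk w N b z t * w t y))"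
    by (rule sum.swap)
  finally show ?case by (simp add: sum_distrib_left)
qed

lemma walk_sym:
  assumes "finite N" "\<And>x y. w x y = w y x" "x \<in> N" "y \<in> N"
  shows "walk w N k x y = walk w N k y x"
  using assms(3,4)
proof (induction k arbitrary: x y)
  case (Suc k)
  have 1: "walk w N 1 y z = w y z" if "z \<in> N" for z
    using assms(1) Suc.prems by (simp add: of_bool_def if_distrib[of "\<lambda>t. t * _"] cong: if_cong)
  have "walk w N k x z * w z y = walk w N 1 y z * walk w N k z x" if "z \<in> N" for z
    unfolding 1[OF that] Suc.IH[OF Suc.prems(1) that] assms(2)[of z y] by (rule mult.commute)
  then have "walk w N (Suc k) x y = (\<Sum>z\<in>N. walk w N 1 y z * walk w N k z x)"
    by (simp del: One_nat_def)
  also have "\<dots> = walk w N (1 + k) y x" using walk_add[OF assms(1) Suc.prems(1)] by metis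
  finally show ?case by simp
qed auto

text \<open>Nonnegative weights preserve an inequality between vectors, so
  \<open>R * v \<le> w v\<close> can be iterated. A trial vector thus takes the place of an
  eigenvector.\<close>

lemma walk_supersolution:
  assumes "\<And>x y. w x y \<ge> 0" and R: "R \<ge> 0"
    and v: "\<And>x. x \<in> N \<Longrightarrow> R * v x \<le> (\<Sum>y\<in>N. w x y * v y)" and "finite N" "x \<in> N"
  shows "R ^ k * v x \<le> (\<Sum>y\<in>N. walk w N k x y * v y)"
proof (induction k)
  case 0
  then show ?case using assms by (simp add: of_bool_def if_distrib[of "\<lambda>t. t * _"] cong: if_cong)
next
  case (Suc k)
  have "R ^ Suc k * v x \<le> R * (\<Sum>y\<in>N. walk w N k x y * v y)"
    using Suc R by (simp add: mult.assoc mult_left_mono)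
  also have "\<dots> = (\<Sum>y\<in>N. walk w N k x y * (R * v y))"
    by (simp add: sum_distrib_left mult_ac)
  also have "\<dots> \<le> (\<Sum>y\<in>N. walk w N k x y * (\<Sum>z\<in>N. w y z * v z))"
    using v walk_nonneg[of w] assms(1) by (intro sum_mono mult_left_mono) auto
  also have "\<dots> = (\<Sum>y\<in>N. \<Sum>z\<in>N. walk w N k x y * w y z * v z)"
    by (simp add: sum_distrib_left mult.assoc)
  also have "\<dots> = (\<Sum>z\<in>N. \<Sum>y\<in>N. walk w N k x y * w y z * v z)"
    by (rule sum.swap)
  finally show ?case by (simp add: sum_distrib_right)
qed

text \<open>A closed walk of length \<open>2 * k\<close> splits in two halves; then Cauchy-Schwarz against \<open>v\<close>.\<close>

lemma closed_walks_ge: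
  assumes N: "finite N" and sym: "\<And>x y. w x y = w y x" and nn: "\<And>x y. w x y \<ge> 0" and R: "R \<ge> 0"
    and v: "\<And>x. x \<in> N \<Longrightarrow> R * v x \<le> (\<Sum>y\<in>N. w x y * v y)" and vpos: "\<And>x. v x \<ge> 0"
    and V: "(\<Sum>x\<in>N. (v x)\<^sup>2) > 0"
  shows "(\<Sum>x\<in>N. walk w N (k + k) x x) \<ge> R ^ (2 * k)"
proof -
  let ?V = "\<Sum>x\<in>N. (v x)\<^sup>2"
  have "(R ^ k * v x)\<^sup>2 / ?V \<le> walk w N (k + k) x x" if x: "x \<in> N" for x
  proof -
    have "(R ^ k * v x)\<^sup>2 \<le> (\<Sum>y\<in>N. walk w N k x y * v y)\<^sup>2"
      using walk_supersolution[OF nn R v N x] vpos R by (intro power_mono) auto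
    also have "\<dots> \<le> (\<Sum>y\<in>N. (walk w N k x y)\<^sup>2) * ?V"
      by (rule Cauchy_Schwarz_ineq_sum)
    also have "(\<Sum>y\<in>N. (walk w N k x y)\<^sup>2) = walk w N (k + k) x x"
      unfolding walk_add[OF N x, of w k k x] power2_eq_square
      by (intro sum.cong refl arg_cong2[where f="(*)"] walk_sym[OF N sym x])
    finally show ?thesis using V by (simp add: divide_le_eq)
  qed
  then have "(\<Sum>x\<in>N. (R ^ k * v x)\<^sup>2 / ?V) \<le> (\<Sum>x\<in>N. walk w N (k + k) x x)"
    by (rule sum_mono)
  also have "(\<Sum>x\<in>N. (R ^ k * v x)\<^sup>2 / ?V) = (R ^ k)\<^sup>2 * ?V / ?V"
    by (simp add: power_mult_distrib sum_distrib_left sum_divide_distrib)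
  also have "\<dots> = R ^ (2 * k)" using V by (simp add: power_mult power2_eq_square power_add mult_2)
  finally show ?thesis .
qed

section \<open>From closed walks to cycles\<close>

lemma card_coincident_le:
  assumes "finite N" "i < L" "j < L" "i \<noteq> j"
  shows "card {c \<in> {..<L} \<rightarrow>\<^sub>E N. c i = c j} \<le> card N ^ (L - 1)"
proof -
  let ?A = "{c \<in> {..<L} \<rightarrow>\<^sub>E N. c i = c j}" and ?I = "{..<L} - {j}"
  have "inj_on (\<lambda>c. restrict c ?I) ?A"
  proof (rule inj_onI)
    fix c c' assume c: "c \<in> ?A" "c' \<in> ?A" "restrict c ?I = restrict c' ?I"
    have eq: "c x = c' x" if "x \<in> ?I" for x
      using fun_cong[OF c(3), of x] that by simp
    show "c = c'"
    proof (rule PiE_ext[of c "{..<L}" "\<lambda>_. N"])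
      fix x assume "x \<in> {..<L}"
      then show "c x = c' x" using eq[of x] eq[of i] c assms by (cases "x = j") auto
    qed (use c in auto)
  qed
  moreover have "(\<lambda>c. restrict c ?I) ` ?A \<subseteq> ?I \<rightarrow>\<^sub>E N"
    by (intro image_subsetI) (simp add: PiE_iff)
  ultimately have "card ?A \<le> card (?I \<rightarrow>\<^sub>E N)"
    using assms by (intro card_inj_on_le finite_PiE) auto
  also have "\<dots> = card N ^ (L - 1)" using assms by (simp add: card_PiE)
  finally show ?thesis .
qed

text \<open>A closed walk that is not a cycle has two equal positions. There are at most
  \<open>L^2 * (D * n) ^ (L - 1)\<close> of these, of weight at most \<open>(C / n) ^ L\<close>
  each, so removing them from the trace costs \<open>O(1 / n)\<close> for fixed
  \<open>L\<close>.\<close>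

lemma sum_cycles_ge:
  assumes N: "finite N" and sym: "\<And>x y. w x y = w y x" and nn: "\<And>x y. w x y \<ge> 0" and R: "R \<ge> 0"
    and v: "\<And>x. x \<in> N \<Longrightarrow> R * v x \<le> (\<Sum>y\<in>N. w x y * v y)" and vpos: "\<And>x. v x \<ge> 0"
    and V: "(\<Sum>x\<in>N. (v x)\<^sup>2) > 0"
    and n: "n > 0" and wle: "\<And>x y. w x y \<le> C / real n" and cN: "real (card N) \<le> D * real n"
    and C: "C \<ge> 0" and D: "D \<ge> 1" and L: "L = 2 * k" "k > 0"
  shows "(\<Sum>c\<in>cycles L N. cycle_weight L w c) \<ge> R ^ L - (real L)\<^sup>2 * D ^ L * C ^ L / real n"
proof -
  let ?P = "{..<L} \<rightarrow>\<^sub>E N"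
  let ?B = "?P - cycles L N"
  let ?I = "{(i, j). i < L \<and> j < L \<and> i \<noteq> j}"
  have finP: "finite ?P" using N by (intro finite_PiE) auto
  have sub: "cycles L N \<subseteq> ?P" by (auto simp: cycles_def)
  have finI: "finite ?I" "card ?I \<le> L * L"
  proof -
    have s: "?I \<subseteq> {..<L} \<times> {..<L}" by auto
    show "finite ?I" using s finite_subset by blast
    show "card ?I \<le> L * L" using card_mono[OF _ s] by simp
  qed
  have "?B \<subseteq> (\<Union>(i, j)\<in>?I. {c \<in> ?P. c i = c j})"
    by (auto simp: cycles_def inj_on_def)
  then have "card ?B \<le> card (\<Union>(i, j)\<in>?I. {c \<in> ?P. c i = c j})"
    using finP finI by (intro card_mono) auto
  also have "\<dots> \<le> (\<Sum>(i, j)\<in>?I. card {c \<in> ?P. c i = c j})"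
    using card_UN_le[OF finI(1), of "\<lambda>(i, j). {c \<in> ?P. c i = c j}"] by (simp add: case_prod_beta')
  also have "\<dots> \<le> (\<Sum>(i, j)\<in>?I. card N ^ (L - 1))"
    by (intro sum_mono) (use card_coincident_le[OF N] in \<open>auto simp del: One_nat_def\<close>)
  also have "\<dots> \<le> L * L * card N ^ (L - 1)"
    using finI by (simp add: case_prod_beta')
  finally have "real (card ?B) \<le> real (L * L * card N ^ (L - 1))" by (rule of_nat_mono)
  also have "\<dots> \<le> (real L)\<^sup>2 * (D * real n) ^ (L - 1)"
    using cN by (simp add: power2_eq_square mult_left_mono power_mono)
  also have "\<dots> \<le> (real L)\<^sup>2 * (D ^ L * real n ^ (L - 1))"
    using D unfolding power_mult_distrib by (intro mult_left_mono mult_right_mono power_increasing) auto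
  finally have cB: "real (card ?B) \<le> (real L)\<^sup>2 * (D ^ L * real n ^ (L - 1))" .
  have "(\<Sum>c\<in>?B. cycle_weight L w c) \<le> (\<Sum>c\<in>?B. (C / real n) ^ L)"
  proof (rule sum_mono)
    fix c
    have "cycle_weight L w c \<le> (\<Prod>i<L. C / real n)"
      unfolding cycle_weight_def using nn wle by (intro prod_mono) auto
    then show "cycle_weight L w c \<le> (C / real n) ^ L" by simp
  qed
  also have "\<dots> = real (card ?B) * (C / real n) ^ L" by simp
  also have "\<dots> \<le> ((real L)\<^sup>2 * (D ^ L * real n ^ (L - 1))) * (C / real n) ^ L"
    using cB C by (intro mult_right_mono) auto
  also have "\<dots> = (real L)\<^sup>2 * D ^ L * C ^ L / real n"
  proof -
    have "L = Suc (L - 1)" using L by simp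
    then have "real n ^ L = real n * real n ^ (L - 1)" by (metis power_Suc)
    then show ?thesis using n by (simp add: power_divide)
  qed
  finally have B: "(\<Sum>c\<in>?B. cycle_weight L w c) \<le> (real L)\<^sup>2 * D ^ L * C ^ L / real n" .
  have "R ^ L \<le> (\<Sum>x\<in>N. walk w N L x x)"
    using closed_walks_ge[OF N sym nn R v vpos V, of k] L by (simp add: mult_2)
  also have "\<dots> = (\<Sum>c\<in>?P. cycle_weight L w c)"
    using L by (subst sum_closed_walks) auto
  also have "\<dots> = (\<Sum>c\<in>?B. cycle_weight L w c) + (\<Sum>c\<in>cycles L N. cycle_weight L w c)"
    using finP sub by (rule sum.subset_diff[rotated])
  finally show ?thesis using B by simp
qed

section \<open>Gaussian and product laws\<close>

abbreviation gauss :: "real measure" where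
  "gauss \<equiv> density lborel (\<lambda>x. ennreal (std_normal_density x))"

lemma prob_space_gauss: "prob_space gauss"
  by (rule prob_space_normal_density) simp

lemma measure_gauss_UNIV [simp]: "measure gauss UNIV = 1"
  using prob_space.prob_space[OF prob_space_gauss] by simp

lemma integrable_gauss_power [simp]: "integrable gauss (\<lambda>x. x ^ k)"
  using integrable_std_normal_moment[of k] by (subst integrable_density) auto

lemma integral_gauss_power:
  "(\<integral>x. x ^ (2 * k) \<partial>gauss) = fact (2 * k) / (2 ^ k * fact k)"
  "(\<integral>x. x ^ (2 * k + 1) \<partial>gauss) = 0"
  using integral_std_normal_moment_even[of k] integral_std_normal_moment_odd[of k]
  by (subst integral_density; simp)+

lemma integral_gauss_1: "(\<integral>x. x \<partial>gauss) = 0" "integrable gauss (\<lambda>x. x)"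
  using integral_gauss_power(2)[of 0] integrable_gauss_power[of 1] by auto

lemma integral_gauss_2: "(\<integral>x. x\<^sup>2 \<partial>gauss) = 1"
  using integral_gauss_power(1)[of 1] by (simp add: numeral_eq_Suc)

lemma integrable_gauss_const [simp]: "integrable gauss (\<lambda>x. c :: real)"
  using prob_space_gauss by (simp add: prob_space.prob_space finite_measure.integrable_const prob_space.axioms(1))

lemma integral_gauss_const [simp]: "(\<integral>x. c \<partial>gauss) = (c :: real)"
  by simp

text \<open>The extra power \<open>x ^ k\<close> makes the induction work: expanding one factor
  turns exponent \<open>k\<close> into \<open>k\<close> and \<open>k + 2\<close>.\<close>

lemma integrable_gauss_prod:
  assumes "finite I"
  shows "integrable gauss (\<lambda>x. (\<Prod>i\<in>I. a i + b i * x\<^sup>2) * x ^ k)"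
  using assms
proof (induction I arbitrary: k rule: finite_induct)
  case (insert i I)
  have "(\<lambda>x. (\<Prod>i\<in>insert i I. a i + b i * x\<^sup>2) * x ^ k)
      = (\<lambda>x. a i * ((\<Prod>i\<in>I. a i + b i * x\<^sup>2) * x ^ k) + b i * ((\<Prod>i\<in>I. a i + b i * x\<^sup>2) * x ^ (k + 2)))"
    using insert by (auto simp: algebra_simps power_add power2_eq_square)
  then show ?case
    using insert.IH[of k] insert.IH[of "k + 2"] by (simp only:) (intro Bochner_Integration.integrable_add integrable_mult_right)
qed simp

lemma measurable_std_gaussian_component [measurable]:
  assumes "r \<in> {1..p}"
  shows "(\<lambda>v. v r) \<in> borel_measurable (std_gaussian p)"
  unfolding std_gaussian_def
  using measurable_component_singleton[OF assms, of "\<lambda>_. gauss"] by simp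

lemma product_sigma_finite_gauss: "product_sigma_finite (\<lambda>_ :: nat. gauss)"
  unfolding product_sigma_finite_def
  by (simp add: prob_space_gauss prob_space_imp_sigma_finite)

lemma product_sigma_finite_std_gaussian: "product_sigma_finite (\<lambda>_ :: nat. std_gaussian p)"
  unfolding product_sigma_finite_def
  by (simp add: prob_space_std_gaussian prob_space_imp_sigma_finite)

lemma integral_std_gaussian_prod:
  fixes f :: "nat \<Rightarrow> real \<Rightarrow> real"
  assumes "\<And>r. r \<in> {1..p} \<Longrightarrow> integrable gauss (f r)"
  shows "integrable (std_gaussian p) (\<lambda>u. \<Prod>r\<in>{1..p}. f r (u r))"
    and "(\<integral>u. (\<Prod>r\<in>{1..p}. f r (u r)) \<partial>std_gaussian p) = (\<Prod>r\<in>{1..p}. \<integral>x. f r x \<partial>gauss)"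
  unfolding std_gaussian_def
  using product_sigma_finite.product_integrable_prod[OF product_sigma_finite_gauss, of "{1..p}" f]
    product_sigma_finite.product_integral_prod[OF product_sigma_finite_gauss, of "{1..p}" f] assms
  by auto

definition noise_law :: "nat \<Rightarrow> nat \<Rightarrow> (nat \<Rightarrow> nat \<Rightarrow> real) measure" where
  "noise_law n p = (\<Pi>\<^sub>M i\<in>{1..n}. std_gaussian p)"

lemma prob_space_noise_law: "prob_space (noise_law n p)"
  unfolding noise_law_def by (intro prob_space_PiM prob_space_std_gaussian)

lemma measurable_noise_component [measurable]:
  assumes "i \<in> {1..n}" "r \<in> {1..p}"
  shows "(\<lambda>Z. Z i r) \<in> borel_measurable (noise_law n p)"
  unfolding noise_law_def
  by (rule measurable_compose[OF measurable_component_singleton[OF assms(1)] measurable_std_gaussian_component[OF assms(2)]])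

lemma integral_noise_law_prod:
  fixes f :: "nat \<Rightarrow> nat \<Rightarrow> real \<Rightarrow> real"
  assumes "\<And>i r. i \<in> {1..n} \<Longrightarrow> r \<in> {1..p} \<Longrightarrow> integrable gauss (f i r)"
  shows "integrable (noise_law n p) (\<lambda>Z. \<Prod>i\<in>{1..n}. \<Prod>r\<in>{1..p}. f i r (Z i r))"
    and "(\<integral>Z. (\<Prod>i\<in>{1..n}. \<Prod>r\<in>{1..p}. f i r (Z i r)) \<partial>noise_law n p) = (\<Prod>i\<in>{1..n}. \<Prod>r\<in>{1..p}. \<integral>x. f i r x \<partial>gauss)"
proof -
  have 1: "integrable (std_gaussian p) (\<lambda>z. \<Prod>r\<in>{1..p}. f i r (z r))" if "i \<in> {1..n}" for i
    by (rule integral_std_gaussian_prod) (use assms that in auto)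
  have 2: "(\<integral>z. (\<Prod>r\<in>{1..p}. f i r (z r)) \<partial>std_gaussian p) = (\<Prod>r\<in>{1..p}. \<integral>x. f i r x \<partial>gauss)" if "i \<in> {1..n}" for i
    by (rule integral_std_gaussian_prod) (use assms that in auto)
  show "integrable (noise_law n p) (\<lambda>Z. \<Prod>i\<in>{1..n}. \<Prod>r\<in>{1..p}. f i r (Z i r))"
    unfolding noise_law_def
    using product_sigma_finite.product_integrable_prod[OF product_sigma_finite_std_gaussian, of "{1..n}" p "\<lambda>i z. \<Prod>r\<in>{1..p}. f i r (z r)"] 1
    by auto
  have "(\<integral>Z. (\<Prod>i\<in>{1..n}. \<Prod>r\<in>{1..p}. f i r (Z i r)) \<partial>noise_law n p)
     = (\<Prod>i\<in>{1..n}. \<integral>z. (\<Prod>r\<in>{1..p}. f i r (z r)) \<partial>std_gaussian p)"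
    unfolding noise_law_def
    using product_sigma_finite.product_integral_prod[OF product_sigma_finite_std_gaussian, of "{1..n}" p "\<lambda>i z. \<Prod>r\<in>{1..p}. f i r (z r)"] 1
    by auto
  also have "\<dots> = (\<Prod>i\<in>{1..n}. \<Prod>r\<in>{1..p}. \<integral>x. f i r x \<partial>gauss)"
    by (intro prod.cong refl 2)
  finally show "(\<integral>Z. (\<Prod>i\<in>{1..n}. \<Prod>r\<in>{1..p}. f i r (Z i r)) \<partial>noise_law n p) = (\<Prod>i\<in>{1..n}. \<Prod>r\<in>{1..p}. \<integral>x. f i r x \<partial>gauss)" .
qed

lemma integrable_gauss_affine_power:
  "integrable gauss (\<lambda>z. (\<beta> * (a + z)) ^ k)"
proof -
  have "(\<lambda>z. (\<beta> * (a + z)) ^ k) = (\<lambda>z. \<beta> ^ k * (\<Sum>j\<le>k. of_nat (k choose j) * z ^ j * a ^ (k - j)))"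
    by (auto simp: power_mult_distrib binomial_ring add.commute)
  then show ?thesis by (simp only:) (intro integrable_mult_right Bochner_Integration.integrable_sum integrable_mult_left integrable_gauss_power)
qed

lemma integral_gauss_affine:
  "(\<integral>z. (\<beta> * (a + z)) ^ 1 \<partial>gauss) = \<beta> * a"
  "(\<integral>z. (\<beta> * (a + z)) ^ 2 \<partial>gauss) = \<beta>\<^sup>2 * (a\<^sup>2 + 1)"
proof -
  show "(\<integral>z. (\<beta> * (a + z)) ^ 1 \<partial>gauss) = \<beta> * a"
    by (simp add: integral_gauss_1)
  have "(\<lambda>z. (\<beta> * (a + z)) ^ 2) = (\<lambda>z. \<beta>\<^sup>2 * (a\<^sup>2 + (2 * a * z + z\<^sup>2)))"
    by (auto simp: power2_eq_square algebra_simps)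
  then show "(\<integral>z. (\<beta> * (a + z)) ^ 2 \<partial>gauss) = \<beta>\<^sup>2 * (a\<^sup>2 + 1)"
    by (simp only:) (simp add: integral_gauss_1 integral_gauss_2)
qed

text \<open>One dominating function for the exponents 0, 1 and 2, the only ones that a pair of
  cycles produces.\<close>

lemma abs_power_le_1_square: "k \<le> 2 \<Longrightarrow> \<bar>x :: real\<bar> ^ k \<le> 1 + x\<^sup>2"
proof -
  assume "k \<le> 2"
  then consider "k = 0" | "k = 1" | "k = 2" by linarith
  then show ?thesis
  proof cases
    case 2
    have "0 \<le> (\<bar>x\<bar> - 1)\<^sup>2" by simp
    then have "2 * \<bar>x\<bar> \<le> 1 + x\<^sup>2" by (simp add: power2_diff)
    then show ?thesis using 2 by (simp add: power2_eq_square)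
  qed (auto simp: power2_eq_square)
qed

section \<open>Moments of the features given the labels\<close>

definition feature_monomial :: "nat \<Rightarrow> nat \<Rightarrow> real \<Rightarrow> (nat \<Rightarrow> real) \<Rightarrow> (nat \<Rightarrow> nat \<Rightarrow> nat) \<Rightarrow> (nat \<Rightarrow> real) \<Rightarrow> (nat \<Rightarrow> nat \<Rightarrow> real) \<Rightarrow> real" where
  "feature_monomial n p \<beta> s k u Z = (\<Prod>i\<in>{1..n}. \<Prod>r\<in>{1..p}. (\<beta> * (s i * u r + Z i r)) ^ k i r)"

text \<open>Given \<open>u\<close> the entries are independent, so the integral over the noise is a
  product. The components of \<open>u\<close> are shared by all vertices and have to be integrated
  last.\<close>

lemma integral_feature_monomial:
  fixes s :: "nat \<Rightarrow> real"
  assumes k: "\<And>i r. k i r \<le> 2"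
  shows "integrable (std_gaussian p \<Otimes>\<^sub>M noise_law n p) (\<lambda>(u, Z). feature_monomial n p \<beta> s k u Z)"
    and "(\<integral>(u, Z). feature_monomial n p \<beta> s k u Z \<partial>(std_gaussian p \<Otimes>\<^sub>M noise_law n p))
       = (\<integral>u. (\<Prod>i\<in>{1..n}. \<Prod>r\<in>{1..p}. \<integral>z. (\<beta> * (s i * u r + z)) ^ k i r \<partial>gauss) \<partial>std_gaussian p)"
proof -
  interpret N: prob_space "noise_law n p" by (rule prob_space_noise_law)
  interpret U: prob_space "std_gaussian p" by (rule prob_space_std_gaussian)
  interpret P: pair_sigma_finite "std_gaussian p" "noise_law n p" ..
  let ?F = "feature_monomial n p \<beta> s k"
  have [measurable]: "(\<lambda>x. snd x i r) \<in> borel_measurable (std_gaussian p \<Otimes>\<^sub>M noise_law n p)"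
    if "i \<in> {1..n}" "r \<in> {1..p}" for i r
    by (rule measurable_compose[OF measurable_snd measurable_noise_component[OF that]])
  have [measurable]: "(\<lambda>x. fst x r) \<in> borel_measurable (std_gaussian p \<Otimes>\<^sub>M noise_law n p)"
    if "r \<in> {1..p}" for r
    by (rule measurable_compose[OF measurable_fst measurable_std_gaussian_component[OF that]])
  have meas: "(\<lambda>x. ?F (fst x) (snd x)) \<in> borel_measurable (std_gaussian p \<Otimes>\<^sub>M noise_law n p)"
    unfolding feature_monomial_def by measurable
  have int: "integrable (noise_law n p) (?F u)" for u
    unfolding feature_monomial_def
    by (rule integral_noise_law_prod(1)) (rule integrable_gauss_affine_power)
  have val: "(\<integral>Z. ?F u Z \<partial>noise_law n p) = (\<Prod>i\<in>{1..n}. \<Prod>r\<in>{1..p}. \<integral>z. (\<beta> * (s i * u r + z)) ^ k i r \<partial>gauss)" for u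
    unfolding feature_monomial_def
    by (rule integral_noise_law_prod(2)) (rule integrable_gauss_affine_power)
  have absval: "(\<integral>Z. norm (?F u Z) \<partial>noise_law n p) = (\<Prod>i\<in>{1..n}. \<Prod>r\<in>{1..p}. \<integral>z. \<bar>\<beta> * (s i * u r + z)\<bar> ^ k i r \<partial>gauss)" for u
  proof -
    have "(\<integral>Z. norm (?F u Z) \<partial>noise_law n p)
        = (\<integral>Z. (\<Prod>i\<in>{1..n}. \<Prod>r\<in>{1..p}. \<bar>\<beta> * (s i * u r + Z i r)\<bar> ^ k i r) \<partial>noise_law n p)"
      unfolding feature_monomial_def by (simp only: real_norm_def abs_prod power_abs)
    also have "\<dots> = (\<Prod>i\<in>{1..n}. \<Prod>r\<in>{1..p}. \<integral>z. \<bar>\<beta> * (s i * u r + z)\<bar> ^ k i r \<partial>gauss)"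
    proof (rule integral_noise_law_prod(2))
      show "integrable gauss (\<lambda>z. \<bar>\<beta> * (s i * u r + z)\<bar> ^ k i r)" for i r
        using integrable_abs[OF integrable_gauss_affine_power[of \<beta> "s i * u r" "k i r"]]
        by (simp only: power_abs)
    qed
    finally show ?thesis .
  qed
  \<comment> \<open>Fubini's theorem needs absolute integrability. After the noise is integrated
    out, the absolute value is dominated by a polynomial in the squares of the \<open>u r\<close>
    that factorizes over \<open>r\<close>.\<close>
  have "integrable (std_gaussian p) (\<lambda>u. \<integral>Z. norm (?F u Z) \<partial>noise_law n p)"
  proof (rule Bochner_Integration.integrable_bound)
    show "integrable (std_gaussian p) (\<lambda>u. \<Prod>r\<in>{1..p}. (\<Prod>i\<in>{1..n}. (1 + \<beta>\<^sup>2) + (\<beta>\<^sup>2 * (s i)\<^sup>2) * (u r)\<^sup>2) * (u r) ^ 0)"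
      by (rule integral_std_gaussian_prod(1)) (rule integrable_gauss_prod, simp)
    show "(\<lambda>u. \<integral>Z. norm (?F u Z) \<partial>noise_law n p) \<in> borel_measurable (std_gaussian p)"
      using meas by (intro N.borel_measurable_lebesgue_integral) (simp add: case_prod_beta')
    show "AE u in std_gaussian p. norm (\<integral>Z. norm (?F u Z) \<partial>noise_law n p)
        \<le> norm (\<Prod>r\<in>{1..p}. (\<Prod>i\<in>{1..n}. (1 + \<beta>\<^sup>2) + (\<beta>\<^sup>2 * (s i)\<^sup>2) * (u r)\<^sup>2) * (u r) ^ 0)"
    proof (rule AE_I2)
      fix u
      have 1: "0 \<le> (\<integral>Z. norm (?F u Z) \<partial>noise_law n p)" by simp
      have 2: "0 \<le> (\<Prod>r\<in>{1..p}. (\<Prod>i\<in>{1..n}. (1 + \<beta>\<^sup>2) + (\<beta>\<^sup>2 * (s i)\<^sup>2) * (u r)\<^sup>2) * (u r) ^ 0)"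
        by (auto intro!: prod_nonneg add_nonneg_nonneg)
      have "(\<integral>Z. norm (?F u Z) \<partial>noise_law n p) \<le> (\<Prod>i\<in>{1..n}. \<Prod>r\<in>{1..p}. (1 + \<beta>\<^sup>2) + (\<beta>\<^sup>2 * (s i)\<^sup>2) * (u r)\<^sup>2)"
        unfolding absval
      proof (intro prod_mono conjI prod_nonneg ballI)
        fix i r
        show "0 \<le> (\<integral>z. \<bar>\<beta> * (s i * u r + z)\<bar> ^ k i r \<partial>gauss)" by simp
        have "(\<integral>z. \<bar>\<beta> * (s i * u r + z)\<bar> ^ k i r \<partial>gauss) \<le> (\<integral>z. 1 + (\<beta> * (s i * u r + z)) ^ 2 \<partial>gauss)"
        proof (rule integral_mono')
          show "integrable gauss (\<lambda>z. 1 + (\<beta> * (s i * u r + z)) ^ 2)"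
            by (intro Bochner_Integration.integrable_add integrable_gauss_affine_power) simp
        qed (use k abs_power_le_1_square in auto)
        also have "\<dots> = 1 + \<beta>\<^sup>2 * ((s i * u r)\<^sup>2 + 1)"
          using integral_gauss_affine(2)[of \<beta> "s i * u r"] integrable_gauss_affine_power[of \<beta> "s i * u r" 2]
          by (simp add: Bochner_Integration.integral_add)
        finally show "(\<integral>z. \<bar>\<beta> * (s i * u r + z)\<bar> ^ k i r \<partial>gauss) \<le> (1 + \<beta>\<^sup>2) + (\<beta>\<^sup>2 * (s i)\<^sup>2) * (u r)\<^sup>2"
          by (simp add: algebra_simps)
      qed simp
      also have "\<dots> = (\<Prod>r\<in>{1..p}. (\<Prod>i\<in>{1..n}. (1 + \<beta>\<^sup>2) + (\<beta>\<^sup>2 * (s i)\<^sup>2) * (u r)\<^sup>2) * (u r) ^ 0)"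
        by (subst prod.swap) simp
      finally show "norm (\<integral>Z. norm (?F u Z) \<partial>noise_law n p)
        \<le> norm (\<Prod>r\<in>{1..p}. (\<Prod>i\<in>{1..n}. (1 + \<beta>\<^sup>2) + (\<beta>\<^sup>2 * (s i)\<^sup>2) * (u r)\<^sup>2) * (u r) ^ 0)"
        using 1 2 by (simp only: real_norm_def abs_of_nonneg)
    qed
  qed
  then have I: "integrable (std_gaussian p \<Otimes>\<^sub>M noise_law n p) (\<lambda>x. ?F (fst x) (snd x))"
    using meas int by (intro P.Fubini_integrable) (auto simp: case_prod_beta')
  then show "integrable (std_gaussian p \<Otimes>\<^sub>M noise_law n p) (\<lambda>(u, Z). ?F u Z)"
    by (simp add: case_prod_beta')
  show "(\<integral>(u, Z). ?F u Z \<partial>(std_gaussian p \<Otimes>\<^sub>M noise_law n p))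
       = (\<integral>u. (\<Prod>i\<in>{1..n}. \<Prod>r\<in>{1..p}. \<integral>z. (\<beta> * (s i * u r + z)) ^ k i r \<partial>gauss) \<partial>std_gaussian p)"
    using P.integral_fst'[OF I] by (simp add: case_prod_beta' val)
qed

section \<open>Expectations over laws with finite support\<close>

lemma integral_measure_pmf_pair:
  fixes f :: "'a \<times> 'b \<Rightarrow> real"
  assumes fin: "finite (set_pmf P)" and "prob_space N"
    and [measurable]: "f \<in> borel_measurable (measure_pmf P \<Otimes>\<^sub>M N)"
    and int: "\<And>x. x \<in> set_pmf P \<Longrightarrow> integrable N (\<lambda>y. f (x, y))"
  shows "integrable (measure_pmf P \<Otimes>\<^sub>M N) f"
    and "(\<integral>z. f z \<partial>(measure_pmf P \<Otimes>\<^sub>M N)) = measure_pmf.expectation P (\<lambda>x. \<integral>y. f (x, y) \<partial>N)"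
proof -
  interpret N: prob_space N by fact
  interpret P: pair_sigma_finite "measure_pmf P" N ..
  show I: "integrable (measure_pmf P \<Otimes>\<^sub>M N) f"
    by (rule P.Fubini_integrable) (use fin int in \<open>auto simp: AE_measure_pmf_iff integrable_measure_pmf_finite\<close>)
  show "(\<integral>z. f z \<partial>(measure_pmf P \<Otimes>\<^sub>M N)) = measure_pmf.expectation P (\<lambda>x. \<integral>y. f (x, y) \<partial>N)"
    using P.integral_fst'[OF I] by simp
qed

lemma finite_set_Pi_pmf:
  assumes "finite A" "\<And>x. x \<in> A \<Longrightarrow> finite (set_pmf (p x))"
  shows "finite (set_pmf (Pi_pmf A d p))"
  using assms by (simp add: set_Pi_pmf finite_PiE_dflt)

lemma expectation_prod_Pi_pmf_finite:
  fixes f :: "'a \<Rightarrow> 'b \<Rightarrow> real"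
  assumes "finite A" and "\<And>x. x \<in> A \<Longrightarrow> finite (set_pmf (p x))"
  shows "measure_pmf.expectation (Pi_pmf A d p) (\<lambda>y. \<Prod>x\<in>A. f x (y x))
       = (\<Prod>x\<in>A. measure_pmf.expectation (p x) (f x))"
  using assms
proof (induction A rule: finite_induct)
  case (insert x A)
  have fin: "finite (set_pmf (p x))" "finite (set_pmf (Pi_pmf A d p))"
    using insert by (auto intro!: finite_set_Pi_pmf)
  have "measure_pmf.expectation (Pi_pmf (insert x A) d p) (\<lambda>y. \<Prod>z\<in>insert x A. f z (y z))
      = measure_pmf.expectation (p x) (\<lambda>a. measure_pmf.expectation (Pi_pmf A d p) (\<lambda>b. f x a * (\<Prod>z\<in>A. f z ((b(x := a)) z))))"
    unfolding Pi_pmf_insert'[OF insert.hyps(1,2)]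
    using insert.hyps fin
    by (subst pmf_expectation_bind[of "set_pmf (p x)"])
       (auto simp: integral_measure_pmf[of "set_pmf (p x)"] simp flip: map_pmf_def)
  also have "(\<lambda>a b. f x a * (\<Prod>z\<in>A. f z ((b(x := a)) z))) = (\<lambda>a b. f x a * (\<Prod>z\<in>A. f z (b z)))"
    using insert.hyps by (intro ext arg_cong2[where f="(*)"] prod.cong) auto
  finally show ?case using insert by simp
qed simp

text \<open>The model draws layer by layer, but a signal combines all layers of one pair. Read pair
  by pair the law is again a product, which makes the signals of distinct pairs independent.\<close>

lemma Pi_pmf_swap:
  assumes "finite A" "finite B"
  shows "map_pmf (\<lambda>G e k. G k e) (Pi_pmf A (\<lambda>_. d) (\<lambda>k. Pi_pmf B d (p k)))
       = Pi_pmf B (\<lambda>_. d) (\<lambda>e. Pi_pmf A d (\<lambda>k. p k e))"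
proof (rule pmf_eqI)
  fix F :: "'b \<Rightarrow> 'a \<Rightarrow> 'c"
  have inj: "inj (\<lambda>G e k. G k e :: 'c)"
    by (rule injI) (metis (no_types, lifting) ext)
  have 1: "pmf (map_pmf (\<lambda>G e k. G k e) (Pi_pmf A (\<lambda>_. d) (\<lambda>k. Pi_pmf B d (p k)))) F
      = pmf (Pi_pmf A (\<lambda>_. d) (\<lambda>k. Pi_pmf B d (p k))) (\<lambda>k e. F e k)"
    using pmf_map_inj'[OF inj, of _ "\<lambda>k e. F e k"] by simp
  have 2: "pmf (Pi_pmf A (\<lambda>_. d) (\<lambda>k. Pi_pmf B d (p k))) (\<lambda>k e. F e k)
      = pmf (Pi_pmf B (\<lambda>_. d) (\<lambda>e. Pi_pmf A d (\<lambda>k. p k e))) F"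
  proof (cases "\<forall>e k. e \<notin> B \<or> k \<notin> A \<longrightarrow> F e k = d")
    case True
    then have 1: "(\<lambda>e. F e k) = (\<lambda>_. d)" if "k \<notin> A" for k using that by auto
    have 2: "F e = (\<lambda>_. d)" if "e \<notin> B" for e using True that by auto
    have "pmf (Pi_pmf A (\<lambda>_. d) (\<lambda>k. Pi_pmf B d (p k))) (\<lambda>k e. F e k) = (\<Prod>k\<in>A. \<Prod>e\<in>B. pmf (p k e) (F e k))"
      using assms 1 True by (subst pmf_Pi') (auto simp: pmf_Pi')
    also have "\<dots> = (\<Prod>e\<in>B. \<Prod>k\<in>A. pmf (p k e) (F e k))" by (rule prod.swap)
    also have "\<dots> = pmf (Pi_pmf B (\<lambda>_. d) (\<lambda>e. Pi_pmf A d (\<lambda>k. p k e))) F"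
      using assms 2 True by (subst pmf_Pi') (auto simp: pmf_Pi')
    finally show ?thesis .
  next
    case False
    \<comment> \<open>A value other than the default outside the index sets has probability 0 on
      both sides, through the outer or the inner product according to which index is
      outside.\<close>
    then obtain e k where ek: "e \<notin> B \<or> k \<notin> A" "F e k \<noteq> d" by auto
    have l: "pmf (Pi_pmf A (\<lambda>_. d) (\<lambda>k. Pi_pmf B d (p k))) (\<lambda>k e. F e k) = 0"
    proof (cases "k \<in> A")
      case True
      then have "pmf (Pi_pmf B d (p k)) (\<lambda>e. F e k) = 0"
        using ek assms by (intro pmf_Pi_outside) auto
      then show ?thesis using assms True by (auto simp: pmf_Pi[OF assms(1)])
    next
      case False
      then have "(\<lambda>e. F e k) \<noteq> (\<lambda>_. d)" using ek by metis
      then show ?thesis using False assms by (intro pmf_Pi_outside) auto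
    qed
    have r: "pmf (Pi_pmf B (\<lambda>_. d) (\<lambda>e. Pi_pmf A d (\<lambda>k. p k e))) F = 0"
    proof (cases "e \<in> B")
      case True
      then have "pmf (Pi_pmf A d (\<lambda>k. p k e)) (F e) = 0"
        using ek assms by (intro pmf_Pi_outside) auto
      then show ?thesis using assms True by (auto simp: pmf_Pi[OF assms(2)])
    next
      case False
      then have "F e \<noteq> (\<lambda>_. d)" using ek by metis
      then show ?thesis using False assms by (intro pmf_Pi_outside) auto
    qed
    show ?thesis using l r by simp
  qed
  show "pmf (map_pmf (\<lambda>G e k. G k e) (Pi_pmf A (\<lambda>_. d) (\<lambda>k. Pi_pmf B d (p k)))) F
     = pmf (Pi_pmf B (\<lambda>_. d) (\<lambda>e. Pi_pmf A d (\<lambda>k. p k e))) F"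
    unfolding 1 by (rule 2)
qed

section \<open>Moments of the observed signals\<close>

lemma expectation_bind_finite:
  fixes h :: "'b \<Rightarrow> real"
  assumes "finite (set_pmf p)" "\<And>x. x \<in> set_pmf p \<Longrightarrow> finite (set_pmf (f x))"
  shows "measure_pmf.expectation (bind_pmf p f) h = measure_pmf.expectation p (\<lambda>x. measure_pmf.expectation (f x) h)"
  using assms by (subst pmf_expectation_bind[of "set_pmf p"]) (auto simp: integral_measure_pmf[of "set_pmf p"])

text \<open>
  The nodes \<open>1..n\<close> are the vertices and the node \<open>n + r\<close> is the feature coordinate \<open>r\<close>; a pair of
  coordinates carries no signal.
\<close>

definition signal :: "nat \<Rightarrow> nat \<Rightarrow> (nat \<Rightarrow> real) \<Rightarrow> (nat \<Rightarrow> real) \<Rightarrow> real \<Rightarrow>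
    (nat \<Rightarrow> nat \<times> nat \<Rightarrow> nat) \<times> (nat \<Rightarrow> nat \<Rightarrow> real) \<Rightarrow> nat \<times> nat \<Rightarrow> real" where
  "signal m n d \<alpha> \<beta> y = (\<lambda>(i, j).
     if j \<le> n then \<Sum>t=1..m. \<alpha> t * (real (fst y t (i, j)) - d t / real n)
     else if i \<le> n then \<beta> * snd y i (j - n) else 0)"

lemma measurable_signal [measurable]:
  assumes "e \<in> vertex_pairs (n + p)"
  shows "(\<lambda>y. signal m n d \<alpha> \<beta> y e) \<in> borel_measurable (obs_space m n p)"
proof -
  obtain i j where e: "e = (i, j)" by force
  have ij: "1 \<le> i" "i < j" "j \<le> n + p" using assms by (auto simp: e vertex_pairs_def)
  consider "j \<le> n" | "j > n" "i \<le> n" | "j > n" "i > n" by linarith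
  then show ?thesis
  proof cases
    case 1
    have *: "(\<lambda>y. real (fst y t (i, j))) \<in> borel_measurable (obs_space m n p)" if t: "t \<in> {1..m}" for t
    proof -
      have "(\<lambda>y. fst y t (i, j)) \<in> obs_space m n p \<rightarrow>\<^sub>M count_space {0, 1}"
        unfolding obs_space_def
        by (rule measurable_compose[OF measurable_fst], rule measurable_compose[OF measurable_component_singleton[OF t]],
            rule measurable_component_singleton) (use 1 ij in auto)
      then show ?thesis by (rule measurable_compose) simp
    qed
    show ?thesis using 1 * by (simp add: e signal_def)
  next
    case 2
    have "(\<lambda>y. snd y i (j - n)) \<in> borel_measurable (obs_space m n p)"
      unfolding obs_space_def
      by (rule measurable_compose[OF measurable_snd], rule measurable_compose[OF measurable_component_singleton[of i]],
          use 2 ij in simp, rule measurable_component_singleton) (use 2 ij in auto)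
    then show ?thesis using 2 by (simp add: e signal_def)
  next
    case 3
    then show ?thesis by (simp add: e signal_def)
  qed
qed

definition layer_moment :: "nat \<Rightarrow> nat \<Rightarrow> (nat \<Rightarrow> real) \<Rightarrow> (nat \<Rightarrow> real) \<Rightarrow> (nat \<Rightarrow> real) \<Rightarrow> bool \<Rightarrow> nat \<Rightarrow> real" where
  "layer_moment m n d l \<alpha> same k = measure_pmf.expectation
     (Pi_pmf {1..m} False (\<lambda>t. bernoulli_pmf ((if same then a_par (d t) (l t) else b_par (d t) (l t)) / real n)))
     (\<lambda>b. (\<Sum>t=1..m. \<alpha> t * (of_bool (b t) - d t / real n)) ^ k)"

text \<open>The last branch is \<open>0 ^ k\<close> and not 0, since a pair that no cycle uses has
  exponent 0 and must contribute the factor 1.\<close>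

definition cond_moment :: "nat \<Rightarrow> nat \<Rightarrow> (nat \<Rightarrow> real) \<Rightarrow> (nat \<Rightarrow> real) \<Rightarrow> real \<Rightarrow> (nat \<Rightarrow> real) \<Rightarrow> real \<Rightarrow>
    (nat \<Rightarrow> real) \<Rightarrow> (nat \<Rightarrow> real) \<Rightarrow> nat \<times> nat \<Rightarrow> nat \<Rightarrow> real" where
  "cond_moment m n d l \<mu> \<alpha> \<beta> \<sigma> u e k = (case e of (i, j) \<Rightarrow>
     if j \<le> n then layer_moment m n d l \<alpha> (\<sigma> i = \<sigma> j) k
     else if i \<le> n then \<integral>z. (\<beta> * (sqrt (\<mu> / real n) * \<sigma> i * u (j - n) + z)) ^ k \<partial>gauss
     else 0 ^ k)"

lemma finite_vertex_pairs [simp]: "finite (vertex_pairs n)"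
  by (rule finite_subset[of _ "{1..n} \<times> {1..n}"]) (auto simp: vertex_pairs_def)

lemma prod_vertex_pairs:
  fixes f :: "nat \<times> nat \<Rightarrow> real"
  shows "(\<Prod>e\<in>vertex_pairs (n + p). f e) = (\<Prod>e\<in>vertex_pairs n. f e)
    * (\<Prod>i\<in>{1..n}. \<Prod>r\<in>{1..p}. f (i, n + r)) * (\<Prod>e\<in>{(i, j). n < i \<and> i < j \<and> j \<le> n + p}. f e)"
proof -
  let ?F = "{(i, j). n < i \<and> i < j \<and> j \<le> n + p}" and ?B = "{1..n} \<times> {n + 1..n + p}"
  have finF: "finite ?F" by (rule finite_subset[of _ "{1..n + p} \<times> {1..n + p}"]) auto
  have split: "vertex_pairs (n + p) = (vertex_pairs n \<union> ?B) \<union> ?F" by (auto simp: vertex_pairs_def)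
  have "(\<Prod>e\<in>vertex_pairs (n + p). f e) = (\<Prod>e\<in>vertex_pairs n \<union> ?B. f e) * (\<Prod>e\<in>?F. f e)"
    unfolding split by (intro prod.union_disjoint finite_UnI finF finite_vertex_pairs) (auto simp: vertex_pairs_def)
  also have "(\<Prod>e\<in>vertex_pairs n \<union> ?B. f e) = (\<Prod>e\<in>vertex_pairs n. f e) * (\<Prod>e\<in>?B. f e)"
    by (intro prod.union_disjoint finite_vertex_pairs) (auto simp: vertex_pairs_def)
  also have "(\<Prod>e\<in>?B. f e) = (\<Prod>i\<in>{1..n}. \<Prod>j\<in>{n + 1..n + p}. f (i, j))"
    by (simp add: prod.cartesian_product)
  also have "\<dots> = (\<Prod>i\<in>{1..n}. \<Prod>r\<in>{1..p}. f (i, n + r))"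
    by (intro prod.cong refl prod.reindex_bij_witness[of _ "\<lambda>r. n + r" "\<lambda>j. j - n"]) auto
  finally show ?thesis .
qed

lemma finite_set_labels: "finite (set_pmf (labels_pmf n))"
  unfolding labels_pmf_def
  by (subst set_pmf_of_set) (auto intro!: finite_PiE simp: PiE_eq_empty_iff)

lemma set_labels: "set_pmf (labels_pmf n) = {1..n} \<rightarrow>\<^sub>E {-1, 1}"
  unfolding labels_pmf_def
  by (subst set_pmf_of_set) (auto intro!: finite_PiE simp: PiE_eq_empty_iff)

lemma finite_set_multilayer: "finite (set_pmf (multilayer_sbm_pmf m n d l \<sigma>))"
  unfolding multilayer_sbm_pmf_def sbm_pmf_def
  by (intro finite_set_Pi_pmf) auto

lemma finite_set_labelled_graphs: "finite (set_pmf (labelled_graphs_pmf m n d l))"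
  unfolding labelled_graphs_pmf_def using finite_set_labels finite_set_multilayer by auto

lemma expectation_multilayer_prod:
  fixes h :: "nat \<times> nat \<Rightarrow> (nat \<Rightarrow> bool) \<Rightarrow> real"
  shows "measure_pmf.expectation (multilayer_sbm_pmf m n d l \<sigma>) (\<lambda>G. \<Prod>e\<in>vertex_pairs n. h e (\<lambda>t. G t e))
    = (\<Prod>e\<in>vertex_pairs n. measure_pmf.expectation
        (Pi_pmf {1..m} False (\<lambda>t. bernoulli_pmf (case e of (i, j) \<Rightarrow>
           (if \<sigma> i = \<sigma> j then a_par (d t) (l t) else b_par (d t) (l t)) / real n))) (h e))"
proof -
  let ?q = "\<lambda>t e. bernoulli_pmf (case e of (i, j) \<Rightarrow> (if \<sigma> i = \<sigma> j then a_par (d t) (l t) else b_par (d t) (l t)) / real n)"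
  have ml: "multilayer_sbm_pmf m n d l \<sigma> = Pi_pmf {1..m} (\<lambda>_. False) (\<lambda>t. Pi_pmf (vertex_pairs n) False (?q t))"
    unfolding multilayer_sbm_pmf_def sbm_pmf_def
    by (intro arg_cong[where f="Pi_pmf {1..m} (\<lambda>_. False)"] ext arg_cong[where f="Pi_pmf (vertex_pairs n) False"])
       (auto simp: fun_eq_iff split: prod.splits)
  have "measure_pmf.expectation (multilayer_sbm_pmf m n d l \<sigma>) (\<lambda>G. \<Prod>e\<in>vertex_pairs n. h e (\<lambda>t. G t e))
     = measure_pmf.expectation (map_pmf (\<lambda>G e t. G t e) (multilayer_sbm_pmf m n d l \<sigma>)) (\<lambda>H. \<Prod>e\<in>vertex_pairs n. h e (H e))"
    by simp
  also have "\<dots> = (\<Prod>e\<in>vertex_pairs n. measure_pmf.expectation (Pi_pmf {1..m} False (\<lambda>t. ?q t e)) (h e))"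
    unfolding ml by (subst Pi_pmf_swap) (auto intro!: expectation_prod_Pi_pmf_finite finite_set_Pi_pmf)
  finally show ?thesis .
qed

text \<open>Given the labels and \<open>u\<close>, the signals of distinct pairs are independent, so
  a monomial integrates factor by factor and only the labels and \<open>u\<close> remain to be
  averaged. Exponents up to 2 suffice for products of two cycles.\<close>

lemma csbm_moment:
  assumes k: "\<And>e. k e \<le> 2"
  shows "integrable (csbm_law m n p d l \<mu>) (\<lambda>y. \<Prod>e\<in>vertex_pairs (n + p). signal m n d \<alpha> \<beta> y e ^ k e)"
    and "(\<integral>y. (\<Prod>e\<in>vertex_pairs (n + p). signal m n d \<alpha> \<beta> y e ^ k e) \<partial>csbm_law m n p d l \<mu>)
      = measure_pmf.expectation (labels_pmf n) (\<lambda>\<sigma>. \<integral>u. (\<Prod>e\<in>vertex_pairs (n + p).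
          cond_moment m n d l \<mu> \<alpha> \<beta> \<sigma> u e (k e)) \<partial>std_gaussian p)"
proof -
  let ?F = "{(i, j). n < i \<and> i < j \<and> j \<le> n + p}" and ?S = "signal m n d \<alpha> \<beta>"
  let ?P = "labelled_graphs_pmf m n d l" and ?N = "std_gaussian p \<Otimes>\<^sub>M noise_law n p"
  define f where "f y = (\<Prod>e\<in>vertex_pairs (n + p). ?S y e ^ k e)" for y
  define s where "s \<sigma> i = sqrt (\<mu> / real n) * \<sigma> i" for \<sigma> and i :: nat
  define kk where "kk i r = k (i, n + r)" for i r
  define g :: "(nat \<Rightarrow> nat \<times> nat \<Rightarrow> bool) \<Rightarrow> real"
    where "g G = (\<Prod>e\<in>vertex_pairs n. (\<Sum>t=1..m. \<alpha> t * (of_bool (G t e) - d t / real n)) ^ k e)" for G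
  define z where "z = (\<Prod>e\<in>?F. 0 ^ k e :: real)"
  have [measurable]: "f \<in> borel_measurable (obs_space m n p)"
    unfolding f_def by measurable
  have latent: "latent_law m n p d l = measure_pmf ?P \<Otimes>\<^sub>M ?N"
    by (simp add: latent_law_def noise_law_def)
  \<comment> \<open>The monomial splits into a function of the graphs, a constant and a feature
    monomial. The constant \<open>z\<close> is 0 as soon as a pair of coordinates has a positive
    exponent, and 1 otherwise.\<close>
  have fo: "f (observe m n p \<mu> ((\<sigma>, G), (u, Z))) = g G * z * feature_monomial n p \<beta> (s \<sigma>) kk u Z" for \<sigma> G u Z
  proof -
    let ?y = "observe m n p \<mu> ((\<sigma>, G), (u, Z))"
    have "(\<Prod>e\<in>vertex_pairs n. ?S ?y e ^ k e) = g G"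
      unfolding g_def
      by (intro prod.cong refl arg_cong2[where f="(^)"])
         (auto simp: vertex_pairs_def signal_def observe_def adjacency_def intro!: sum.cong)
    moreover have "(\<Prod>i\<in>{1..n}. \<Prod>r\<in>{1..p}. ?S ?y (i, n + r) ^ k (i, n + r)) = feature_monomial n p \<beta> (s \<sigma>) kk u Z"
      unfolding feature_monomial_def kk_def
      by (intro prod.cong refl arg_cong2[where f="(^)"])
         (auto simp: signal_def observe_def feature_matrix_def s_def)
    moreover have "(\<Prod>e\<in>?F. ?S ?y e ^ k e) = z"
      unfolding z_def by (intro prod.cong refl arg_cong2[where f="(^)"]) (auto simp: signal_def)
    ultimately show ?thesis unfolding f_def prod_vertex_pairs by simp
  qed
  have kk: "kk i r \<le> 2" for i r using k by (simp add: kk_def)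
  have obs [measurable]: "(\<lambda>x. f (observe m n p \<mu> x)) \<in> borel_measurable (measure_pmf ?P \<Otimes>\<^sub>M ?N)"
    unfolding latent[symmetric] by measurable
  have N: "prob_space ?N" by (intro prob_space_pair prob_space_std_gaussian prob_space_noise_law)
  have int1: "integrable ?N (\<lambda>y. f (observe m n p \<mu> (x, y)))" for x
  proof -
    obtain \<sigma> G where x: "x = (\<sigma>, G)" by force
    have "integrable ?N (\<lambda>y. g G * z * (case y of (u, Z) \<Rightarrow> feature_monomial n p \<beta> (s \<sigma>) kk u Z))"
      by (intro integrable_mult_right integral_feature_monomial(1) kk)
    moreover have "(\<lambda>y. f (observe m n p \<mu> (x, y)))
        = (\<lambda>y. g G * z * (case y of (u, Z) \<Rightarrow> feature_monomial n p \<beta> (s \<sigma>) kk u Z))"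
      by (rule ext) (auto simp: x fo split: prod.split)
    ultimately show ?thesis by simp
  qed
  have val1: "(\<integral>y. f (observe m n p \<mu> ((\<sigma>, G), y)) \<partial>?N) = g G * (z *
     (\<integral>u. (\<Prod>i\<in>{1..n}. \<Prod>r\<in>{1..p}. \<integral>x. (\<beta> * (s \<sigma> i * u r + x)) ^ kk i r \<partial>gauss) \<partial>std_gaussian p))" for \<sigma> G
  proof -
    have "(\<integral>y. f (observe m n p \<mu> ((\<sigma>, G), y)) \<partial>?N)
       = (\<integral>y. g G * z * (case y of (u, Z) \<Rightarrow> feature_monomial n p \<beta> (s \<sigma>) kk u Z) \<partial>?N)"
      by (intro Bochner_Integration.integral_cong refl) (auto simp: fo)
    also have "\<dots> = g G * z * (\<integral>y. (case y of (u, Z) \<Rightarrow> feature_monomial n p \<beta> (s \<sigma>) kk u Z) \<partial>?N)"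
      by (rule integral_mult_right_zero)
    finally show ?thesis unfolding integral_feature_monomial(2)[OF kk] by simp
  qed
  have I: "integrable (measure_pmf ?P \<Otimes>\<^sub>M ?N) (\<lambda>x. f (observe m n p \<mu> x))"
    by (rule integral_measure_pmf_pair(1)[OF finite_set_labelled_graphs N obs int1])
  then have "integrable (csbm_law m n p d l \<mu>) f"
    unfolding csbm_law_def latent[symmetric] by (subst integrable_distr_eq[OF measurable_observe]) simp_all
  then show "integrable (csbm_law m n p d l \<mu>) (\<lambda>y. \<Prod>e\<in>vertex_pairs (n + p). ?S y e ^ k e)"
    unfolding f_def .
  have "(\<integral>y. f y \<partial>csbm_law m n p d l \<mu>) = (\<integral>x. f (observe m n p \<mu> x) \<partial>latent_law m n p d l)"
    unfolding csbm_law_def by (rule integral_distr[OF measurable_observe]) simp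
  also have "\<dots> = measure_pmf.expectation ?P (\<lambda>x. \<integral>y. f (observe m n p \<mu> (x, y)) \<partial>?N)"
    unfolding latent by (rule integral_measure_pmf_pair(2)[OF finite_set_labelled_graphs N obs int1])
  also have "\<dots> = measure_pmf.expectation (labels_pmf n) (\<lambda>\<sigma>. measure_pmf.expectation (multilayer_sbm_pmf m n d l \<sigma>)
      (\<lambda>G. \<integral>y. f (observe m n p \<mu> ((\<sigma>, G), y)) \<partial>?N))"
    unfolding labelled_graphs_pmf_def
    by (subst expectation_bind_finite) (auto simp: finite_set_labels finite_set_multilayer)
  also have "\<dots> = measure_pmf.expectation (labels_pmf n) (\<lambda>\<sigma>. \<integral>u. (\<Prod>e\<in>vertex_pairs (n + p).
          cond_moment m n d l \<mu> \<alpha> \<beta> \<sigma> u e (k e)) \<partial>std_gaussian p)"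
  proof (intro Bochner_Integration.integral_cong refl)
    fix \<sigma> :: "nat \<Rightarrow> real"
    let ?c = "cond_moment m n d l \<mu> \<alpha> \<beta> \<sigma>"
    have "measure_pmf.expectation (multilayer_sbm_pmf m n d l \<sigma>) g
       = (\<Prod>e\<in>vertex_pairs n. measure_pmf.expectation
        (Pi_pmf {1..m} False (\<lambda>t. bernoulli_pmf (case e of (i, j) \<Rightarrow>
           (if \<sigma> i = \<sigma> j then a_par (d t) (l t) else b_par (d t) (l t)) / real n)))
          (\<lambda>b. (\<Sum>t=1..m. \<alpha> t * (of_bool (b t) - d t / real n)) ^ k e))"
      unfolding g_def by (rule expectation_multilayer_prod)
    also have "\<dots> = (\<Prod>e\<in>vertex_pairs n. ?c u e (k e))" for u
      by (intro prod.cong refl) (auto simp: cond_moment_def layer_moment_def vertex_pairs_def)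
    finally have g: "measure_pmf.expectation (multilayer_sbm_pmf m n d l \<sigma>) g = (\<Prod>e\<in>vertex_pairs n. ?c u e (k e))" for u .
    have b: "(\<Prod>i\<in>{1..n}. \<Prod>r\<in>{1..p}. \<integral>x. (\<beta> * (s \<sigma> i * u r + x)) ^ kk i r \<partial>gauss)
        = (\<Prod>i\<in>{1..n}. \<Prod>r\<in>{1..p}. ?c u (i, n + r) (k (i, n + r)))" for u
      by (intro prod.cong refl) (auto simp: cond_moment_def s_def kk_def)
    have z: "z = (\<Prod>e\<in>?F. ?c u e (k e))" for u
      unfolding z_def by (intro prod.cong refl) (auto simp: cond_moment_def)
    have "measure_pmf.expectation (multilayer_sbm_pmf m n d l \<sigma>) (\<lambda>G. \<integral>y. f (observe m n p \<mu> ((\<sigma>, G), y)) \<partial>?N)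
      = measure_pmf.expectation (multilayer_sbm_pmf m n d l \<sigma>) g * (z *
         (\<integral>u. (\<Prod>i\<in>{1..n}. \<Prod>r\<in>{1..p}. \<integral>x. (\<beta> * (s \<sigma> i * u r + x)) ^ kk i r \<partial>gauss) \<partial>std_gaussian p))"
      unfolding val1 by (rule integral_mult_left_zero)
    also have "\<dots> = (\<integral>u. measure_pmf.expectation (multilayer_sbm_pmf m n d l \<sigma>) g * (z *
         (\<Prod>i\<in>{1..n}. \<Prod>r\<in>{1..p}. \<integral>x. (\<beta> * (s \<sigma> i * u r + x)) ^ kk i r \<partial>gauss)) \<partial>std_gaussian p)"
      by (simp only: integral_mult_right_zero)
    also have "\<dots> = (\<integral>u. (\<Prod>e\<in>vertex_pairs (n + p). ?c u e (k e)) \<partial>std_gaussian p)"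
    proof (intro Bochner_Integration.integral_cong refl)
      fix u
      show "measure_pmf.expectation (multilayer_sbm_pmf m n d l \<sigma>) g * (z *
         (\<Prod>i\<in>{1..n}. \<Prod>r\<in>{1..p}. \<integral>x. (\<beta> * (s \<sigma> i * u r + x)) ^ kk i r \<partial>gauss))
        = (\<Prod>e\<in>vertex_pairs (n + p). ?c u e (k e))"
        unfolding prod_vertex_pairs b g[of u] using z[of u] by (simp add: mult_ac)
    qed
    finally show "measure_pmf.expectation (multilayer_sbm_pmf m n d l \<sigma>) (\<lambda>G. \<integral>y. f (observe m n p \<mu> ((\<sigma>, G), y)) \<partial>?N)
      = (\<integral>u. (\<Prod>e\<in>vertex_pairs (n + p). ?c u e (k e)) \<partial>std_gaussian p)" .
  qed
  finally show "(\<integral>y. (\<Prod>e\<in>vertex_pairs (n + p). ?S y e ^ k e) \<partial>csbm_law m n p d l \<mu>)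
      = measure_pmf.expectation (labels_pmf n) (\<lambda>\<sigma>. \<integral>u. (\<Prod>e\<in>vertex_pairs (n + p).
          cond_moment m n d l \<mu> \<alpha> \<beta> \<sigma> u e (k e)) \<partial>std_gaussian p)"
    unfolding f_def .
qed

lemma expectation_Pi_pmf_insert:
  fixes F :: "('a \<Rightarrow> 'b) \<Rightarrow> real"
  assumes "finite A" "x \<notin> A" "\<And>y. y \<in> insert x A \<Longrightarrow> finite (set_pmf (p y))"
  shows "measure_pmf.expectation (Pi_pmf (insert x A) d p) F
    = measure_pmf.expectation (p x) (\<lambda>a. measure_pmf.expectation (Pi_pmf A d p) (\<lambda>b. F (b(x := a))))"
proof -
  have fin: "finite (set_pmf (p x))" "finite (set_pmf (Pi_pmf A d p))"
    using assms by (auto intro!: finite_set_Pi_pmf)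
  show ?thesis
    unfolding Pi_pmf_insert'[OF assms(1,2)] using fin
    by (subst expectation_bind_finite) (auto simp flip: map_pmf_def)
qed

text \<open>Variances of independent terms add, and each is at most the second moment. Both claims
  share one induction, because the cross term of the square involves the mean of the remaining
  sum.\<close>

lemma expectation_square_sum_Pi_pmf:
  fixes Y :: "'a \<Rightarrow> 'b \<Rightarrow> real"
  assumes "finite A" and fin: "\<And>x. finite (set_pmf (p x))"
  shows "measure_pmf.expectation (Pi_pmf A d p) (\<lambda>b. \<Sum>t\<in>A. Y t (b t))
        = (\<Sum>t\<in>A. measure_pmf.expectation (p t) (Y t))"
    and "measure_pmf.expectation (Pi_pmf A d p) (\<lambda>b. (\<Sum>t\<in>A. Y t (b t))\<^sup>2)
        \<le> (\<Sum>t\<in>A. measure_pmf.expectation (p t) (\<lambda>v. (Y t v)\<^sup>2)) + (\<Sum>t\<in>A. measure_pmf.expectation (p t) (Y t))\<^sup>2"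
  using assms(1)
proof (induction A rule: finite_induct)
  case (insert x A)
  let ?S = "\<lambda>b. \<Sum>t\<in>A. Y t (b t)" and ?E = "measure_pmf.expectation (Pi_pmf A d p)"
  let ?EY = "\<lambda>t. measure_pmf.expectation (p t) (Y t)"
  have ix: "integrable (measure_pmf (p x)) f" for f :: "'b \<Rightarrow> real"
    by (rule integrable_measure_pmf_finite[OF fin])
  have iA: "integrable (measure_pmf (Pi_pmf A d p)) f" for f :: "('a \<Rightarrow> 'b) \<Rightarrow> real"
    by (intro integrable_measure_pmf_finite finite_set_Pi_pmf insert.hyps fin)
  have upd: "(\<Sum>t\<in>insert x A. Y t ((b(x := a)) t)) = Y x a + ?S b" for a b
    using insert.hyps by (subst sum.insert) (auto intro!: sum.cong)
  have "measure_pmf.expectation (Pi_pmf (insert x A) d p) (\<lambda>b. \<Sum>t\<in>insert x A. Y t (b t))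
     = measure_pmf.expectation (p x) (\<lambda>a. ?E (\<lambda>b. Y x a + ?S b))"
    unfolding expectation_Pi_pmf_insert[OF insert.hyps fin] upd ..
  also have "\<dots> = measure_pmf.expectation (p x) (\<lambda>a. Y x a + ?E ?S)"
    by (simp add: Bochner_Integration.integral_add[OF iA iA])
  also have "\<dots> = ?EY x + ?E ?S"
    by (simp add: Bochner_Integration.integral_add[OF ix ix])
  finally show "measure_pmf.expectation (Pi_pmf (insert x A) d p) (\<lambda>b. \<Sum>t\<in>insert x A. Y t (b t))
     = (\<Sum>t\<in>insert x A. ?EY t)"
    using insert by simp
  have "measure_pmf.expectation (Pi_pmf (insert x A) d p) (\<lambda>b. (\<Sum>t\<in>insert x A. Y t (b t))\<^sup>2)
     = measure_pmf.expectation (p x) (\<lambda>a. ?E (\<lambda>b. (Y x a + ?S b)\<^sup>2))"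
    unfolding expectation_Pi_pmf_insert[OF insert.hyps fin] upd ..
  also have "\<dots> = measure_pmf.expectation (p x) (\<lambda>a. (Y x a)\<^sup>2 + (2 * ?E ?S * Y x a + ?E (\<lambda>b. (?S b)\<^sup>2)))"
  proof (intro Bochner_Integration.integral_cong refl)
    fix a
    have "?E (\<lambda>b. (Y x a + ?S b)\<^sup>2) = ?E (\<lambda>b. (Y x a)\<^sup>2 + (2 * Y x a * ?S b + (?S b)\<^sup>2))"
      by (simp add: power2_sum algebra_simps)
    also have "\<dots> = (Y x a)\<^sup>2 + (2 * Y x a * ?E ?S + ?E (\<lambda>b. (?S b)\<^sup>2))"
      by (simp add: Bochner_Integration.integral_add[OF iA iA])
    finally show "?E (\<lambda>b. (Y x a + ?S b)\<^sup>2) = (Y x a)\<^sup>2 + (2 * ?E ?S * Y x a + ?E (\<lambda>b. (?S b)\<^sup>2))"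
      by (simp add: mult_ac)
  qed
  also have "\<dots> = measure_pmf.expectation (p x) (\<lambda>a. (Y x a)\<^sup>2) + (2 * ?E ?S * ?EY x + ?E (\<lambda>b. (?S b)\<^sup>2))"
    by (simp add: Bochner_Integration.integral_add[OF ix ix])
  also have "?E ?S = (\<Sum>t\<in>A. ?EY t)" by (rule insert.IH(1))
  also have "measure_pmf.expectation (p x) (\<lambda>a. (Y x a)\<^sup>2) + (2 * (\<Sum>t\<in>A. ?EY t) * ?EY x + ?E (\<lambda>b. (?S b)\<^sup>2))
     \<le> measure_pmf.expectation (p x) (\<lambda>a. (Y x a)\<^sup>2) + (2 * (\<Sum>t\<in>A. ?EY t) * ?EY x
       + ((\<Sum>t\<in>A. measure_pmf.expectation (p t) (\<lambda>v. (Y t v)\<^sup>2)) + (\<Sum>t\<in>A. ?EY t)\<^sup>2))"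
    by (intro add_left_mono insert.IH(2))
  also have "\<dots> \<le> (\<Sum>t\<in>insert x A. measure_pmf.expectation (p t) (\<lambda>v. (Y t v)\<^sup>2)) + (\<Sum>t\<in>insert x A. ?EY t)\<^sup>2"
    using insert.hyps by (simp add: power2_sum algebra_simps)
  finally show "measure_pmf.expectation (Pi_pmf (insert x A) d p) (\<lambda>b. (\<Sum>t\<in>insert x A. Y t (b t))\<^sup>2)
     \<le> (\<Sum>t\<in>insert x A. measure_pmf.expectation (p t) (\<lambda>v. (Y t v)\<^sup>2)) + (\<Sum>t\<in>insert x A. ?EY t)\<^sup>2" .
qed simp_all

section \<open>Averages over uniform labels\<close>

lemma square_sign: "\<sigma> \<in> {1..n} \<rightarrow>\<^sub>E {-1, 1} \<Longrightarrow> x \<in> {1..n} \<Longrightarrow> (\<sigma> x)\<^sup>2 = (1 :: real)"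
  by (force simp: PiE_iff power2_eq_square)

text \<open>Flipping one label permutes the sign vectors and so preserves the uniform law. This is
  how terms odd in a single label are seen to vanish.\<close>

lemma expectation_labels_flip:
  fixes f :: "(nat \<Rightarrow> real) \<Rightarrow> real"
  assumes x: "x \<in> {1..n}"
  shows "measure_pmf.expectation (labels_pmf n) (\<lambda>\<sigma>. f (\<sigma>(x := - \<sigma> x))) = measure_pmf.expectation (labels_pmf n) f"
proof -
  let ?A = "{1..n} \<rightarrow>\<^sub>E {-1, 1 :: real}" and ?h = "\<lambda>\<sigma>. \<sigma>(x := - \<sigma> x) :: nat \<Rightarrow> real"
  have h: "?h \<sigma> \<in> ?A" if "\<sigma> \<in> ?A" for \<sigma>
  proof (rule PiE_I)
    fix y assume "y \<in> {1..n}"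
    then show "?h \<sigma> y \<in> {-1, 1}" using PiE_mem[OF that, of y] by auto
  next
    fix y assume "y \<notin> {1..n}"
    then show "?h \<sigma> y = undefined" using that x by (auto simp: PiE_iff extensional_def)
  qed
  have "bij_betw ?h ?A ?A"
  proof (rule bij_betwI[of _ _ _ ?h])
    show "?h \<in> ?A \<rightarrow> ?A" "?h \<in> ?A \<rightarrow> ?A" using h by blast+
  qed simp_all
  then have "map_pmf ?h (labels_pmf n) = labels_pmf n"
    unfolding labels_pmf_def
    by (intro map_pmf_of_set_bij_betw finite_PiE) (simp_all add: PiE_eq_empty_iff)
  then show ?thesis using integral_map_pmf[of ?h "labels_pmf n" f] by simp
qed

text \<open>The last node of the path occurs only in the last factor. Flipping its label changes the
  sign of the correlation term there and nothing else, so that factor averages to 1 and the path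
  gets shorter. A step to a node without a label carries no correlation, by
  \<open>out\<close>.\<close>

lemma expectation_path_correlations:
  fixes \<rho> :: "nat \<Rightarrow> real"
  assumes inj: "inj_on c {..k}" and out: "\<And>i. i < k \<Longrightarrow> c (Suc i) \<notin> {1..n} \<Longrightarrow> \<rho> i = 0"
  shows "measure_pmf.expectation (labels_pmf n) (\<lambda>\<sigma>. \<Prod>i<k. 1 + \<rho> i * \<sigma> (c i) * \<sigma> (c (Suc i))) = 1"
  using assms
proof (induction k)
  case (Suc k)
  let ?P = "\<lambda>\<sigma>. \<Prod>i<k. 1 + \<rho> i * \<sigma> (c i) * \<sigma> (c (Suc i)) :: real"
  let ?E = "measure_pmf.expectation (labels_pmf n)"
  note [simp] = integrable_measure_pmf_finite[OF finite_set_labels]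
  have IH: "?E ?P = 1" using Suc by (auto simp: inj_on_def)
  have "?E (\<lambda>\<sigma>. \<rho> k * (?P \<sigma> * \<sigma> (c k) * \<sigma> (c (Suc k)))) = 0"
  proof (cases "c (Suc k) \<in> {1..n}")
    case True
    let ?h = "\<lambda>\<sigma>. \<sigma>(c (Suc k) := - \<sigma> (c (Suc k))) :: nat \<Rightarrow> real"
    have ne: "c i \<noteq> c (Suc k)" if "i \<le> k" for i
      using Suc.prems(1) that by (auto dest!: inj_onD[of c "{..Suc k}" i "Suc k"])
    have "?P (?h \<sigma>) = ?P \<sigma>" for \<sigma>
      using ne by (intro prod.cong) auto
    then have "?E (\<lambda>\<sigma>. ?P \<sigma> * \<sigma> (c k) * \<sigma> (c (Suc k))) = ?E (\<lambda>\<sigma>. - (?P \<sigma> * \<sigma> (c k) * \<sigma> (c (Suc k))))"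
      using expectation_labels_flip[OF True, of "\<lambda>\<sigma>. ?P \<sigma> * \<sigma> (c k) * \<sigma> (c (Suc k))"] ne[of k]
      by simp
    then show ?thesis by simp
  next
    case False
    then show ?thesis using Suc.prems(2)[of k] by simp
  qed
  moreover have "(\<lambda>\<sigma>. \<Prod>i<Suc k. 1 + \<rho> i * \<sigma> (c i) * \<sigma> (c (Suc i)))
      = (\<lambda>\<sigma>. ?P \<sigma> + \<rho> k * (?P \<sigma> * \<sigma> (c k) * \<sigma> (c (Suc k))))"
    by (auto simp: algebra_simps)
  ultimately show ?case using IH by simp
qed simp

text \<open>Removing one edge of the cycle leaves a path, along which the correlations average to 1.\<close>

lemma expectation_cycle_correlations_le:
  fixes \<rho> :: "nat \<Rightarrow> real"
  assumes L: "L > 0" and inj: "inj_on c {..<L}" and \<rho>: "\<And>i. 0 \<le> \<rho> i" "\<And>i. \<rho> i \<le> 1"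
    and out: "\<And>i. i < L \<Longrightarrow> c i \<notin> {1..n} \<or> c (Suc i mod L) \<notin> {1..n} \<Longrightarrow> \<rho> i = 0"
  shows "measure_pmf.expectation (labels_pmf n) (\<lambda>\<sigma>. \<Prod>i<L. 1 + \<rho> i * \<sigma> (c i) * \<sigma> (c (Suc i mod L))) \<le> 2"
proof -
  obtain k where k: "L = Suc k" using L by (cases L) auto
  note [simp] = integrable_measure_pmf_finite[OF finite_set_labels]
  \<comment> \<open>The factor of the removed edge is bounded by 2; this preserves the inequality
    because the other factors are nonnegative.\<close>
  have bd: "0 \<le> 1 + \<rho> i * \<sigma> (c i) * \<sigma> (c (Suc i mod L)) \<and> 1 + \<rho> i * \<sigma> (c i) * \<sigma> (c (Suc i mod L)) \<le> 2"
    if "\<sigma> \<in> {1..n} \<rightarrow>\<^sub>E {-1, 1}" "i < L" for \<sigma> i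
  proof (cases "c i \<in> {1..n} \<and> c (Suc i mod L) \<in> {1..n}")
    case True
    then have "\<sigma> (c i) \<in> {-1, 1}" "\<sigma> (c (Suc i mod L)) \<in> {-1, 1}" using that by (auto simp: PiE_iff)
    then show ?thesis using \<rho>[of i] by auto
  qed (use out that in auto)
  have "measure_pmf.expectation (labels_pmf n) (\<lambda>\<sigma>. \<Prod>i<L. 1 + \<rho> i * \<sigma> (c i) * \<sigma> (c (Suc i mod L)))
     \<le> measure_pmf.expectation (labels_pmf n) (\<lambda>\<sigma>. (\<Prod>i<k. 1 + \<rho> i * \<sigma> (c i) * \<sigma> (c (Suc i))) * 2)"
  proof (intro integral_mono_AE AE_pmfI)
    fix \<sigma> assume "\<sigma> \<in> set_pmf (labels_pmf n)"
    then have \<sigma>: "\<sigma> \<in> {1..n} \<rightarrow>\<^sub>E {-1, 1}" by (simp add: set_labels)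
    have eq: "(\<Prod>i<k. 1 + \<rho> i * \<sigma> (c i) * \<sigma> (c (Suc i mod L))) = (\<Prod>i<k. 1 + \<rho> i * \<sigma> (c i) * \<sigma> (c (Suc i)))"
      by (intro prod.cong) (auto simp: k)
    have "0 \<le> (\<Prod>i<k. 1 + \<rho> i * \<sigma> (c i) * \<sigma> (c (Suc i mod L)))"
    proof (intro prod_nonneg)
      fix i assume "i \<in> {..<k}"
      then show "0 \<le> 1 + \<rho> i * \<sigma> (c i) * \<sigma> (c (Suc i mod L))" using bd[OF \<sigma>, of i] by (simp add: k)
    qed
    then show "(\<Prod>i<L. 1 + \<rho> i * \<sigma> (c i) * \<sigma> (c (Suc i mod L))) \<le> (\<Prod>i<k. 1 + \<rho> i * \<sigma> (c i) * \<sigma> (c (Suc i))) * 2"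
      using bd[OF \<sigma>, of k] unfolding eq k by (simp add: mult_left_mono eq[unfolded k])
  qed simp_all
  also have "\<dots> = 2"
  proof -
    have "measure_pmf.expectation (labels_pmf n) (\<lambda>\<sigma>. \<Prod>i<k. 1 + \<rho> i * \<sigma> (c i) * \<sigma> (c (Suc i))) = 1"
      using inj out k by (intro expectation_path_correlations) (auto simp: inj_on_def)
    then show ?thesis by simp
  qed
  finally show ?thesis .
qed

definition node_value :: "nat \<Rightarrow> (nat \<Rightarrow> real) \<Rightarrow> (nat \<Rightarrow> real) \<Rightarrow> nat \<Rightarrow> real" where
  "node_value n \<sigma> u x = (if x \<le> n then \<sigma> x else u (x - n))"

text \<open>Distinct nodes beyond \<open>n\<close> read distinct components of \<open>u\<close>,
  hence independent Gaussians; nodes up to \<open>n\<close> contribute constants, as the labels are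
  fixed here.\<close>

lemma integral_node_values:
  fixes f :: "nat \<Rightarrow> real \<Rightarrow> real"
  assumes A: "A \<subseteq> {1..n + p}" and f: "\<And>x. integrable gauss (f x)"
  shows "integrable (std_gaussian p) (\<lambda>u. \<Prod>x\<in>A. f x (node_value n \<sigma> u x))"
    and "(\<integral>u. (\<Prod>x\<in>A. f x (node_value n \<sigma> u x)) \<partial>std_gaussian p)
      = (\<Prod>x\<in>A. if x \<le> n then f x (\<sigma> x) else \<integral>z. f x z \<partial>gauss)"
proof -
  let ?g = "\<lambda>r z. if n + r \<in> A then f (n + r) z else 1"
  have finA: "finite A" using A finite_subset by blast
  have split: "(\<Prod>x\<in>A. h x) = (\<Prod>x\<in>{x\<in>A. x \<le> n}. h x) * (\<Prod>r\<in>{1..p}. if n + r \<in> A then h (n + r) else 1)"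
    for h :: "nat \<Rightarrow> real"
  proof -
    have "(\<Prod>x\<in>A. h x) = (\<Prod>x\<in>{x\<in>A. x \<le> n} \<union> {x\<in>A. x > n}. h x)"
      by (intro prod.cong) auto
    also have "\<dots> = (\<Prod>x\<in>{x\<in>A. x \<le> n}. h x) * (\<Prod>x\<in>{x\<in>A. x > n}. h x)"
      using finA by (intro prod.union_disjoint) auto
    also have "(\<Prod>x\<in>{x\<in>A. x > n}. h x) = (\<Prod>r\<in>{r\<in>{1..p}. n + r \<in> A}. h (n + r))"
      using A by (intro prod.reindex_bij_witness[of _ "\<lambda>r. n + r" "\<lambda>x. x - n"]) auto
    also have "\<dots> = (\<Prod>r\<in>{1..p}. if n + r \<in> A then h (n + r) else 1)"
      by (rule prod.inter_filter) simp
    finally show ?thesis .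
  qed
  have nv: "(\<Prod>x\<in>A. f x (node_value n \<sigma> u x))
     = (\<Prod>x\<in>{x\<in>A. x \<le> n}. f x (\<sigma> x)) * (\<Prod>r\<in>{1..p}. ?g r (u r))" for u
    unfolding split by (intro arg_cong2[where f="(*)"] prod.cong) (auto simp: node_value_def)
  have g: "integrable gauss (?g r)" for r by (cases "n + r \<in> A") (use f in auto)
  show "integrable (std_gaussian p) (\<lambda>u. \<Prod>x\<in>A. f x (node_value n \<sigma> u x))"
    unfolding nv by (intro integrable_mult_right integral_std_gaussian_prod(1) g)
  have "(\<integral>u. (\<Prod>x\<in>A. f x (node_value n \<sigma> u x)) \<partial>std_gaussian p)
    = (\<Prod>x\<in>{x\<in>A. x \<le> n}. f x (\<sigma> x)) * (\<integral>u. (\<Prod>r\<in>{1..p}. ?g r (u r)) \<partial>std_gaussian p)"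
    unfolding nv by (rule integral_mult_right_zero)
  also have "(\<integral>u. (\<Prod>r\<in>{1..p}. ?g r (u r)) \<partial>std_gaussian p) = (\<Prod>r\<in>{1..p}. \<integral>z. ?g r z \<partial>gauss)"
    by (rule integral_std_gaussian_prod(2)) (rule g)
  also have "(\<Prod>x\<in>{x\<in>A. x \<le> n}. f x (\<sigma> x)) * \<dots> = (\<Prod>x\<in>A. if x \<le> n then f x (\<sigma> x) else \<integral>z. f x z \<partial>gauss)"
    unfolding split by (intro arg_cong2[where f="(*)"] prod.cong) auto
  finally show "(\<integral>u. (\<Prod>x\<in>A. f x (node_value n \<sigma> u x)) \<partial>std_gaussian p)
      = (\<Prod>x\<in>A. if x \<le> n then f x (\<sigma> x) else \<integral>z. f x z \<partial>gauss)" .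
qed

section \<open>Conditional moments under the planted and the null law\<close>

text \<open>
  Given the node values, \<open>weight\<close> times their product is the mean of the signal of a pair, and \<open>weight\<close> is
  also the leading term of its second moment, under the planted law as well as under the null law.
\<close>

definition weight :: "nat \<Rightarrow> real \<Rightarrow> real \<Rightarrow> nat \<Rightarrow> nat \<Rightarrow> real" where
  "weight n \<Lambda> \<mu> x y = (if x \<le> n \<and> y \<le> n then \<Lambda> / real n else if x \<le> n \<or> y \<le> n then \<mu> / real n else 0)"

lemma weight_sym: "weight n \<Lambda> \<mu> x y = weight n \<Lambda> \<mu> y x"
  by (auto simp: weight_def)

lemma weight_nonneg: "\<Lambda> \<ge> 0 \<Longrightarrow> \<mu> \<ge> 0 \<Longrightarrow> weight n \<Lambda> \<mu> x y \<ge> 0"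
  by (auto simp: weight_def)

lemma prod_cyclic_shift:
  fixes f :: "nat \<Rightarrow> real"
  assumes "L > 0"
  shows "(\<Prod>i<L. f (Suc i mod L)) = (\<Prod>i<L. f i)"
proof -
  have inj: "inj_on (\<lambda>i. Suc i mod L) {..<L}" by (rule inj_onI) (auto intro: Suc_mod_inj)
  have "(\<lambda>i. Suc i mod L) ` {..<L} = {..<L}"
    using assms by (intro endo_inj_surj inj) auto
  then show ?thesis using prod.reindex[OF inj, of f] by simp
qed

lemma centered_bernoulli_moments:
  fixes q a x :: real
  assumes "0 \<le> q" "q \<le> 1"
  shows "measure_pmf.expectation (bernoulli_pmf q) (\<lambda>b. a * (of_bool b - x)) = a * (q - x)"
    and "measure_pmf.expectation (bernoulli_pmf q) (\<lambda>b. (a * (of_bool b - x))\<^sup>2) = a\<^sup>2 * (q - 2 * q * x + x\<^sup>2)"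
  using assms by (simp_all add: algebra_simps power2_eq_square)

text \<open>
  The law is the planted one for \<open>\<delta> = 1\<close> and the null one for \<open>\<delta> = 0\<close>; the statistic uses the planted
  parameters in both cases.
\<close>

locale planted =
  fixes m n p :: nat and d l :: "nat \<Rightarrow> real" and \<mu> \<delta> :: real
  assumes n: "n > 0" and d: "\<And>t. t \<in> {1..m} \<Longrightarrow> d t > 0" and l: "\<And>t. t \<in> {1..m} \<Longrightarrow> l t \<ge> 0"
    and \<mu>: "\<mu> \<ge> 0" and b_par: "\<And>t. t \<in> {1..m} \<Longrightarrow> b_par (d t) (l t) \<ge> 0"
    and a_par: "\<And>t. t \<in> {1..m} \<Longrightarrow> a_par (d t) (l t) \<le> real n"
    and \<delta>: "\<delta> = 0 \<or> \<delta> = 1"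
begin

definition snr :: real where "snr = (\<Sum>t=1..m. (l t)\<^sup>2)"
text \<open>The part of an edge signal's second moment that tells equal from unequal labels: the
  edge probability deviates from \<open>d t / n\<close> by \<open>l t * sqrt (d t) / n\<close>, and
  the squared weight \<open>(l t)^2 / d t\<close> turns this into
  \<open>l t ^ 3 / sqrt (d t)\<close> over \<open>n\<close>, the same order as the main term
  \<open>snr / n\<close>.\<close>

definition skew :: real where "skew = (\<Sum>t=1..m. l t ^ 3 / sqrt (d t))"
definition total_degree :: real where "total_degree = (\<Sum>t=1..m. d t)"
text \<open>The relative error \<open>1 + O(1 / n)\<close> of the second moments:
  \<open>total_degree\<close> comes from the squared centering, \<open>snr\<close> from the squared
  mean.\<close>

definition slack :: real where "slack = 1 + (total_degree + snr) / real n"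

text \<open>A centred edge has mean \<open>l t * sqrt (d t) / n\<close> up to sign and variance
  about \<open>d t / n\<close>, so the weight \<open>l t / sqrt (d t)\<close> turns both into
  \<open>(l t)^2 / n\<close>. A feature has mean \<open>sqrt (\<mu> / n)\<close> times its node
  values and unit noise, so the weight \<open>sqrt (\<mu> / n)\<close> turns both into
  \<open>\<mu> / n\<close>.\<close>

abbreviation "\<alpha> \<equiv> \<lambda>t. l t / sqrt (d t)"
abbreviation "\<beta> \<equiv> sqrt (\<mu> / real n)"
abbreviation "law \<equiv> csbm_law m n p d (\<lambda>t. \<delta> * l t) (\<delta> * \<mu>)"
abbreviation "sig \<equiv> signal m n d \<alpha> \<beta>"
abbreviation "cm \<equiv> cond_moment m n d (\<lambda>t. \<delta> * l t) (\<delta> * \<mu>) \<alpha> \<beta>"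
abbreviation "w \<equiv> weight n snr \<mu>"
abbreviation "N \<equiv> {1..n + p}"
abbreviation "lm \<equiv> layer_moment m n d (\<lambda>t. \<delta> * l t) \<alpha>"
abbreviation "signs \<equiv> {1..n} \<rightarrow>\<^sub>E {-1, 1 :: real}"

lemma snr_nonneg: "snr \<ge> 0" unfolding snr_def by (intro sum_nonneg) auto
lemma total_degree_nonneg: "total_degree \<ge> 0" unfolding total_degree_def using d by (intro sum_nonneg) (auto intro: less_imp_le)
lemma slack_ge_1: "slack \<ge> 1" unfolding slack_def using snr_nonneg total_degree_nonneg by simp

text \<open>Nonnegativity of \<open>b_par\<close> in another form. It yields
  \<open>skew \<le> snr\<close> and so keeps \<open>corr\<close> at most 1.\<close>

lemma l_le_sqrt: "t \<in> {1..m} \<Longrightarrow> l t \<le> sqrt (d t)"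
proof -
  assume t: "t \<in> {1..m}"
  have "l t * sqrt (d t) \<le> sqrt (d t) * sqrt (d t)"
    using b_par[OF t] d[OF t] by (simp add: b_par_def)
  then show ?thesis using d[OF t] by (intro mult_right_le_imp_le[of "l t" "sqrt (d t)" "sqrt (d t)"]) auto
qed

lemma skew_bounds: "0 \<le> skew" "skew \<le> snr"
proof -
  show "0 \<le> skew" unfolding skew_def using l d
    by (intro sum_nonneg divide_nonneg_nonneg zero_le_power) (auto simp: less_imp_le)
  show "skew \<le> snr" unfolding skew_def snr_def
  proof (rule sum_mono)
    fix t assume t: "t \<in> {1..m}"
    have "l t ^ 3 / sqrt (d t) = (l t)\<^sup>2 * (l t / sqrt (d t))" by (simp add: power3_eq_cube power2_eq_square)
    also have "\<dots> \<le> (l t)\<^sup>2 * 1"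
      using l_le_sqrt[OF t] d[OF t] by (intro mult_left_mono) auto
    finally show "l t ^ 3 / sqrt (d t) \<le> (l t)\<^sup>2" by simp
  qed
qed

definition edge_prob :: "bool \<Rightarrow> nat \<Rightarrow> real" where
  "edge_prob same t = (if same then a_par (d t) (\<delta> * l t) else b_par (d t) (\<delta> * l t)) / real n"

lemma edge_prob_eq: "edge_prob same t = (d t + \<delta> * (if same then 1 else -1) * l t * sqrt (d t)) / real n"
  by (simp add: edge_prob_def a_par_def b_par_def)

lemma edge_prob_bounds: "t \<in> {1..m} \<Longrightarrow> 0 \<le> edge_prob same t" "t \<in> {1..m} \<Longrightarrow> edge_prob same t \<le> 1"
proof -
  assume t: "t \<in> {1..m}"
  have p: "0 \<le> l t * sqrt (d t)" using l[OF t] d[OF t] by simp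
  have "l t * sqrt (d t) \<le> d t" "d t + l t * sqrt (d t) \<le> real n"
    using a_par[OF t] b_par[OF t] by (auto simp: a_par_def b_par_def)
  then show "0 \<le> edge_prob same t" "edge_prob same t \<le> 1"
    using \<delta> n d[OF t] p unfolding edge_prob_eq by (auto simp: mult.assoc)
qed

lemma edge_moment_1:
  assumes t: "t \<in> {1..m}"
  shows "measure_pmf.expectation (bernoulli_pmf (edge_prob same t)) (\<lambda>b. \<alpha> t * (of_bool b - d t / real n))
    = \<delta> * (if same then 1 else -1) * (l t)\<^sup>2 / real n"
proof -
  have "measure_pmf.expectation (bernoulli_pmf (edge_prob same t)) (\<lambda>b. \<alpha> t * (of_bool b - d t / real n))
    = \<alpha> t * (edge_prob same t - d t / real n)"
    by (intro centered_bernoulli_moments edge_prob_bounds t)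
  also have "\<dots> = \<alpha> t * (\<delta> * (if same then 1 else -1) * l t * sqrt (d t) / real n)"
    by (simp add: edge_prob_eq add_divide_distrib)
  also have "\<dots> = \<delta> * (if same then 1 else -1) * (l t)\<^sup>2 / real n"
    using d[OF t] by (simp add: power2_eq_square)
  finally show ?thesis .
qed

text \<open>The squared weight multiplies \<open>q - 2 * q * x + x^2\<close> with
  \<open>x = d t / n\<close>. The cross term is nonpositive and dropped; \<open>q\<close> gives the
  term of order \<open>1 / n\<close> and \<open>x^2\<close> the one of order
  \<open>1 / n^2\<close>.\<close>

lemma edge_moment_2:
  assumes t: "t \<in> {1..m}"
  shows "measure_pmf.expectation (bernoulli_pmf (edge_prob same t)) (\<lambda>b. (\<alpha> t * (of_bool b - d t / real n))\<^sup>2)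
    \<le> ((l t)\<^sup>2 + \<delta> * (if same then 1 else -1) * (l t ^ 3 / sqrt (d t))) / real n + (l t)\<^sup>2 * d t / (real n)\<^sup>2"
proof -
  let ?q = "edge_prob same t"
  have sq: "(sqrt (d t))\<^sup>2 = d t" "sqrt (d t) > 0" using d[OF t] by auto
  have "measure_pmf.expectation (bernoulli_pmf ?q) (\<lambda>b. (\<alpha> t * (of_bool b - d t / real n))\<^sup>2)
    = (\<alpha> t)\<^sup>2 * (?q - 2 * ?q * (d t / real n) + (d t / real n)\<^sup>2)"
    by (intro centered_bernoulli_moments edge_prob_bounds t)
  also have "\<dots> \<le> (\<alpha> t)\<^sup>2 * (?q + (d t / real n)\<^sup>2)"
    using edge_prob_bounds[OF t, of same] d[OF t] by (intro mult_left_mono) auto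
  also have "\<dots> = ((l t)\<^sup>2 + \<delta> * (if same then 1 else -1) * (l t ^ 3 / sqrt (d t))) / real n + (l t)\<^sup>2 * d t / (real n)\<^sup>2"
  proof -
    have "(\<alpha> t)\<^sup>2 * (?q + (d t / real n)\<^sup>2) = (l t)\<^sup>2 / d t * ((d t + \<delta> * (if same then 1 else -1) * l t * sqrt (d t)) / real n + (d t)\<^sup>2 / (real n)\<^sup>2)"
      using sq by (simp add: power_divide edge_prob_eq)
    also have "(l t)\<^sup>2 / d t * (d t)\<^sup>2 / (real n)\<^sup>2 = (l t)\<^sup>2 * d t / (real n)\<^sup>2"
      using d[OF t] by (simp add: power2_eq_square)
    then have "(l t)\<^sup>2 / d t * ((d t + \<delta> * (if same then 1 else -1) * l t * sqrt (d t)) / real n + (d t)\<^sup>2 / (real n)\<^sup>2)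
       = (l t)\<^sup>2 / d t * ((d t + \<delta> * (if same then 1 else -1) * l t * sqrt (d t)) / real n) + (l t)\<^sup>2 * d t / (real n)\<^sup>2"
      by (simp add: distrib_left)
    also have "(l t)\<^sup>2 / d t * ((d t + \<delta> * (if same then 1 else -1) * l t * sqrt (d t)) / real n)
       = ((l t)\<^sup>2 + \<delta> * (if same then 1 else -1) * (l t ^ 3 * (sqrt (d t) / d t))) / real n"
      using d[OF t] n by (simp add: field_simps power2_eq_square power3_eq_cube)
    also have "sqrt (d t) / d t = 1 / sqrt (d t)"
      using sq by (simp add: field_simps power2_eq_square flip: real_sqrt_mult)
    finally show ?thesis by simp
  qed
  finally show ?thesis .
qed

lemma layer_moment_eq:
  "lm same k = measure_pmf.expectation (Pi_pmf {1..m} False (\<lambda>t. bernoulli_pmf (edge_prob same t)))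
     (\<lambda>b. (\<Sum>t=1..m. \<alpha> t * (of_bool (b t) - d t / real n)) ^ k)"
  unfolding layer_moment_def edge_prob_def ..

lemma layer_moment_0: "lm same 0 = 1"
  by (simp add: layer_moment_eq)

lemma layer_moment_1: "lm same 1 = \<delta> * (if same then 1 else -1) * snr / real n"
proof -
  have "lm same 1 = (\<Sum>t=1..m. measure_pmf.expectation (bernoulli_pmf (edge_prob same t)) (\<lambda>b. \<alpha> t * (of_bool b - d t / real n)))"
    unfolding layer_moment_eq power_one_right by (rule expectation_square_sum_Pi_pmf(1)) auto
  also have "\<dots> = (\<Sum>t=1..m. \<delta> * (if same then 1 else -1) * (l t)\<^sup>2 / real n)"
    by (intro sum.cong refl edge_moment_1)
  finally show ?thesis unfolding snr_def by (simp only: sum_distrib_left sum_divide_distrib)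
qed

lemma layer_moment_2:
  "0 \<le> lm same 2"
  "lm same 2 \<le> (snr * slack + \<delta> * (if same then 1 else -1) * skew) / real n"
proof -
  show "0 \<le> lm same 2" unfolding layer_moment_eq by simp
  let ?s = "\<delta> * (if same then 1 else -1) :: real"
  have "lm same 2 \<le> (\<Sum>t=1..m. measure_pmf.expectation (bernoulli_pmf (edge_prob same t)) (\<lambda>b. (\<alpha> t * (of_bool b - d t / real n))\<^sup>2))
      + (\<Sum>t=1..m. measure_pmf.expectation (bernoulli_pmf (edge_prob same t)) (\<lambda>b. \<alpha> t * (of_bool b - d t / real n)))\<^sup>2"
    unfolding layer_moment_eq by (rule expectation_square_sum_Pi_pmf(2)) auto
  also have "(\<Sum>t=1..m. measure_pmf.expectation (bernoulli_pmf (edge_prob same t)) (\<lambda>b. \<alpha> t * (of_bool b - d t / real n)))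
      = ?s * snr / real n"
    using layer_moment_1[of same] unfolding layer_moment_eq power_one_right
    by (subst (asm) expectation_square_sum_Pi_pmf(1)) auto
  also have "(\<Sum>t=1..m. measure_pmf.expectation (bernoulli_pmf (edge_prob same t)) (\<lambda>b. (\<alpha> t * (of_bool b - d t / real n))\<^sup>2))
     \<le> (\<Sum>t=1..m. ((l t)\<^sup>2 + ?s * (l t ^ 3 / sqrt (d t))) / real n + (l t)\<^sup>2 * d t / (real n)\<^sup>2)"
    by (intro sum_mono edge_moment_2)
  also have "\<dots> = (snr + ?s * skew) / real n + (\<Sum>t=1..m. (l t)\<^sup>2 * d t) / (real n)\<^sup>2"
    unfolding snr_def skew_def
    by (simp only: sum.distrib sum_divide_distrib sum_distrib_left add_divide_distrib)
  \<comment> \<open>Replacing each \<open>d t\<close> by \<open>total_degree\<close> makes both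
    terms of order \<open>1 / n^2\<close> multiples of \<open>snr\<close>, so that they merge into
    \<open>slack\<close>.\<close>
  also have "(\<Sum>t=1..m. (l t)\<^sup>2 * d t) \<le> (\<Sum>t=1..m. (l t)\<^sup>2 * total_degree)"
  proof (intro sum_mono mult_left_mono)
    show "d t \<le> total_degree" if "t \<in> {1..m}" for t
      unfolding total_degree_def using that d by (intro member_le_sum) (auto intro: less_imp_le)
  qed simp
  also have "(\<Sum>t=1..m. (l t)\<^sup>2 * total_degree) = snr * total_degree"
    by (simp add: snr_def sum_distrib_right)
  finally have "lm same 2 \<le> (snr + ?s * skew) / real n + snr * total_degree / (real n)\<^sup>2 + (?s * snr / real n)\<^sup>2"
    by (simp add: divide_right_mono)
  also have "(?s * snr / real n)\<^sup>2 \<le> snr\<^sup>2 / (real n)\<^sup>2"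
    using \<delta> by (auto simp: power_mult_distrib power_divide)
  also have "(snr + ?s * skew) / real n + snr * total_degree / (real n)\<^sup>2 + snr\<^sup>2 / (real n)\<^sup>2
     = (snr * slack + ?s * skew) / real n"
    unfolding slack_def using n by (simp add: field_simps power2_eq_square)
  finally show "lm same 2 \<le> (snr * slack + ?s * skew) / real n" by simp
qed

section \<open>Conditional moments of one pair in terms of the node values\<close>

abbreviation "nv \<equiv> node_value n"

lemma same_sign: "\<sigma> \<in> signs \<Longrightarrow> i \<in> {1..n} \<Longrightarrow> j \<in> {1..n} \<Longrightarrow> (if \<sigma> i = \<sigma> j then 1 else -1) = \<sigma> i * \<sigma> j"
  using PiE_mem[of \<sigma> "{1..n}" "\<lambda>_. {-1, 1}" i] PiE_mem[of \<sigma> "{1..n}" "\<lambda>_. {-1, 1}" j] by auto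

lemma cm_0: "cm \<sigma> u e 0 = 1"
  by (auto simp: cond_moment_def layer_moment_0 split: prod.splits)

lemma cm_1:
  assumes \<sigma>: "\<sigma> \<in> signs" and e: "(x, y) \<in> vertex_pairs (n + p)"
  shows "cm \<sigma> u (x, y) 1 = \<delta> * w x y * nv \<sigma> u x * nv \<sigma> u y"
proof -
  have xy: "1 \<le> x" "x < y" using e by (auto simp: vertex_pairs_def)
  consider "y \<le> n" | "y > n" "x \<le> n" | "x > n" by linarith
  then show ?thesis
  proof cases
    case 1
    have "cm \<sigma> u (x, y) 1 = \<delta> * (if \<sigma> x = \<sigma> y then 1 else -1) * snr / real n"
      using 1 by (simp add: cond_moment_def layer_moment_1[unfolded One_nat_def])
    also have "\<dots> = \<delta> * w x y * nv \<sigma> u x * nv \<sigma> u y"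
      using 1 xy by (subst same_sign[OF \<sigma>]) (auto simp: weight_def node_value_def)
    finally show ?thesis .
  next
    case 2
    have "cm \<sigma> u (x, y) 1 = \<beta> * (sqrt (\<delta> * \<mu> / real n) * \<sigma> x * u (y - n))"
      using 2 unfolding cond_moment_def prod.case by (simp only: integral_gauss_affine(1)) simp
    \<comment> \<open>\<open>\<delta>\<close> is 0 or 1 and therefore passes through the square
      root.\<close>
    also have "\<beta> * (sqrt (\<delta> * \<mu> / real n) * \<sigma> x * u (y - n)) = \<delta> * (\<beta> * \<beta>) * \<sigma> x * u (y - n)"
      using \<delta> by (elim disjE) (simp, simp only: mult_1_left mult.assoc)
    also have "\<beta> * \<beta> = \<mu> / real n" using \<mu> by simp
    finally show ?thesis using 2 by (simp add: weight_def node_value_def)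
  next
    case 3
    then show ?thesis using xy by (simp add: cond_moment_def weight_def)
  qed
qed

text \<open>Solves \<open>snr * slack * (1 + corr * s) = snr * slack + \<delta> * skew * s\<close>,
  so that the second moment of a pair of vertices is bounded by its weight times a label
  correlation. For \<open>snr = 0\<close> the quotient is 0, consistent with
  \<open>skew = 0\<close>.\<close>

definition corr :: real where "corr = \<delta> * (skew / snr) / slack"

lemma corr_bounds: "0 \<le> corr" "corr \<le> 1"
proof -
  have 1: "0 \<le> skew / snr" "skew / snr \<le> 1" using skew_bounds snr_nonneg by (auto intro!: divide_le_eq_1[THEN iffD2] divide_nonneg_nonneg)
  have 2: "0 \<le> \<delta> * (skew / snr)" "\<delta> * (skew / snr) \<le> 1" using \<delta> 1 by (elim disjE; simp)+
  have "0 \<le> X / slack \<and> X / slack \<le> 1" if "0 \<le> X" "X \<le> 1" for X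
    using slack_ge_1 that by (auto simp: divide_le_eq_1)
  from this[OF 2] show "0 \<le> corr" "corr \<le> 1" unfolding corr_def by simp_all
qed

text \<open>At a coordinate this bounds the growth of a feature's second moment with
  \<open>u\<close>. One factor per end point lets the product over a cycle be regrouped by
  nodes.\<close>

definition node_factor :: "nat \<Rightarrow> real \<Rightarrow> real" where
  "node_factor x s = (if x \<le> n then 1 else 1 + \<mu> / real n * s\<^sup>2)"

lemma cm_2:
  assumes \<sigma>: "\<sigma> \<in> signs" and e: "(x, y) \<in> vertex_pairs (n + p)"
  shows "0 \<le> cm \<sigma> u (x, y) 2"
    and "cm \<sigma> u (x, y) 2 \<le> w x y * slack * (1 + (if x \<le> n \<and> y \<le> n then corr else 0) * \<sigma> x * \<sigma> y)
           * (node_factor x (nv \<sigma> u x) * node_factor y (nv \<sigma> u y))"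
proof -
  have xy: "1 \<le> x" "x < y" using e by (auto simp: vertex_pairs_def)
  consider "y \<le> n" | "y > n" "x \<le> n" | "x > n" by linarith
  then have "0 \<le> cm \<sigma> u (x, y) 2 \<and> cm \<sigma> u (x, y) 2 \<le> w x y * slack * (1 + (if x \<le> n \<and> y \<le> n then corr else 0) * \<sigma> x * \<sigma> y)
           * (node_factor x (nv \<sigma> u x) * node_factor y (nv \<sigma> u y))"
  proof cases
    case 1
    have eq: "cm \<sigma> u (x, y) 2 = lm (\<sigma> x = \<sigma> y) 2" using 1 by (simp add: cond_moment_def)
    have sk: "skew = snr * (skew / snr)" using skew_bounds by (cases "snr = 0") auto
    have "lm (\<sigma> x = \<sigma> y) 2 \<le> (snr * slack + \<delta> * (\<sigma> x * \<sigma> y) * skew) / real n"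
      using layer_moment_2(2)[of "\<sigma> x = \<sigma> y"] 1 xy by (subst (asm) same_sign[OF \<sigma>]) auto
    also have "\<dots> = (snr * slack + \<delta> * (\<sigma> x * \<sigma> y) * (snr * (skew / snr))) / real n"
      using sk by simp
    also have "\<dots> = snr / real n * slack * (1 + corr * \<sigma> x * \<sigma> y)"
      unfolding corr_def using slack_ge_1 n by (simp add: field_simps)
    finally show ?thesis using 1 xy layer_moment_2(1) by (simp add: eq weight_def node_factor_def)
  next
    case 2
    have "cm \<sigma> u (x, y) 2 = \<beta>\<^sup>2 * ((sqrt (\<delta> * \<mu> / real n) * \<sigma> x * u (y - n))\<^sup>2 + 1)"
      using 2 unfolding cond_moment_def prod.case by (simp only: integral_gauss_affine(2)) simp
    also have "\<dots> = \<mu> / real n * (1 + \<delta> * \<mu> / real n * (u (y - n))\<^sup>2)"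
      using \<mu> \<delta> 2 xy by (auto simp: power_mult_distrib square_sign[OF \<sigma>])
    finally have eq: "cm \<sigma> u (x, y) 2 = \<mu> / real n * (1 + \<delta> * \<mu> / real n * (u (y - n))\<^sup>2)" .
    have "\<mu> / real n * (1 + \<delta> * \<mu> / real n * (u (y - n))\<^sup>2) \<le> \<mu> / real n * (1 + \<mu> / real n * (u (y - n))\<^sup>2)"
      using \<delta> \<mu> by (intro mult_left_mono) auto
    also have "\<dots> \<le> slack * (\<mu> / real n * (1 + \<mu> / real n * (u (y - n))\<^sup>2))"
      using slack_ge_1 \<mu> mult_right_mono[of 1 slack "\<mu> / real n * (1 + \<mu> / real n * (u (y - n))\<^sup>2)"] by simp
    finally have "cm \<sigma> u (x, y) 2 \<le> slack * (\<mu> / real n * (1 + \<mu> / real n * (u (y - n))\<^sup>2))"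
      unfolding eq .
    moreover have "0 \<le> cm \<sigma> u (x, y) 2" unfolding eq using \<mu> \<delta> by auto
    ultimately show ?thesis using 2 by (simp add: weight_def node_factor_def node_value_def mult_ac)
  next
    case 3
    then show ?thesis using xy by (simp add: cond_moment_def weight_def)
  qed
  then show "0 \<le> cm \<sigma> u (x, y) 2"
    and "cm \<sigma> u (x, y) 2 \<le> w x y * slack * (1 + (if x \<le> n \<and> y \<le> n then corr else 0) * \<sigma> x * \<sigma> y)
           * (node_factor x (nv \<sigma> u x) * node_factor y (nv \<sigma> u y))"
    by auto
qed

text \<open>Free of \<open>n\<close> and \<open>p\<close>: it enters an error term of the variance
  that must vanish as \<open>n\<close> grows with \<open>L\<close> fixed.\<close>

definition crude :: real where "crude = 1 + snr * (2 + total_degree + snr) + \<mu> * (1 + \<mu>)"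

lemma crude_ge_1: "crude \<ge> 1"
  unfolding crude_def using snr_nonneg total_degree_nonneg \<mu> by simp

text \<open>For overlapping cycles only the order \<open>1 / n\<close> of each distinct pair
  matters, whether it is used once or twice. Hence one bound for both exponents, with the dependence
  on \<open>u\<close> in a factor per end point.\<close>

lemma abs_cm_le:
  assumes \<sigma>: "\<sigma> \<in> signs" and e: "(x, y) \<in> vertex_pairs (n + p)" and k: "k = 1 \<or> k = 2"
  shows "\<bar>cm \<sigma> u (x, y) k\<bar> \<le> crude / real n * ((1 + (nv \<sigma> u x)\<^sup>2) * (1 + (nv \<sigma> u y)\<^sup>2))"
proof -
  have n1: "real n \<ge> 1" using n by simp
  have xy: "1 \<le> x" "x < y" using e by (auto simp: vertex_pairs_def)
  have h: "1 \<le> 1 + s\<^sup>2" for s :: real by simp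
  have slack: "slack \<le> 1 + total_degree + snr"
    unfolding slack_def using n1 snr_nonneg total_degree_nonneg
    by (simp add: divide_le_eq mult_right_le_one_le add_nonneg_nonneg mult_le_cancel_left1)
  have cs: "snr * (2 + total_degree + snr) \<le> crude" "\<mu> * (1 + \<mu>) \<le> crude"
    unfolding crude_def using snr_nonneg total_degree_nonneg \<mu> by auto
  consider "y \<le> n" | "y > n" "x \<le> n" | "x > n" by linarith
  then show ?thesis
  proof cases
    case 1
    have "\<bar>cm \<sigma> u (x, y) k\<bar> \<le> snr * (2 + total_degree + snr) / real n"
      using k
    proof
      assume "k = 1"
      then have "\<bar>cm \<sigma> u (x, y) k\<bar> = \<bar>\<delta> * (if \<sigma> x = \<sigma> y then 1 else -1) * snr / real n\<bar>"
        using 1 by (simp add: cond_moment_def layer_moment_1[unfolded One_nat_def])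
      also have "\<dots> \<le> snr / real n" using \<delta> snr_nonneg by auto
      also have "\<dots> \<le> snr * (2 + total_degree + snr) / real n"
        using snr_nonneg total_degree_nonneg n1 by (intro divide_right_mono) (auto simp: mult_le_cancel_left1)
      finally show ?thesis .
    next
      assume k: "k = 2"
      have "cm \<sigma> u (x, y) k = lm (\<sigma> x = \<sigma> y) 2" using 1 k by (simp add: cond_moment_def)
      then have "\<bar>cm \<sigma> u (x, y) k\<bar> \<le> (snr * slack + \<delta> * (if \<sigma> x = \<sigma> y then 1 else -1) * skew) / real n"
        using layer_moment_2[of "\<sigma> x = \<sigma> y"] by simp
      also have "\<dots> \<le> (snr * (1 + total_degree + snr) + snr) / real n"
        using slack skew_bounds snr_nonneg \<delta> by (intro divide_right_mono add_mono mult_left_mono) auto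
      finally show ?thesis by (simp add: algebra_simps)
    qed
    also have "\<dots> \<le> crude / real n * 1" using cs n1 by (simp add: divide_right_mono)
    also have "\<dots> \<le> crude / real n * ((1 + (nv \<sigma> u x)\<^sup>2) * (1 + (nv \<sigma> u y)\<^sup>2))"
      using crude_ge_1 mult_mono[OF h h, of "nv \<sigma> u x" "nv \<sigma> u y"] by (intro mult_left_mono) auto
    finally show ?thesis .
  next
    case 2
    let ?v = "u (y - n)"
    have nvy: "nv \<sigma> u y = ?v" using 2 by (simp add: node_value_def)
    have \<sigma>x: "\<bar>\<sigma> x\<bar> = 1" "(\<sigma> x)\<^sup>2 = 1" using square_sign[OF \<sigma>, of x] 2 xy by (auto simp: power2_eq_1_iff)
    have "\<bar>cm \<sigma> u (x, y) k\<bar> \<le> \<mu> * (1 + \<mu>) / real n * (1 + ?v\<^sup>2)"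
      using k
    proof
      assume "k = 1"
      then have "\<bar>cm \<sigma> u (x, y) k\<bar> = \<bar>\<delta>\<bar> * (\<mu> / real n) * \<bar>?v\<bar>"
        using cm_1[OF \<sigma> e, of u] 2 \<sigma>x \<mu> by (simp add: weight_def node_value_def abs_mult)
      also have "\<dots> \<le> 1 * (\<mu> * (1 + \<mu>) / real n) * (1 + ?v\<^sup>2)"
        using \<delta> \<mu> abs_power_le_1_square[of 1 ?v] n1
        by (intro mult_mono divide_right_mono) (auto simp: mult_le_cancel_left1)
      finally show ?thesis by simp
    next
      assume k: "k = 2"
      have "cm \<sigma> u (x, y) k = \<beta>\<^sup>2 * ((sqrt (\<delta> * \<mu> / real n) * \<sigma> x * u (y - n))\<^sup>2 + 1)"
        using 2 k unfolding cond_moment_def prod.case by (simp only: integral_gauss_affine(2)) simp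
      also have "\<dots> = \<mu> / real n * (1 + \<delta> * \<mu> / real n * ?v\<^sup>2)"
        using \<mu> \<delta> \<sigma>x by (auto simp: power_mult_distrib)
      also have "\<dots> \<le> \<mu> / real n * ((1 + \<mu>) * (1 + ?v\<^sup>2))"
      proof (intro mult_left_mono)
        have "\<delta> * \<mu> / real n \<le> \<mu>" using \<delta> \<mu> n1 by (auto simp: divide_le_eq mult_le_cancel_left1)
        then have "\<delta> * \<mu> / real n * ?v\<^sup>2 \<le> \<mu> * ?v\<^sup>2" by (rule mult_right_mono) simp
        then have "1 + \<delta> * \<mu> / real n * ?v\<^sup>2 \<le> 1 + \<mu> * ?v\<^sup>2" by simp
        also have "\<dots> \<le> (1 + \<mu>) * (1 + ?v\<^sup>2)" using \<mu> by (simp add: algebra_simps)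
        finally show "1 + \<delta> * \<mu> / real n * ?v\<^sup>2 \<le> (1 + \<mu>) * (1 + ?v\<^sup>2)" .
      qed (use \<mu> in auto)
      finally have "cm \<sigma> u (x, y) k \<le> \<mu> * (1 + \<mu>) / real n * (1 + ?v\<^sup>2)" by simp
      moreover have "0 \<le> cm \<sigma> u (x, y) k" using cm_2(1)[OF \<sigma> e] k by simp
      ultimately show ?thesis by simp
    qed
    also have "\<dots> \<le> crude / real n * ((1 + (nv \<sigma> u x)\<^sup>2) * (1 + (nv \<sigma> u y)\<^sup>2))"
      unfolding nvy using cs crude_ge_1 h[of "nv \<sigma> u x"] mult_right_mono[OF h[of "nv \<sigma> u x"], of "1 + ?v\<^sup>2"]
      by (intro mult_mono divide_right_mono) auto
    finally show ?thesis .
  next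
    case 3
    then have "cm \<sigma> u (x, y) k = 0" using xy k by (auto simp: cond_moment_def)
    then show ?thesis using crude_ge_1 by simp
  qed
qed

end

section \<open>Variance of the cycle statistic\<close>

lemma expectation_labels_le:
  assumes "\<And>\<sigma>. \<sigma> \<in> {1..n} \<rightarrow>\<^sub>E {-1, 1} \<Longrightarrow> F \<sigma> \<le> (B :: real)"
  shows "measure_pmf.expectation (labels_pmf n) F \<le> B"
proof -
  have "measure_pmf.expectation (labels_pmf n) F \<le> measure_pmf.expectation (labels_pmf n) (\<lambda>_. B)"
    by (intro integral_mono_AE AE_pmfI integrable_measure_pmf_finite finite_set_labels) (auto simp: set_labels assms)
  then show ?thesis by simp
qed

lemma expectation_labels_eq:
  assumes "\<And>\<sigma>. \<sigma> \<in> {1..n} \<rightarrow>\<^sub>E {-1, 1} \<Longrightarrow> F \<sigma> = (B :: real)"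
  shows "measure_pmf.expectation (labels_pmf n) F = B"
proof -
  have "measure_pmf.expectation (labels_pmf n) F = measure_pmf.expectation (labels_pmf n) (\<lambda>_. B)"
    by (intro integral_cong_AE AE_pmfI) (auto simp: set_labels assms)
  then show ?thesis by simp
qed

lemma cycles_inj: "c \<in> cycles L N \<Longrightarrow> inj_on c {..<L}"
  by (simp add: cycles_def)

lemma prod_edges:
  fixes f :: "nat \<times> nat \<Rightarrow> real"
  assumes "L \<ge> 3" "c \<in> cycles L N"
  shows "(\<Prod>e\<in>edges L c. f e) = (\<Prod>i<L. f (step L c i))"
  unfolding edges_def using inj_on_step[OF assms(1) cycles_inj[OF assms(2)]]
  by (simp add: prod.reindex)

lemma prod_cycle_nodes:
  fixes f :: "nat \<Rightarrow> real"
  assumes "c \<in> cycles L N"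
  shows "(\<Prod>x\<in>c ` {..<L}. f x) = (\<Prod>i<L. f (c i))"
  using cycles_inj[OF assms] by (simp add: prod.reindex)

text \<open>Each node of a cycle is the start of one step and the end of another.\<close>

lemma prod_cycle_ends:
  fixes f :: "nat \<Rightarrow> real"
  assumes "L > 0" "c \<in> cycles L N"
  shows "(\<Prod>i<L. f (c i) * f (c (Suc i mod L))) = (\<Prod>x\<in>c ` {..<L}. (f x)\<^sup>2)"
  using prod_cyclic_shift[OF assms(1), of "\<lambda>i. f (c i)"]
  by (simp add: prod_cycle_nodes[OF assms(2)] prod.distrib power2_eq_square)

lemma step_vertex_pairs:
  assumes "L \<ge> 3" "c \<in> cycles L {1..k}" "i < L"
  shows "step L c i \<in> vertex_pairs k"
proof -
  define j where "j = Suc i mod L"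
  have m: "j < L" "j \<noteq> i" using assms by (auto simp: mod_Suc j_def)
  have ne: "c i \<noteq> c j"
    using inj_onD[OF cycles_inj[OF assms(2)], of i j] assms m by auto
  have c: "c \<in> {..<L} \<rightarrow>\<^sub>E {1..k}" using assms(2) by (simp add: cycles_def)
  have "c i \<in> {1..k}" "c j \<in> {1..k}"
    by (rule PiE_mem[OF c], use assms m in simp)+
  then show ?thesis
    using ne by (auto simp: step_def edge_def vertex_pairs_def min_def max_def simp flip: j_def)
qed

lemma edges_vertex_pairs:
  "L \<ge> 3 \<Longrightarrow> c \<in> cycles L {1..k} \<Longrightarrow> edges L c \<subseteq> vertex_pairs k"
  unfolding edges_def using step_vertex_pairs by auto

text \<open>Turns the product over the steps into a monomial over all pairs with exponents 0 and 1,
  the form in which \<open>csbm_moment\<close> computes expectations.\<close>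

lemma prod_pairs_of_bool:
  fixes f :: "nat \<times> nat \<Rightarrow> real"
  assumes "L \<ge> 3" "c \<in> cycles L {1..k}"
  shows "(\<Prod>i<L. f (step L c i)) = (\<Prod>e\<in>vertex_pairs k. f e ^ of_bool (e \<in> edges L c))"
proof -
  have "(\<Prod>e\<in>vertex_pairs k. f e ^ of_bool (e \<in> edges L c)) = (\<Prod>e\<in>edges L c. f e ^ of_bool (e \<in> edges L c))"
    using edges_vertex_pairs[OF assms] by (intro prod.mono_neutral_right) auto
  also have "\<dots> = (\<Prod>e\<in>edges L c. f e)" by (intro prod.cong) auto
  finally show ?thesis using prod_edges[OF assms] by simp
qed

lemma integral_gauss_quartic: "(\<integral>z. (1 + a * z\<^sup>2)\<^sup>2 \<partial>gauss) = 1 + 2 * a + 3 * a\<^sup>2"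
  and integrable_gauss_quartic: "integrable gauss (\<lambda>z. (1 + a * z\<^sup>2)\<^sup>2)"
proof -
  have 4: "(\<integral>x. x ^ 4 \<partial>gauss) = 3"
    using integral_gauss_power(1)[of 2] by (simp add: fact_numeral)
  have eq: "(\<lambda>z. (1 + a * z\<^sup>2)\<^sup>2) = (\<lambda>z. 1 + (2 * a * z\<^sup>2 + a\<^sup>2 * z ^ 4))"
    by (auto simp: power2_eq_square algebra_simps power4_eq_xxxx)
  show "integrable gauss (\<lambda>z. (1 + a * z\<^sup>2)\<^sup>2)"
    unfolding eq by (intro Bochner_Integration.integrable_add integrable_mult_right integrable_gauss_power) simp
  show "(\<integral>z. (1 + a * z\<^sup>2)\<^sup>2 \<partial>gauss) = 1 + 2 * a + 3 * a\<^sup>2"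
    unfolding eq by (simp add: 4 integral_gauss_2)
qed

context planted
begin

definition cycle_signal :: "nat \<Rightarrow> (nat \<Rightarrow> nat) \<Rightarrow> _ \<Rightarrow> real" where
  "cycle_signal L c y = (\<Prod>i<L. sig y (step L c i))"

definition cycle_stat :: "nat \<Rightarrow> _ \<Rightarrow> real" where
  "cycle_stat L y = (\<Sum>c\<in>cycles L N. cycle_signal L c y)"

text \<open>The planted mean for either value of \<open>\<delta>\<close>. The actual mean is
  \<open>\<delta> * mean_stat L\<close>, so one cutoff serves both laws.\<close>

definition mean_stat :: "nat \<Rightarrow> real" where
  "mean_stat L = (\<Sum>c\<in>cycles L N. cycle_weight L w c)"

lemma w_nonneg: "w x y \<ge> 0"
  using weight_nonneg snr_nonneg \<mu> .

lemma cycle_weight_nonneg: "cycle_weight L w c \<ge> 0"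
  unfolding cycle_weight_def by (intro prod_nonneg w_nonneg ballI)

lemma cm_1_step:
  assumes \<sigma>: "\<sigma> \<in> signs" and L: "L \<ge> 3" and c: "c \<in> cycles L N" and i: "i < L"
  shows "cm \<sigma> u (step L c i) 1 = \<delta> * w (c i) (c (Suc i mod L)) * (nv \<sigma> u (c i) * nv \<sigma> u (c (Suc i mod L)))"
  using cm_1[OF \<sigma>, of "min (c i) (c (Suc i mod L))" "max (c i) (c (Suc i mod L))" u] step_vertex_pairs[OF L c i]
  by (auto simp: step_def edge_def min_def max_def weight_sym split: if_splits)

text \<open>Each node value occurs in two steps and hence squared, with average 1 for labels and for
  Gaussians alike. This is why the mean of a cycle survives the averaging, while that of a path
  between distinct nodes would not.\<close>

lemma prod_cm_1:
  assumes \<sigma>: "\<sigma> \<in> signs" and L: "L \<ge> 3" and c: "c \<in> cycles L N"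
  shows "(\<Prod>e\<in>edges L c. cm \<sigma> u e 1) = \<delta> * cycle_weight L w c * (\<Prod>x\<in>c ` {..<L}. (nv \<sigma> u x)\<^sup>2)"
proof -
  have "(\<Prod>e\<in>edges L c. cm \<sigma> u e 1)
     = (\<Prod>i<L. \<delta> * w (c i) (c (Suc i mod L)) * (nv \<sigma> u (c i) * nv \<sigma> u (c (Suc i mod L))))"
    unfolding prod_edges[OF L c] by (intro prod.cong refl cm_1_step \<sigma> L c) auto
  also have "\<dots> = \<delta> ^ L * cycle_weight L w c * (\<Prod>i<L. nv \<sigma> u (c i) * nv \<sigma> u (c (Suc i mod L)))"
    by (simp add: prod.distrib cycle_weight_def)
  also have "(\<Prod>i<L. nv \<sigma> u (c i) * nv \<sigma> u (c (Suc i mod L))) = (\<Prod>x\<in>c ` {..<L}. (nv \<sigma> u x)\<^sup>2)"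
    using L by (intro prod_cycle_ends[OF _ c]) auto
  also have "\<delta> ^ L = \<delta>" using \<delta> L by auto
  finally show ?thesis .
qed

lemma integral_squares:
  assumes "\<sigma> \<in> signs" "A \<subseteq> N"
  shows "(\<integral>u. (\<Prod>x\<in>A. (nv \<sigma> u x)\<^sup>2) \<partial>std_gaussian p) = 1"
proof -
  have "(\<integral>u. (\<Prod>x\<in>A. (nv \<sigma> u x)\<^sup>2) \<partial>std_gaussian p) = (\<Prod>x\<in>A. if x \<le> n then (\<sigma> x)\<^sup>2 else \<integral>z. z\<^sup>2 \<partial>gauss)"
    by (rule integral_node_values(2)) (use assms in simp_all)
  also have "\<dots> = 1"
    using assms by (intro prod.neutral ballI) (auto simp: integral_gauss_2 square_sign)
  finally show ?thesis .
qed

lemma nodes_subset: "c \<in> cycles L N \<Longrightarrow> c ` {..<L} \<subseteq> N"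
  by (auto simp: cycles_def)

lemma prod_cm_support:
  assumes F: "F \<subseteq> vertex_pairs (n + p)" and k: "\<And>e. e \<notin> F \<Longrightarrow> k e = 0"
  shows "(\<Prod>e\<in>vertex_pairs (n + p). cm \<sigma> u e (k e)) = (\<Prod>e\<in>F. cm \<sigma> u e (k e))"
  using F k by (intro prod.mono_neutral_right) (auto simp: cm_0)

lemma integral_cycle_signal:
  assumes L: "L \<ge> 3" and c: "c \<in> cycles L N"
  shows "integrable law (cycle_signal L c)" "(\<integral>y. cycle_signal L c y \<partial>law) = \<delta> * cycle_weight L w c"
proof -
  let ?k = "\<lambda>e. of_bool (e \<in> edges L c) :: nat"
  have k: "?k e \<le> 2" for e by simp
  have sig: "cycle_signal L c = (\<lambda>y. \<Prod>e\<in>vertex_pairs (n + p). sig y e ^ ?k e)"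
    unfolding cycle_signal_def using prod_pairs_of_bool[OF L c] by auto
  show "integrable law (cycle_signal L c)"
    unfolding sig by (rule csbm_moment(1)) (rule k)
  show "(\<integral>y. cycle_signal L c y \<partial>law) = \<delta> * cycle_weight L w c"
    unfolding sig csbm_moment(2)[OF k]
  proof (rule expectation_labels_eq)
    fix \<sigma> assume \<sigma>: "\<sigma> \<in> signs"
    have "(\<Prod>e\<in>vertex_pairs (n + p). cm \<sigma> u e (?k e)) = \<delta> * cycle_weight L w c * (\<Prod>x\<in>c ` {..<L}. (nv \<sigma> u x)\<^sup>2)" for u
    proof -
      have "(\<Prod>e\<in>vertex_pairs (n + p). cm \<sigma> u e (?k e)) = (\<Prod>e\<in>edges L c. cm \<sigma> u e (?k e))"
        by (rule prod_cm_support) (use edges_vertex_pairs[OF L c] in auto)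
      also have "\<dots> = (\<Prod>e\<in>edges L c. cm \<sigma> u e 1)" by (intro prod.cong) auto
      finally show ?thesis using prod_cm_1[OF \<sigma> L c] by simp
    qed
    then show "(\<integral>u. (\<Prod>e\<in>vertex_pairs (n + p). cm \<sigma> u e (?k e)) \<partial>std_gaussian p) = \<delta> * cycle_weight L w c"
      using integral_squares[OF \<sigma> nodes_subset[OF c]] by simp
  qed
qed

section \<open>Mixed moments of two cycles\<close>

definition pair_exponent :: "nat \<Rightarrow> (nat \<Rightarrow> nat) \<Rightarrow> (nat \<Rightarrow> nat) \<Rightarrow> nat \<times> nat \<Rightarrow> nat" where
  "pair_exponent L c c' e = of_bool (e \<in> edges L c) + of_bool (e \<in> edges L c')"

lemma cycle_signal_mult:
  assumes L: "L \<ge> 3" and c: "c \<in> cycles L N" and c': "c' \<in> cycles L N"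
  shows "integrable law (\<lambda>y. cycle_signal L c y * cycle_signal L c' y)"
    and "(\<integral>y. cycle_signal L c y * cycle_signal L c' y \<partial>law)
     = measure_pmf.expectation (labels_pmf n) (\<lambda>\<sigma>. \<integral>u. (\<Prod>e\<in>edges L c \<union> edges L c'.
         cm \<sigma> u e (pair_exponent L c c' e)) \<partial>std_gaussian p)"
proof -
  have k: "pair_exponent L c c' e \<le> 2" for e by (simp add: pair_exponent_def)
  have sig: "(\<lambda>y. cycle_signal L c y * cycle_signal L c' y) = (\<lambda>y. \<Prod>e\<in>vertex_pairs (n + p). sig y e ^ pair_exponent L c c' e)"
    unfolding cycle_signal_def pair_exponent_def power_add prod.distrib
    using prod_pairs_of_bool[OF L c] prod_pairs_of_bool[OF L c'] by auto
  show "integrable law (\<lambda>y. cycle_signal L c y * cycle_signal L c' y)"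
    unfolding sig by (rule csbm_moment(1)) (rule k)
  have "(\<Prod>e\<in>vertex_pairs (n + p). cm \<sigma> u e (pair_exponent L c c' e))
     = (\<Prod>e\<in>edges L c \<union> edges L c'. cm \<sigma> u e (pair_exponent L c c' e))" for \<sigma> u
    by (rule prod_cm_support)
       (use edges_vertex_pairs[OF L c] edges_vertex_pairs[OF L c'] in \<open>auto simp: pair_exponent_def\<close>)
  then show "(\<integral>y. cycle_signal L c y * cycle_signal L c' y \<partial>law)
     = measure_pmf.expectation (labels_pmf n) (\<lambda>\<sigma>. \<integral>u. (\<Prod>e\<in>edges L c \<union> edges L c'.
         cm \<sigma> u e (pair_exponent L c c' e)) \<partial>std_gaussian p)"
    unfolding sig csbm_moment(2)[OF k] by simp
qed

text \<open>No pair is used twice, and the squared node values over the union of the two node sets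
  still integrate to 1.\<close>

lemma disjoint_cycles:
  assumes L: "L \<ge> 3" and c: "c \<in> cycles L N" and c': "c' \<in> cycles L N" and disj: "c ` {..<L} \<inter> c' ` {..<L} = {}"
  shows "(\<integral>y. cycle_signal L c y * cycle_signal L c' y \<partial>law) = (\<delta> * cycle_weight L w c) * (\<delta> * cycle_weight L w c')"
  unfolding cycle_signal_mult(2)[OF L c c']
proof (rule expectation_labels_eq)
  fix \<sigma> assume \<sigma>: "\<sigma> \<in> signs"
  have ed: "edges L c \<inter> edges L c' = {}"
  proof -
    have False if e: "e \<in> edges L c" "e \<in> edges L c'" for e
    proof -
      obtain i where i: "e = edge (c i) (c (Suc i mod L))" using e(1) unfolding edges_def step_def by blast
      have "c i \<in> c ` {..<L}" "c i \<in> c' ` {..<L}"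
        using edges_vertices[OF e(1)[unfolded i]] edges_vertices[OF e(2)[unfolded i]] by simp_all
      then have "c i \<in> c ` {..<L} \<inter> c' ` {..<L}" by (rule IntI)
      then show False unfolding disj by simp
    qed
    then show ?thesis by auto
  qed
  have "(\<Prod>e\<in>edges L c \<union> edges L c'. cm \<sigma> u e (pair_exponent L c c' e))
    = (\<delta> * cycle_weight L w c) * (\<delta> * cycle_weight L w c') * (\<Prod>x\<in>c ` {..<L} \<union> c' ` {..<L}. (nv \<sigma> u x)\<^sup>2)" for u
  proof -
    have "(\<Prod>e\<in>edges L c \<union> edges L c'. cm \<sigma> u e (pair_exponent L c c' e))
       = (\<Prod>e\<in>edges L c. cm \<sigma> u e (pair_exponent L c c' e)) * (\<Prod>e\<in>edges L c'. cm \<sigma> u e (pair_exponent L c c' e))"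
      by (rule prod.union_disjoint) (use ed in auto)
    also have "(\<Prod>e\<in>edges L c. cm \<sigma> u e (pair_exponent L c c' e)) = (\<Prod>e\<in>edges L c. cm \<sigma> u e 1)"
      using ed by (intro prod.cong) (auto simp: pair_exponent_def)
    also have "(\<Prod>e\<in>edges L c'. cm \<sigma> u e (pair_exponent L c c' e)) = (\<Prod>e\<in>edges L c'. cm \<sigma> u e 1)"
      using ed by (intro prod.cong) (auto simp: pair_exponent_def)
    finally have "(\<Prod>e\<in>edges L c \<union> edges L c'. cm \<sigma> u e (pair_exponent L c c' e))
       = (\<delta> * cycle_weight L w c * (\<Prod>x\<in>c ` {..<L}. (nv \<sigma> u x)\<^sup>2)) * (\<delta> * cycle_weight L w c' * (\<Prod>x\<in>c' ` {..<L}. (nv \<sigma> u x)\<^sup>2))"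
      unfolding prod_cm_1[OF \<sigma> L c] prod_cm_1[OF \<sigma> L c'] .
    also have "\<dots> = (\<delta> * cycle_weight L w c) * (\<delta> * cycle_weight L w c')
        * ((\<Prod>x\<in>c ` {..<L}. (nv \<sigma> u x)\<^sup>2) * (\<Prod>x\<in>c' ` {..<L}. (nv \<sigma> u x)\<^sup>2))"
      by (simp only: mult_ac)
    also have "(\<Prod>x\<in>c ` {..<L}. (nv \<sigma> u x)\<^sup>2) * (\<Prod>x\<in>c' ` {..<L}. (nv \<sigma> u x)\<^sup>2) = (\<Prod>x\<in>c ` {..<L} \<union> c' ` {..<L}. (nv \<sigma> u x)\<^sup>2)"
      by (rule prod.union_disjoint[symmetric]) (use disj in auto)
    finally show ?thesis .
  qed
  then show "(\<integral>u. (\<Prod>e\<in>edges L c \<union> edges L c'. cm \<sigma> u e (pair_exponent L c c' e)) \<partial>std_gaussian p)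
     = (\<delta> * cycle_weight L w c) * (\<delta> * cycle_weight L w c')"
    using integral_squares[OF \<sigma>, of "c ` {..<L} \<union> c' ` {..<L}"] nodes_subset[OF c] nodes_subset[OF c'] by simp
qed

text \<open>16 is the value of \<open>(1 + s^2) ^ 4\<close> at a label, so one constant covers both
  kinds of nodes.\<close>

definition gauss_moment :: real where
  "gauss_moment = max 16 (\<integral>z. (1 + z\<^sup>2) ^ 4 \<partial>gauss)"

text \<open>Each distinct pair contributes a factor of order \<open>1 / n\<close>. A node meets two
  steps of each cycle, so its factor \<open>1 + s^2\<close> occurs at most four times, and a
  Gaussian moment of degree 8 bounds the rest uniformly.\<close>

lemma overlapping_cycles:
  assumes L: "L \<ge> 3" and c: "c \<in> cycles L N" and c': "c' \<in> cycles L N"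
  shows "(\<integral>y. cycle_signal L c y * cycle_signal L c' y \<partial>law)
    \<le> (crude / real n) ^ card (edges L c \<union> edges L c') * gauss_moment ^ (2 * L)"
  unfolding cycle_signal_mult(2)[OF L c c']
proof (rule expectation_labels_le)
  fix \<sigma> assume \<sigma>: "\<sigma> \<in> signs"
  let ?E = "edges L c" and ?E' = "edges L c'" and ?V = "c ` {..<L}" and ?V' = "c' ` {..<L}"
  let ?h = "\<lambda>u x. 1 + (nv \<sigma> u x)\<^sup>2"
  let ?g = "\<lambda>u e. ?h u (fst e) * ?h u (snd e)"
  have h1: "1 \<le> ?h u x" for u x by simp
  have g1: "1 \<le> ?g u e" for u e using mult_mono[OF h1 h1, of u "fst e" u "snd e"] by simp
  have Eg: "(\<Prod>e\<in>edges L b. ?g u e) = (\<Prod>x\<in>b ` {..<L}. (?h u x)\<^sup>2)" if "b \<in> cycles L N" for b u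
  proof -
    have "(\<Prod>e\<in>edges L b. ?g u e) = (\<Prod>i<L. ?h u (b i) * ?h u (b (Suc i mod L)))"
      unfolding prod_edges[OF L that]
      by (intro prod.cong refl) (auto simp: step_def edge_def min_def max_def)
    then show ?thesis using L by (subst prod_cycle_ends[symmetric, OF _ that]) auto
  qed
  have mono: "(\<Prod>x\<in>A. (?h u x)\<^sup>2) \<le> (\<Prod>x\<in>B. (?h u x)\<^sup>2)" if "A \<subseteq> B" "finite B" for A B u
    using that by (intro prod_mono2) (auto simp: one_le_power)
  let ?I = "(crude / real n) ^ card (?E \<union> ?E')"
  have "(\<integral>u. (\<Prod>e\<in>?E \<union> ?E'. cm \<sigma> u e (pair_exponent L c c' e)) \<partial>std_gaussian p)
     \<le> (\<integral>u. ?I * (\<Prod>x\<in>?V \<union> ?V'. (1 + (nv \<sigma> u x)\<^sup>2) ^ 4) \<partial>std_gaussian p)"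
  proof (rule integral_mono')
    have "integrable gauss (\<lambda>z. (1 + z\<^sup>2) ^ 4)"
      using integrable_gauss_prod[of "{..<4 :: nat}" "\<lambda>_. 1" "\<lambda>_. 1" 0] by simp
    then show "integrable (std_gaussian p) (\<lambda>u. ?I * (\<Prod>x\<in>?V \<union> ?V'. (1 + (nv \<sigma> u x)\<^sup>2) ^ 4))"
      using nodes_subset[OF c] nodes_subset[OF c']
      by (intro integrable_mult_right integral_node_values(1)) auto
    fix u
    show "0 \<le> ?I * (\<Prod>x\<in>?V \<union> ?V'. (1 + (nv \<sigma> u x)\<^sup>2) ^ 4)"
      using crude_ge_1 by (intro mult_nonneg_nonneg prod_nonneg) auto
    have "(\<Prod>e\<in>?E \<union> ?E'. cm \<sigma> u e (pair_exponent L c c' e)) \<le> (\<Prod>e\<in>?E \<union> ?E'. \<bar>cm \<sigma> u e (pair_exponent L c c' e)\<bar>)"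
      by (simp only: abs_prod[symmetric] abs_ge_self)
    also have "\<dots> \<le> (\<Prod>e\<in>?E \<union> ?E'. crude / real n * ?g u e)"
    proof (intro prod_mono conjI)
      fix e assume e: "e \<in> ?E \<union> ?E'"
      then have "e \<in> vertex_pairs (n + p)" "pair_exponent L c c' e = 1 \<or> pair_exponent L c c' e = 2"
        using edges_vertex_pairs[OF L c] edges_vertex_pairs[OF L c'] by (auto simp: pair_exponent_def)
      then show "\<bar>cm \<sigma> u e (pair_exponent L c c' e)\<bar> \<le> crude / real n * ?g u e"
        using abs_cm_le[OF \<sigma>, of "fst e" "snd e"] by simp
    qed simp
    also have "\<dots> = ?I * (\<Prod>e\<in>?E \<union> ?E'. ?g u e)"
      by (simp only: prod.distrib[of "\<lambda>_. crude / real n"] prod_constant)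
    also have "\<dots> \<le> ?I * (\<Prod>x\<in>?V \<union> ?V'. (1 + (nv \<sigma> u x)\<^sup>2) ^ 4)"
    proof (rule mult_left_mono)
      \<comment> \<open>All factors \<open>?g u e\<close> are at least 1, so common pairs may be
        counted twice and the node products enlarged to the union.\<close>
      have "(\<Prod>e\<in>?E \<union> ?E'. ?g u e) = (\<Prod>e\<in>?E. ?g u e) * (\<Prod>e\<in>?E' - ?E. ?g u e)"
        by (subst prod.union_disjoint[symmetric]) (auto intro!: prod.cong)
      also have "\<dots> \<le> (\<Prod>e\<in>?E. ?g u e) * (\<Prod>e\<in>?E'. ?g u e)"
      proof (intro mult_left_mono prod_mono2 prod_nonneg ballI)
        show "0 \<le> ?g u e" for e using g1[of u e] by linarith
        show "0 \<le> ?g u e" for e using g1[of u e] by linarith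
      qed (use g1 in auto)
      also have "\<dots> \<le> (\<Prod>x\<in>?V \<union> ?V'. (?h u x)\<^sup>2) * (\<Prod>x\<in>?V \<union> ?V'. (?h u x)\<^sup>2)"
        unfolding Eg[OF c] Eg[OF c'] by (intro mult_mono mono prod_nonneg) auto
      also have "\<dots> = (\<Prod>x\<in>?V \<union> ?V'. (1 + (nv \<sigma> u x)\<^sup>2) ^ 4)"
        by (simp add: prod.distrib[symmetric] power_add[symmetric])
      finally show "(\<Prod>e\<in>?E \<union> ?E'. ?g u e) \<le> (\<Prod>x\<in>?V \<union> ?V'. (1 + (nv \<sigma> u x)\<^sup>2) ^ 4)" .
    qed (use crude_ge_1 in auto)
    finally show "(\<Prod>e\<in>?E \<union> ?E'. cm \<sigma> u e (pair_exponent L c c' e)) \<le> ?I * (\<Prod>x\<in>?V \<union> ?V'. (1 + (nv \<sigma> u x)\<^sup>2) ^ 4)" .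
  qed
  also have "\<dots> = ?I * (\<Prod>x\<in>?V \<union> ?V'. if x \<le> n then (1 + (\<sigma> x)\<^sup>2) ^ 4 else \<integral>z. (1 + z\<^sup>2) ^ 4 \<partial>gauss)"
  proof -
    have "integrable gauss (\<lambda>z. (1 + z\<^sup>2) ^ 4)"
      using integrable_gauss_prod[of "{..<4 :: nat}" "\<lambda>_. 1" "\<lambda>_. 1" 0] by simp
    then show ?thesis
      using nodes_subset[OF c] nodes_subset[OF c'] integral_node_values(2)[of "?V \<union> ?V'" n p "\<lambda>_ z. (1 + z\<^sup>2) ^ 4" \<sigma>]
      by simp
  qed
  also have "\<dots> \<le> ?I * (\<Prod>x\<in>?V \<union> ?V'. gauss_moment)"
  proof (intro mult_left_mono prod_mono conjI)
    fix x assume "x \<in> ?V \<union> ?V'"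
    then have "x \<in> N" using nodes_subset[OF c] nodes_subset[OF c'] by auto
    then show "(if x \<le> n then (1 + (\<sigma> x)\<^sup>2) ^ 4 else \<integral>z. (1 + z\<^sup>2) ^ 4 \<partial>gauss) \<le> gauss_moment"
      using square_sign[OF \<sigma>, of x] by (auto simp: gauss_moment_def)
  qed (use crude_ge_1 in auto)
  also have "\<dots> \<le> ?I * gauss_moment ^ (2 * L)"
  proof (intro mult_left_mono)
    have "card (?V \<union> ?V') \<le> 2 * L"
      using card_Un_le[of ?V ?V'] card_image_le[of "{..<L}" c] card_image_le[of "{..<L}" c'] by simp
    then show "(\<Prod>x\<in>?V \<union> ?V'. gauss_moment) \<le> gauss_moment ^ (2 * L)"
      by (simp add: power_increasing gauss_moment_def)
  qed (use crude_ge_1 in auto)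
  finally show "(\<integral>u. (\<Prod>e\<in>?E \<union> ?E'. cm \<sigma> u e (pair_exponent L c c' e)) \<partial>std_gaussian p) \<le> ?I * gauss_moment ^ (2 * L)" .
qed

text \<open>The Gaussian integral of the squared \<open>node_factor\<close> at a coordinate, again
  \<open>1 + O(1 / n)\<close>.\<close>

definition node_moment :: real where
  "node_moment = 1 + 2 * (\<mu> / real n) + 3 * (\<mu> / real n)\<^sup>2"

lemma node_moment_ge_1: "node_moment \<ge> 1"
  unfolding node_moment_def using \<mu> by simp

text \<open>All pairs occur squared, so the conditional moment is the product of the weights times
  errors \<open>1 + O(1 / n)\<close> and one label correlation per step. Bounding each correlation
  by 2 would cost \<open>2 ^ L\<close>, which can outgrow the mean; averaged around the cycle they
  cost a single factor 2.\<close>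

lemma equal_cycles:
  assumes L: "L \<ge> 3" and c: "c \<in> cycles L N" and c': "c' \<in> cycles L N" and same: "edges L c' = edges L c"
  shows "(\<integral>y. cycle_signal L c y * cycle_signal L c' y \<partial>law) \<le> 2 * (slack * node_moment) ^ L * cycle_weight L w c"
proof -
  let ?V = "c ` {..<L}"
  let ?r = "\<lambda>i. if c i \<le> n \<and> c (Suc i mod L) \<le> n then corr else 0"
  let ?P = "\<lambda>\<sigma>. \<Prod>i<L. 1 + ?r i * \<sigma> (c i) * \<sigma> (c (Suc i mod L))"
  let ?K = "cycle_weight L w c * slack ^ L * node_moment ^ L"
  have cN: "c i \<in> N" if "i < L" for i using nodes_subset[OF c] that by auto
  have Pnn: "0 \<le> 1 + ?r i * \<sigma> (c i) * \<sigma> (c (Suc i mod L))" if \<sigma>: "\<sigma> \<in> signs" and i: "i < L" for \<sigma> i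
  proof (cases "c i \<le> n \<and> c (Suc i mod L) \<le> n")
    case True
    have "c i \<in> {1..n}" "c (Suc i mod L) \<in> {1..n}"
      using True cN[OF i] cN[of "Suc i mod L"] L by auto
    from this[THEN PiE_mem[OF \<sigma>]] show ?thesis using True corr_bounds by auto
  qed auto
  have step: "0 \<le> cm \<sigma> u (step L c i) 2 \<and> cm \<sigma> u (step L c i) 2 \<le> w (c i) (c (Suc i mod L)) * slack * (1 + ?r i * \<sigma> (c i) * \<sigma> (c (Suc i mod L)))
      * (node_factor (c i) (nv \<sigma> u (c i)) * node_factor (c (Suc i mod L)) (nv \<sigma> u (c (Suc i mod L))))"
    if \<sigma>: "\<sigma> \<in> signs" and i: "i < L" for \<sigma> u i
  proof (cases "c i \<le> c (Suc i mod L)")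
    case True
    then have "step L c i = (c i, c (Suc i mod L))" by (simp add: step_def edge_def)
    then show ?thesis using cm_2[OF \<sigma>, of "c i" "c (Suc i mod L)" u] step_vertex_pairs[OF L c i] by simp
  next
    case False
    then have eq: "step L c i = (c (Suc i mod L), c i)" by (simp add: step_def edge_def)
    have "0 \<le> cm \<sigma> u (step L c i) 2 \<and> cm \<sigma> u (step L c i) 2
      \<le> w (c (Suc i mod L)) (c i) * slack * (1 + (if c (Suc i mod L) \<le> n \<and> c i \<le> n then corr else 0) * \<sigma> (c (Suc i mod L)) * \<sigma> (c i))
      * (node_factor (c (Suc i mod L)) (nv \<sigma> u (c (Suc i mod L))) * node_factor (c i) (nv \<sigma> u (c i)))"
      using cm_2[OF \<sigma>, of "c (Suc i mod L)" "c i" u] step_vertex_pairs[OF L c i] unfolding eq by simp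
    moreover have "w (c (Suc i mod L)) (c i) = w (c i) (c (Suc i mod L))" by (rule weight_sym)
    ultimately show ?thesis by (simp add: mult_ac conj_commute)
  qed
  have bound: "(\<integral>u. (\<Prod>e\<in>edges L c \<union> edges L c'. cm \<sigma> u e (pair_exponent L c c' e)) \<partial>std_gaussian p) \<le> ?K * ?P \<sigma>"
    if \<sigma>: "\<sigma> \<in> signs" for \<sigma>
  proof -
    let ?f = "\<lambda>x z. (node_factor x z)\<^sup>2"
    have fint: "integrable gauss (?f x)" for x
      using integrable_gauss_quartic[of "\<mu> / real n"] by (cases "x \<le> n") (simp_all add: node_factor_def)
    have P0: "0 \<le> ?P \<sigma>" using Pnn[OF \<sigma>] by (intro prod_nonneg) auto
    have K0: "0 \<le> cycle_weight L w c * slack ^ L * ?P \<sigma>"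
      using P0 cycle_weight_nonneg slack_ge_1 by simp
    have "(\<integral>u. (\<Prod>e\<in>edges L c \<union> edges L c'. cm \<sigma> u e (pair_exponent L c c' e)) \<partial>std_gaussian p)
      \<le> (\<integral>u. cycle_weight L w c * slack ^ L * ?P \<sigma> * (\<Prod>x\<in>?V. ?f x (nv \<sigma> u x)) \<partial>std_gaussian p)"
    proof (rule integral_mono')
      show "integrable (std_gaussian p) (\<lambda>u. cycle_weight L w c * slack ^ L * ?P \<sigma> * (\<Prod>x\<in>?V. ?f x (nv \<sigma> u x)))"
        by (intro integrable_mult_right integral_node_values(1) nodes_subset c fint)
      fix u
      show "0 \<le> cycle_weight L w c * slack ^ L * ?P \<sigma> * (\<Prod>x\<in>?V. ?f x (nv \<sigma> u x))"
        using K0 by (intro mult_nonneg_nonneg[OF K0] prod_nonneg) auto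
      have "(\<Prod>e\<in>edges L c \<union> edges L c'. cm \<sigma> u e (pair_exponent L c c' e)) = (\<Prod>e\<in>edges L c. cm \<sigma> u e 2)"
        using same by (intro prod.cong) (auto simp: pair_exponent_def numeral_2_eq_2)
      also have "\<dots> = (\<Prod>i<L. cm \<sigma> u (step L c i) 2)" by (rule prod_edges[OF L c])
      also have "\<dots> \<le> (\<Prod>i<L. w (c i) (c (Suc i mod L)) * slack * (1 + ?r i * \<sigma> (c i) * \<sigma> (c (Suc i mod L)))
      * (node_factor (c i) (nv \<sigma> u (c i)) * node_factor (c (Suc i mod L)) (nv \<sigma> u (c (Suc i mod L)))))"
        using step[OF \<sigma>] by (intro prod_mono) auto
      also have "\<dots> = cycle_weight L w c * slack ^ L * ?P \<sigma>
          * (\<Prod>i<L. node_factor (c i) (nv \<sigma> u (c i)) * node_factor (c (Suc i mod L)) (nv \<sigma> u (c (Suc i mod L))))"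
        by (simp only: prod.distrib cycle_weight_def prod_constant card_lessThan)
      also have "(\<Prod>i<L. node_factor (c i) (nv \<sigma> u (c i)) * node_factor (c (Suc i mod L)) (nv \<sigma> u (c (Suc i mod L))))
          = (\<Prod>x\<in>?V. ?f x (nv \<sigma> u x))"
        using L by (intro prod_cycle_ends[of L c N "\<lambda>x. node_factor x (nv \<sigma> u x)"] c) auto
      finally show "(\<Prod>e\<in>edges L c \<union> edges L c'. cm \<sigma> u e (pair_exponent L c c' e))
         \<le> cycle_weight L w c * slack ^ L * ?P \<sigma> * (\<Prod>x\<in>?V. ?f x (nv \<sigma> u x))" .
    qed
    also have "\<dots> = cycle_weight L w c * slack ^ L * ?P \<sigma> * (\<Prod>x\<in>?V. if x \<le> n then ?f x (\<sigma> x) else \<integral>z. ?f x z \<partial>gauss)"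
      using integral_node_values(2)[OF nodes_subset[OF c], of ?f \<sigma>] fint by simp
    also have "\<dots> \<le> cycle_weight L w c * slack ^ L * ?P \<sigma> * (\<Prod>x\<in>?V. node_moment)"
      using node_moment_ge_1 integral_gauss_quartic[of "\<mu> / real n"]
      by (intro mult_left_mono[OF _ K0] prod_mono) (auto simp: node_factor_def node_moment_def)
    also have "(\<Prod>x\<in>?V. node_moment) = node_moment ^ L"
      using cycles_inj[OF c] by (simp add: card_image)
    finally show ?thesis by (simp only: mult_ac)
  qed
  have "(\<integral>y. cycle_signal L c y * cycle_signal L c' y \<partial>law) \<le> measure_pmf.expectation (labels_pmf n) (\<lambda>\<sigma>. ?K * ?P \<sigma>)"
    unfolding cycle_signal_mult(2)[OF L c c']
    by (intro integral_mono_AE AE_pmfI integrable_measure_pmf_finite finite_set_labels) (simp add: set_labels bound)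
  also have "\<dots> = ?K * measure_pmf.expectation (labels_pmf n) ?P"
    by (rule integral_mult_right_zero)
  also have "\<dots> \<le> ?K * 2"
  proof (rule mult_left_mono)
    show "measure_pmf.expectation (labels_pmf n) ?P \<le> 2"
      using L corr_bounds cycles_inj[OF c] cN by (intro expectation_cycle_correlations_le) auto
    show "0 \<le> ?K" using cycle_weight_nonneg slack_ge_1 node_moment_ge_1 by simp
  qed
  finally show ?thesis by (simp add: power_mult_distrib mult_ac)
qed

lemma integrable_cycle_stat: "L \<ge> 3 \<Longrightarrow> integrable law (cycle_stat L)"
  unfolding cycle_stat_def by (intro Bochner_Integration.integrable_sum integral_cycle_signal(1))

lemma variance_cycle_stat:
  assumes L: "L \<ge> 3" and D: "D \<ge> 1" "real (n + p) \<le> D * real n"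
  defines "C \<equiv> crude * gauss_moment ^ (2 * L)"
  shows "integrable law (\<lambda>y. (cycle_stat L y - \<delta> * mean_stat L)\<^sup>2)"
    and "(\<integral>y. (cycle_stat L y - \<delta> * mean_stat L)\<^sup>2 \<partial>law)
      \<le> 2 * real L * (2 * (slack * node_moment) ^ L) * mean_stat L
        + 2 ^ L * real L * real L ^ L * D ^ (2 * L) * C ^ (2 * L + 1) / real n"
proof -
  let ?Y = "cycles L N"
  let ?q = "\<lambda>c c'. \<integral>y. cycle_signal L c y * cycle_signal L c' y \<partial>law"
  interpret P: prob_space law by (rule prob_space_csbm_law)
  note i1 = integrable_cycle_stat[OF L]
  have m: "(\<integral>y. cycle_stat L y \<partial>law) = \<delta> * mean_stat L"
  proof -
    have "(\<integral>y. cycle_stat L y \<partial>law) = (\<Sum>c\<in>?Y. \<integral>y. cycle_signal L c y \<partial>law)"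
      unfolding cycle_stat_def by (intro Bochner_Integration.integral_sum integral_cycle_signal(1) L)
    also have "\<dots> = (\<Sum>c\<in>?Y. \<delta> * cycle_weight L w c)" by (intro sum.cong refl integral_cycle_signal(2) L)
    finally show ?thesis by (simp add: mean_stat_def sum_distrib_left)
  qed
  have sq: "(\<lambda>y. (cycle_stat L y)\<^sup>2) = (\<lambda>y. \<Sum>c\<in>?Y. \<Sum>c'\<in>?Y. cycle_signal L c y * cycle_signal L c' y)"
    unfolding cycle_stat_def power2_eq_square sum_product ..
  have i2: "integrable law (\<lambda>y. (cycle_stat L y)\<^sup>2)"
    unfolding sq by (intro Bochner_Integration.integrable_sum cycle_signal_mult(1) L)
  have "(\<integral>y. (cycle_stat L y)\<^sup>2 \<partial>law) = (\<Sum>c\<in>?Y. \<integral>y. (\<Sum>c'\<in>?Y. cycle_signal L c y * cycle_signal L c' y) \<partial>law)"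
    unfolding sq by (intro Bochner_Integration.integral_sum Bochner_Integration.integrable_sum cycle_signal_mult(1) L)
  also have "\<dots> = (\<Sum>c\<in>?Y. \<Sum>c'\<in>?Y. ?q c c')"
    by (intro sum.cong refl Bochner_Integration.integral_sum cycle_signal_mult(1) L)
  also have "\<dots> \<le> (\<Sum>c\<in>?Y. \<delta> * cycle_weight L w c)\<^sup>2
       + 2 * real L * (2 * (slack * node_moment) ^ L) * (\<Sum>c\<in>?Y. cycle_weight L w c)
       + 2 ^ L * real L * real L ^ L * D ^ (2 * L) * C ^ (2 * L + 1) / real n"
  proof (rule sum_pairs_of_cycles_le[OF L])
    show "1 \<le> real n" using n by simp
    have g1: "1 \<le> gauss_moment ^ (2 * L)" by (rule one_le_power) (simp add: gauss_moment_def)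
    then show C1: "1 \<le> C" unfolding C_def using mult_mono[OF crude_ge_1 g1] crude_ge_1 by simp
    show "0 \<le> 2 * (slack * node_moment) ^ L" using slack_ge_1 node_moment_ge_1 by simp
    show "0 \<le> \<delta> * cycle_weight L w c" for c using \<delta> cycle_weight_nonneg by auto
    show "0 \<le> cycle_weight L w c" for c by (rule cycle_weight_nonneg)
    fix c c' assume c: "c \<in> ?Y" "c' \<in> ?Y"
    show "?q c c' \<le> (\<delta> * cycle_weight L w c) * (\<delta> * cycle_weight L w c')" if "c ` {..<L} \<inter> c' ` {..<L} = {}"
      using disjoint_cycles[OF L c that] by simp
    show "?q c c' \<le> 2 * (slack * node_moment) ^ L * cycle_weight L w c" if "edges L c' = edges L c"
      by (rule equal_cycles[OF L c that])
    have "?q c c' \<le> (crude / real n) ^ card (edges L c \<union> edges L c') * gauss_moment ^ (2 * L)"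
      by (rule overlapping_cycles[OF L c])
    \<comment> \<open>\<open>C\<close> serves both as base and as prefactor, the form that
      \<open>sum_pairs_of_cycles_le\<close> asks for.\<close>
    also have "\<dots> \<le> (C / real n) ^ card (edges L c \<union> edges L c') * C"
    proof (intro mult_mono power_mono divide_right_mono)
      show "crude \<le> C" unfolding C_def using mult_left_mono[OF g1, of crude] crude_ge_1 by simp
      show "gauss_moment ^ (2 * L) \<le> C" unfolding C_def using mult_right_mono[OF crude_ge_1, of "gauss_moment ^ (2 * L)"] g1 by simp
    qed (use crude_ge_1 C1 g1 in auto)
    finally show "?q c c' \<le> C * (C / real n) ^ card (edges L c \<union> edges L c')" by (simp add: mult.commute)
  qed (use D in auto)
  also have "(\<Sum>c\<in>?Y. \<delta> * cycle_weight L w c) = \<delta> * mean_stat L" by (simp add: mean_stat_def sum_distrib_left)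
  finally have second: "(\<integral>y. (cycle_stat L y)\<^sup>2 \<partial>law) \<le> (\<delta> * mean_stat L)\<^sup>2
       + 2 * real L * (2 * (slack * node_moment) ^ L) * mean_stat L
       + 2 ^ L * real L * real L ^ L * D ^ (2 * L) * C ^ (2 * L + 1) / real n"
    unfolding mean_stat_def .
  show "integrable law (\<lambda>y. (cycle_stat L y - \<delta> * mean_stat L)\<^sup>2)"
    unfolding power2_diff using i1 i2 by simp
  have "(\<integral>y. (cycle_stat L y - \<delta> * mean_stat L)\<^sup>2 \<partial>law) = (\<integral>y. (cycle_stat L y)\<^sup>2 \<partial>law) - (\<delta> * mean_stat L)\<^sup>2"
    using P.variance_eq[OF i1 i2] unfolding m .
  then show "(\<integral>y. (cycle_stat L y - \<delta> * mean_stat L)\<^sup>2 \<partial>law)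
      \<le> 2 * real L * (2 * (slack * node_moment) ^ L) * mean_stat L
        + 2 ^ L * real L * real L ^ L * D ^ (2 * L) * C ^ (2 * L + 1) / real n"
    using second by simp
qed

end

section \<open>Singularity above the threshold\<close>

context planted
begin

text \<open>For fixed \<open>L\<close> and bounded \<open>p / n\<close> the hypotheses
  \<open>A\<close> and \<open>C\<close> hold for all large \<open>n\<close>. They reduce the
  variance bound to \<open>6 * L * M + 1\<close>, and the deviation \<open>M / 2\<close> brings the
  factor \<open>4 / M^2\<close>.\<close>

lemma chebyshev_cycle_stat:
  assumes L: "L \<ge> 3" and D: "D \<ge> 1" "real (n + p) \<le> D * real n" and M: "mean_stat L > 0"
    and A: "(slack * node_moment) ^ L \<le> 3 / 2"
    and C: "2 ^ L * real L * real L ^ L * D ^ (2 * L) * (crude * gauss_moment ^ (2 * L)) ^ (2 * L + 1) / real n \<le> 1"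
  shows "measure law {y \<in> space law. \<bar>cycle_stat L y - \<delta> * mean_stat L\<bar> \<ge> mean_stat L / 2}
    \<le> (24 * real L * mean_stat L + 4) / (mean_stat L)\<^sup>2"
proof -
  let ?M = "mean_stat L"
  have "{y \<in> space law. \<bar>cycle_stat L y - \<delta> * ?M\<bar> \<ge> ?M / 2} = {y \<in> space law. (cycle_stat L y - \<delta> * ?M)\<^sup>2 \<ge> ?M\<^sup>2 / 4}"
  proof -
    have "?M / 2 \<le> \<bar>z\<bar> \<longleftrightarrow> ?M\<^sup>2 / 4 \<le> z\<^sup>2" for z
      using abs_le_square_iff[of "?M / 2" z] M by (simp add: power_divide)
    then show ?thesis by simp
  qed
  then have "measure law {y \<in> space law. \<bar>cycle_stat L y - \<delta> * ?M\<bar> \<ge> ?M / 2}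
      \<le> (\<integral>y. (cycle_stat L y - \<delta> * ?M)\<^sup>2 \<partial>law) / (?M\<^sup>2 / 4)"
    using integral_Markov_inequality_measure[OF variance_cycle_stat(1)[OF L D] sets.top, of "?M\<^sup>2 / 4"] M by simp
  also have "\<dots> \<le> (6 * real L * ?M + 1) / (?M\<^sup>2 / 4)"
  proof (rule divide_right_mono)
    have "(\<integral>y. (cycle_stat L y - \<delta> * ?M)\<^sup>2 \<partial>law) \<le> 2 * real L * (2 * (slack * node_moment) ^ L) * ?M + 1"
      using variance_cycle_stat(2)[OF L D] C by simp
    also have "2 * real L * (2 * (slack * node_moment) ^ L) * ?M \<le> 2 * real L * (2 * (3 / 2)) * ?M"
      using A M by (intro mult_right_mono mult_left_mono) auto
    finally show "(\<integral>y. (cycle_stat L y - \<delta> * ?M)\<^sup>2 \<partial>law) \<le> 6 * real L * ?M + 1" by simp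
  qed simp
  also have "\<dots> = (24 * real L * ?M + 4) / ?M\<^sup>2" by (simp add: field_simps)
  finally show ?thesis .
qed

text \<open>The trial vector is 1 on the vertices and \<open>\<mu> / R\<close> on the coordinates,
  with \<open>R = sqrt \<theta>\<close>. At a coordinate \<open>w v = R * v\<close> holds with
  equality. At a vertex \<open>R \<ge> 1\<close> gives
  \<open>snr + \<mu>^2 * (p / n) / R \<ge> \<theta> / R = R\<close>. So the closed walks of length
  \<open>2 * k\<close> weigh at least \<open>\<theta> ^ k\<close>.\<close>

lemma mean_stat_ge:
  assumes \<theta>: "\<theta> > 1" "snr + \<mu>\<^sup>2 * (real p / real n) \<ge> \<theta>"
    and D: "D \<ge> 1" "real (n + p) \<le> D * real n" and k: "k > 0"
  shows "mean_stat (2 * k) \<ge> \<theta> ^ k - (real (2 * k))\<^sup>2 * D ^ (2 * k) * (snr + \<mu>) ^ (2 * k) / real n"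
proof -
  let ?R = "sqrt \<theta>"
  have R: "?R \<ge> 1" "?R * ?R = \<theta>" using \<theta> by auto
  let ?v = "\<lambda>x. if x \<le> n then 1 else \<mu> / ?R"
  have split: "(\<Sum>y\<in>N. h y) = (\<Sum>y\<in>{1..n}. h y) + (\<Sum>y\<in>{n + 1..n + p}. h y)" for h :: "nat \<Rightarrow> real"
  proof -
    have "N = {1..n} \<union> {n + 1..n + p}" by auto
    then show ?thesis by (simp add: sum.union_disjoint)
  qed
  have super: "?R * ?v x \<le> (\<Sum>y\<in>N. w x y * ?v y)" if "x \<in> N" for x
  proof (cases "x \<le> n")
    case True
    have "(\<Sum>y\<in>N. w x y * ?v y) = (\<Sum>y\<in>{1..n}. snr / real n) + (\<Sum>y\<in>{n + 1..n + p}. \<mu> / real n * (\<mu> / ?R))"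
      unfolding split using True by (intro arg_cong2[where f="(+)"] sum.cong) (auto simp: weight_def)
    also have "\<dots> = snr + \<mu>\<^sup>2 * (real p / real n) / ?R"
      using n by (simp add: power2_eq_square)
    also have "\<dots> \<ge> (snr + \<mu>\<^sup>2 * (real p / real n)) / ?R"
      using R snr_nonneg by (simp add: add_divide_distrib divide_le_eq mult_le_cancel_left1)
    moreover have "(snr + \<mu>\<^sup>2 * (real p / real n)) / ?R \<ge> \<theta> / ?R"
      using \<theta> R by (intro divide_right_mono) auto
    moreover have "\<theta> / ?R = ?R" using R \<theta> by (simp add: real_div_sqrt)
    ultimately show ?thesis using True by simp
  next
    case False
    have "(\<Sum>y\<in>N. w x y * ?v y) = (\<Sum>y\<in>{1..n}. \<mu> / real n) + (\<Sum>y\<in>{n + 1..n + p}. 0)"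
      unfolding split using False by (intro arg_cong2[where f="(+)"] sum.cong) (auto simp: weight_def)
    also have "\<dots> = \<mu>" using n by simp
    finally show ?thesis using False R by simp
  qed
  have "mean_stat (2 * k) \<ge> ?R ^ (2 * k) - (real (2 * k))\<^sup>2 * D ^ (2 * k) * (snr + \<mu>) ^ (2 * k) / real n"
    unfolding mean_stat_def
  proof (rule sum_cycles_ge[where v="?v" and k=k])
    show "w x y = w y x" for x y by (rule weight_sym)
    show "0 \<le> w x y" for x y by (rule w_nonneg)
    show "w x y \<le> (snr + \<mu>) / real n" for x y
      using snr_nonneg \<mu> by (auto simp: weight_def divide_right_mono)
    show "0 < (\<Sum>x\<in>N. (?v x)\<^sup>2)"
      using n by (intro sum_pos2[of _ 1]) auto
    show "real (card N) \<le> D * real n" using D by simp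
    show "0 \<le> ?R" using R by linarith
    show "0 \<le> ?v x" for x using \<mu> R by auto
    show "?R * ?v x \<le> (\<Sum>y\<in>N. w x y * ?v y)" if "x \<in> N" for x by (rule super[OF that])
  qed (use n D k snr_nonneg \<mu> in auto)
  moreover have "?R ^ (2 * k) = \<theta> ^ k" using \<theta> by (simp add: power_mult)
  ultimately show ?thesis by simp
qed

end

text \<open>The tests depend on \<open>\<epsilon>\<close>, while a single sequence of events is
  wanted. For each \<open>n\<close> an event is taken whose total error is within
  \<open>1 / Suc n\<close> of the infimum over all events; by comparison with the tests this infimum
  tends to 0.\<close>

lemma asymp_mutually_singularI:
  assumes Q: "\<And>n. prob_space (Q n)" and sets: "\<And>n. sets (Q n) = sets (P n)"
    and test: "\<And>\<epsilon>. \<epsilon> > 0 \<Longrightarrow> \<exists>E. (\<forall>n. E n \<in> sets (P n)) \<and>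
      (\<forall>\<^sub>F n in sequentially. measure (P n) (E n) \<le> \<epsilon> \<and> measure (Q n) (E n) \<ge> 1 - \<epsilon>)"
  shows "asymp_mutually_singular Q P"
proof -
  define f where "f n A = measure (P n) A + (1 - measure (Q n) A)" for n A
  have f0: "0 \<le> f n A" for n A
    unfolding f_def using prob_space.prob_le_1[OF Q, of n A] by simp
  define I where "I n = (INF A\<in>sets (P n). f n A)" for n
  have bdd: "bdd_below (f n ` sets (P n))" for n using f0 by (intro bdd_belowI[of _ 0]) auto
  have "\<exists>A\<in>sets (P n). f n A < I n + 1 / real (Suc n)" for n
  proof -
    have "I n < I n + 1 / real (Suc n)" by simp
    then show ?thesis unfolding I_def[of n, symmetric]
      using cINF_less_iff[OF _ bdd, of n "I n + 1 / real (Suc n)"] unfolding I_def by auto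
  qed
  then obtain E where E: "\<And>n. E n \<in> sets (P n)" "\<And>n. f n (E n) < I n + 1 / real (Suc n)"
    by metis
  have lim: "(\<lambda>n. f n (E n)) \<longlonglongrightarrow> 0"
  proof (rule LIMSEQ_I)
    fix r :: real assume r: "r > 0"
    obtain A where A: "\<And>n. A n \<in> sets (P n)"
      "\<forall>\<^sub>F n in sequentially. measure (P n) (A n) \<le> r / 4 \<and> measure (Q n) (A n) \<ge> 1 - r / 4"
      using test[of "r / 4"] r by auto
    have "\<forall>\<^sub>F n in sequentially. 1 / real (Suc n) < r / 2"
      using order_tendstoD(2)[OF LIMSEQ_inverse_real_of_nat, of "r / 2"] r by (simp add: inverse_eq_divide)
    with A(2) have "\<forall>\<^sub>F n in sequentially. norm (f n (E n) - 0) < r"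
    proof eventually_elim
      case (elim n)
      have "I n \<le> f n (A n)" unfolding I_def by (rule cINF_lower[OF bdd A(1)])
      then have "f n (E n) < r" using E(2)[of n] elim unfolding f_def by linarith
      then show ?case using f0[of n "E n"] by simp
    qed
    then show "\<exists>no. \<forall>n\<ge>no. norm (f n (E n) - 0) < r" by (simp add: eventually_sequentially)
  qed
  have "(\<lambda>n. measure (P n) (E n)) \<longlonglongrightarrow> 0"
  proof (rule tendsto_sandwich[OF _ _ tendsto_const lim])
    show "\<forall>\<^sub>F n in sequentially. measure (P n) (E n) \<le> f n (E n)"
      unfolding f_def using prob_space.prob_le_1[OF Q] by (intro always_eventually) auto
  qed simp
  moreover have "(\<lambda>n. measure (Q n) (E n)) \<longlonglongrightarrow> 1"
  proof (rule tendsto_sandwich)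
    show "(\<lambda>n. 1 - f n (E n)) \<longlonglongrightarrow> 1" using tendsto_diff[OF tendsto_const lim, of 1] by simp
    show "\<forall>\<^sub>F n in sequentially. 1 - f n (E n) \<le> measure (Q n) (E n)"
      unfolding f_def by (intro always_eventually) auto
    show "\<forall>\<^sub>F n in sequentially. measure (Q n) (E n) \<le> 1"
      using prob_space.prob_le_1[OF Q] by (intro always_eventually) auto
  qed simp
  ultimately show ?thesis unfolding asymp_mutually_singular_def using E(1) by blast
qed

lemma tendsto_p_over_n:
  fixes p :: "nat \<Rightarrow> nat"
  assumes "\<gamma> > 0" "(\<lambda>n. real n / real (p n)) \<longlonglongrightarrow> \<gamma>"
  shows "(\<lambda>n. real (p n) / real n) \<longlonglongrightarrow> 1 / \<gamma>"
  using tendsto_inverse[OF assms(2)] assms(1) by (simp add: inverse_eq_divide)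

lemma csbm_singular:
  fixes d l :: "nat \<Rightarrow> real" and p :: "nat \<Rightarrow> nat"
  assumes d: "\<And>k. k \<in> {1..m} \<Longrightarrow> d k > 1" and l: "\<And>k. k \<in> {1..m} \<Longrightarrow> l k \<ge> 0"
    and \<mu>: "\<mu> \<ge> 0" and b: "\<And>k. k \<in> {1..m} \<Longrightarrow> b_par (d k) (l k) \<ge> 0"
    and \<gamma>: "\<gamma> > 0" and lim: "(\<lambda>n. real n / real (p n)) \<longlonglongrightarrow> \<gamma>"
    and snr: "(\<Sum>k=1..m. (l k)\<^sup>2) + \<mu>\<^sup>2 / \<gamma> > 1"
  shows "asymp_mutually_singular (\<lambda>n. csbm_law m n (p n) d l \<mu>) (\<lambda>n. csbm_law m n (p n) d (\<lambda>_. 0) 0)"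
proof (rule asymp_mutually_singularI)
  show "prob_space (csbm_law m n (p n) d l \<mu>)" for n by (rule prob_space_csbm_law)
  show "sets (csbm_law m n (p n) d l \<mu>) = sets (csbm_law m n (p n) d (\<lambda>_. 0) 0)" for n
    by (simp add: sets_csbm_law)
  fix \<epsilon> :: real assume \<epsilon>: "\<epsilon> > 0"
  define \<Lambda> where "\<Lambda> = (\<Sum>k=1..m. (l k)\<^sup>2)"
  \<comment> \<open>Strictly between 1 and the limiting value, so that
    \<open>\<theta> < \<Lambda> + \<mu>^2 * (p / n)\<close> for all large \<open>n\<close>.\<close>
  define \<theta> where "\<theta> = (1 + (\<Lambda> + \<mu>\<^sup>2 / \<gamma>)) / 2"
  have \<theta>: "\<theta> > 1" "\<theta> < \<Lambda> + \<mu>\<^sup>2 * (1 / \<gamma>)" 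
  proof -
    have "\<Lambda> + \<mu>\<^sup>2 / \<gamma> > 1" using snr by (simp add: \<Lambda>_def)
    moreover have "1 < (1 + s) / 2 \<and> (1 + s) / 2 < s" if "s > 1" for s :: real
      using that by simp
    ultimately have "\<theta> > 1" "\<theta> < \<Lambda> + \<mu>\<^sup>2 / \<gamma>" unfolding \<theta>_def by blast+
    then show "\<theta> > 1" "\<theta> < \<Lambda> + \<mu>\<^sup>2 * (1 / \<gamma>)" by simp_all
  qed
  have pn: "(\<lambda>n. real (p n) / real n) \<longlonglongrightarrow> 1 / \<gamma>" by (rule tendsto_p_over_n[OF \<gamma> lim])
  \<comment> \<open>The ratio \<open>(n + p) / n\<close> tends to \<open>1 + 1 / \<gamma>\<close>;
    one more unit leaves room.\<close>
  define D where "D = 2 + 1 / \<gamma>"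
  have D: "D \<ge> 1" using \<gamma> by (simp add: D_def)
  \<comment> \<open>With \<open>L = 2 * k\<close> and
    \<open>M \<ge> \<theta> ^ k - 1 \<ge> 1\<close>, Chebyshev's bound is at most
    \<open>(48 * k + 4) / (\<theta> ^ k - 1)\<close>, which tends to 0 in \<open>k\<close>. The
    condition \<open>k \<ge> 2\<close> makes the length at least 3.\<close>
  obtain k where k: "(48 * real k + 4) / (\<theta> ^ k - 1) < \<epsilon>" "\<theta> ^ k \<ge> 2" "k \<ge> 2"
  proof -
    let ?x = "1 / \<theta>"
    have "(\<lambda>k. 96 * (real k * ?x ^ k) + 8 * ?x ^ k) \<longlonglongrightarrow> 96 * 0 + 8 * 0"
      using \<theta>(1) by (intro tendsto_intros powser_times_n_limit_0 LIMSEQ_power_zero) auto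
    then have "\<forall>\<^sub>F k in sequentially. 96 * (real k * ?x ^ k) + 8 * ?x ^ k < \<epsilon>"
      using \<epsilon> by (intro order_tendstoD(2)) auto
    moreover have "(\<lambda>k. ?x ^ k) \<longlonglongrightarrow> 0" using \<theta>(1) by (intro LIMSEQ_power_zero) auto
    then have "\<forall>\<^sub>F k in sequentially. ?x ^ k < 1 / 2" by (rule order_tendstoD(2)) simp
    ultimately have "\<forall>\<^sub>F k in sequentially. 96 * (real k * ?x ^ k) + 8 * ?x ^ k < \<epsilon> \<and> ?x ^ k < 1 / 2 \<and> k \<ge> 2"
      using eventually_ge_at_top[of 2] by eventually_elim auto
    then obtain k where k: "96 * (real k * ?x ^ k) + 8 * ?x ^ k < \<epsilon>" "?x ^ k < 1 / 2" "k \<ge> 2"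
      by (auto simp: eventually_sequentially)
    have t: "\<theta> ^ k > 0" "?x ^ k = 1 / \<theta> ^ k" using \<theta>(1) by (auto simp: power_one_over)
    then have t2: "\<theta> ^ k \<ge> 2" using k(2) by (simp add: divide_less_eq)
    have "(48 * real k + 4) / (\<theta> ^ k - 1) \<le> (48 * real k + 4) / (\<theta> ^ k / 2)"
      using t2 by (intro divide_left_mono) auto
    also have "\<dots> = 96 * (real k * ?x ^ k) + 8 * ?x ^ k" unfolding t(2) by (simp add: add_divide_distrib)
    finally show ?thesis using k t2 by (intro that) auto
  qed
  define L where "L = 2 * k"
  have L: "L \<ge> 3" using k by (simp add: L_def)
  \<comment> \<open>The cutoff is half the planted mean. Where \<open>n\<close> is too small for the
    locale to apply, measurability of the statistic is not at hand and the event is empty.\<close>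
  define E where "E n = (if planted m n d l \<mu> 0 then {y \<in> space (csbm_law m n (p n) d (\<lambda>_. 0) 0).
      planted.cycle_stat m n (p n) d l \<mu> L y \<ge> planted.mean_stat m n (p n) l \<mu> L / 2} else {})" for n
  have good: "\<forall>\<^sub>F n in sequentially. planted m n d l \<mu> 0 \<and> planted m n d l \<mu> 1"
  proof -
    have "\<forall>\<^sub>F n in sequentially. \<forall>t\<in>{1..m}. a_par (d t) (l t) \<le> real n"
      by (intro eventually_ball_finite ballI) (auto intro: eventually_mono[OF filterlim_at_top[THEN iffD1, OF filterlim_real_sequentially, rule_format]])
    then show ?thesis using eventually_gt_at_top[of 0]
    proof eventually_elim
      case (elim n)
      then show ?case
        unfolding planted_def using d l b \<mu> by (auto simp: less_trans[OF zero_less_one])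
    qed
  qed
  show "\<exists>E. (\<forall>n. E n \<in> sets (csbm_law m n (p n) d (\<lambda>_. 0) 0)) \<and>
      (\<forall>\<^sub>F n in sequentially. measure (csbm_law m n (p n) d (\<lambda>_. 0) 0) (E n) \<le> \<epsilon>
         \<and> measure (csbm_law m n (p n) d l \<mu>) (E n) \<ge> 1 - \<epsilon>)"
  proof (intro exI[of _ E] conjI allI)
    show "E n \<in> sets (csbm_law m n (p n) d (\<lambda>_. 0) 0)" for n
    proof (cases "planted m n d l \<mu> 0")
      case True
      then interpret planted m n "p n" d l \<mu> 0 .
      have [measurable]: "cycle_stat L \<in> borel_measurable (csbm_law m n (p n) d (\<lambda>_. 0) 0)"
        using borel_measurable_integrable[OF integrable_cycle_stat[OF L]] by simp
      show ?thesis using True unfolding E_def by simp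
    qed (simp add: E_def)
    have e2: "\<forall>\<^sub>F n in sequentially. real (p n) / real n < 1 / \<gamma> + 1"
      by (rule order_tendstoD(2)[OF pn]) simp
    have "(\<lambda>n. \<Lambda> + \<mu>\<^sup>2 * (real (p n) / real n)) \<longlonglongrightarrow> \<Lambda> + \<mu>\<^sup>2 * (1 / \<gamma>)"
      by (intro tendsto_intros pn)
    then have e3: "\<forall>\<^sub>F n in sequentially. \<theta> < \<Lambda> + \<mu>\<^sup>2 * (real (p n) / real n)"
      using \<theta>(2) by (rule order_tendstoD(1))
    \<comment> \<open>\<open>L\<close> is fixed before \<open>n\<close> grows, so the error terms of
      the mean and of the variance are constants over \<open>n\<close>.\<close>
    have small: "\<forall>\<^sub>F n in sequentially. K / real n < 1" for K :: real
      by (rule order_tendstoD(2)[OF lim_const_over_n]) simp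
    define a where "a = (\<Sum>t=1..m. d t) + \<Lambda>"
    have "(\<lambda>n. ((1 + a / real n) * (1 + 2 * (\<mu> / real n) + 3 * (\<mu> / real n)\<^sup>2)) ^ L) \<longlonglongrightarrow> ((1 + 0) * (1 + 2 * 0 + 3 * 0\<^sup>2)) ^ L"
      by (intro tendsto_intros lim_const_over_n)
    then have e6: "\<forall>\<^sub>F n in sequentially. ((1 + a / real n) * (1 + 2 * (\<mu> / real n) + 3 * (\<mu> / real n)\<^sup>2)) ^ L < 3 / 2"
      by (rule order_tendstoD(2)) simp
    show "\<forall>\<^sub>F n in sequentially. measure (csbm_law m n (p n) d (\<lambda>_. 0) 0) (E n) \<le> \<epsilon>
         \<and> measure (csbm_law m n (p n) d l \<mu>) (E n) \<ge> 1 - \<epsilon>"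
      using good e2 e3 e6 small[of "(real L)\<^sup>2 * D ^ L * (\<Lambda> + \<mu>) ^ L"]
        small[of "2 ^ L * real L * real L ^ L * D ^ (2 * L) * (planted.crude m d l \<mu> * planted.gauss_moment ^ (2 * L)) ^ (2 * L + 1)"]
        eventually_gt_at_top[of 0]
    proof eventually_elim
      case (elim n)
      interpret P0: planted m n "p n" d l \<mu> 0 using elim by simp
      interpret P1: planted m n "p n" d l \<mu> 1 using elim by simp
      let ?T = "P0.cycle_stat L" and ?M = "P0.mean_stat L"
      let ?P = "csbm_law m n (p n) d (\<lambda>_. 0) 0" and ?Q = "csbm_law m n (p n) d l \<mu>"
      interpret P: prob_space ?P by (rule prob_space_csbm_law)
      interpret Q: prob_space ?Q by (rule prob_space_csbm_law)
      have snr_eq: "P0.snr = \<Lambda>" by (simp add: P0.snr_def \<Lambda>_def)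
      have D2: "real (n + p n) \<le> D * real n"
        using elim by (simp add: D_def divide_less_eq algebra_simps)
      have "?M \<ge> \<theta> ^ k - (real L)\<^sup>2 * D ^ L * (\<Lambda> + \<mu>) ^ L / real n"
        using P0.mean_stat_ge[OF \<theta>(1) _ D D2, of k] elim k unfolding snr_eq L_def by simp
      then have M: "?M \<ge> \<theta> ^ k - 1" "?M \<ge> 1" using elim k by linarith+
      have A: "(P0.slack * P0.node_moment) ^ L \<le> 3 / 2"
        using elim unfolding P0.slack_def P0.node_moment_def snr_eq P0.total_degree_def a_def by simp
      have "(24 * real L * ?M + 4) / ?M\<^sup>2 \<le> (24 * real L * ?M + 4 * ?M) / ?M\<^sup>2"
        using M by (intro divide_right_mono) auto
      also have "\<dots> = (48 * real k + 4) / ?M"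
        using M by (simp add: L_def power2_eq_square field_simps)
      also have "\<dots> \<le> (48 * real k + 4) / (\<theta> ^ k - 1)"
        using M k by (intro divide_left_mono) auto
      finally have err: "(24 * real L * ?M + 4) / ?M\<^sup>2 \<le> \<epsilon>" using k by simp
      have M0: "?M > 0" using M by simp
      have C: "2 ^ L * real L * real L ^ L * D ^ (2 * L) * (P0.crude * P0.gauss_moment ^ (2 * L)) ^ (2 * L + 1) / real n \<le> 1"
        using elim by simp
      have c0: "measure ?P {y \<in> space ?P. \<bar>?T y\<bar> \<ge> ?M / 2} \<le> \<epsilon>"
        using P0.chebyshev_cycle_stat[OF L D D2 M0 A C] err by simp
      have c1: "measure ?Q {y \<in> space ?Q. \<bar>?T y - ?M\<bar> \<ge> ?M / 2} \<le> \<epsilon>"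
        using P1.chebyshev_cycle_stat[OF L D D2 M0 A C] err by simp
      have [measurable]: "?T \<in> borel_measurable ?P" "?T \<in> borel_measurable ?Q"
        using borel_measurable_integrable[OF P0.integrable_cycle_stat[OF L]]
          borel_measurable_integrable[OF P1.integrable_cycle_stat[OF L]] by simp_all
      have sp: "space ?Q = space ?P" by (rule sets_eq_imp_space_eq) (simp add: sets_csbm_law)
      have E: "E n = {y \<in> space ?P. ?T y \<ge> ?M / 2}" using elim by (simp add: E_def)
      have "measure ?P (E n) \<le> measure ?P {y \<in> space ?P. \<bar>?T y\<bar> \<ge> ?M / 2}"
        unfolding E by (rule P.finite_measure_mono) auto
      moreover have "measure ?Q {y \<in> space ?Q. \<not> ?T y \<ge> ?M / 2} \<le> measure ?Q {y \<in> space ?Q. \<bar>?T y - ?M\<bar> \<ge> ?M / 2}"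
      proof (rule Q.finite_measure_mono)
        have "\<bar>t - ?M\<bar> \<ge> ?M / 2" if "\<not> t \<ge> ?M / 2" for t using that by linarith
        then show "{y \<in> space ?Q. \<not> ?T y \<ge> ?M / 2} \<subseteq> {y \<in> space ?Q. \<bar>?T y - ?M\<bar> \<ge> ?M / 2}" by blast
      qed measurable
      moreover have "measure ?Q {y \<in> space ?Q. \<not> ?T y \<ge> ?M / 2} = 1 - measure ?Q (E n)"
        unfolding E sp[symmetric] by (rule Q.prob_neg) measurable
      ultimately show ?case using c0 c1 by linarith
    qed
  qed
qed

section \<open>Likelihood ratios\<close>

lemma nn_integral_gauss:
  assumes "f \<in> borel_measurable borel"
  shows "(\<integral>\<^sup>+x. f x \<partial>gauss) = (\<integral>\<^sup>+x. ennreal (std_normal_density x) * f x \<partial>lborel)"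
  using assms by (intro nn_integral_density) auto

lemma nn_integral_normal_density: "0 < s \<Longrightarrow> (\<integral>\<^sup>+x. ennreal (normal_density a s x) \<partial>lborel) = 1"
  by (subst nn_integral_eq_integral) auto

lemma nn_integral_gauss_exp: "(\<integral>\<^sup>+x. ennreal (exp (t * x)) \<partial>gauss) = ennreal (exp (t\<^sup>2 / 2))"
proof -
  have "(\<integral>\<^sup>+x. ennreal (exp (t * x)) \<partial>gauss) = (\<integral>\<^sup>+x. ennreal (exp (t\<^sup>2 / 2)) * ennreal (normal_density t 1 x) \<partial>lborel)"
    by (subst nn_integral_gauss)
       (auto intro!: nn_integral_cong simp: normal_density_def exp_add[symmetric] ennreal_mult[symmetric] power2_diff
         field_simps power2_eq_square)
  also have "\<dots> = ennreal (exp (t\<^sup>2 / 2))"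
    by (simp add: nn_integral_cmult nn_integral_normal_density)
  finally show ?thesis .
qed

text \<open>The integrand against Lebesgue measure is a multiple of the centred normal density with
  variance \<open>1 / (1 - \<theta>)\<close>. The average over overlaps and the tail bound for
  \<open>u\<close> both rest on this value.\<close>

lemma nn_integral_gauss_exp_square:
  assumes "\<theta> < 1"
  shows "(\<integral>\<^sup>+x. ennreal (exp (\<theta> * x\<^sup>2 / 2)) \<partial>gauss) = ennreal (1 / sqrt (1 - \<theta>))"
proof -
  let ?s = "1 / sqrt (1 - \<theta>)"
  have s: "?s > 0" "?s\<^sup>2 = 1 / (1 - \<theta>)" using assms by (auto simp: power_divide)
  have eq: "std_normal_density x * exp (\<theta> * x\<^sup>2 / 2) = ?s * normal_density 0 ?s x" for x
  proof -
    have "sqrt (2 * pi * ?s\<^sup>2) = sqrt (2 * pi) * ?s" using s(1) by (simp add: real_sqrt_mult)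
    moreover have "- x\<^sup>2 / 2 + \<theta> * x\<^sup>2 / 2 = - x\<^sup>2 / (2 * ?s\<^sup>2)"
      unfolding s(2) by (simp add: field_simps)
    ultimately show ?thesis
      using s(1) by (simp add: std_normal_density_def normal_density_def exp_add[symmetric])
  qed
  have "(\<integral>\<^sup>+x. ennreal (exp (\<theta> * x\<^sup>2 / 2)) \<partial>gauss) = (\<integral>\<^sup>+x. ennreal ?s * ennreal (normal_density 0 ?s x) \<partial>lborel)"
    using s(1) by (subst nn_integral_gauss) (auto intro!: nn_integral_cong simp: eq ennreal_mult[symmetric] simp del: times_divide_eq_left)
  also have "\<dots> = ennreal ?s" using s(1) by (simp add: nn_integral_cmult nn_integral_normal_density)
  finally show ?thesis .
qed

text \<open>The Cameron-Martin formula in dimension one.\<close>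

lemma distr_gauss_shift:
  "distr gauss gauss (\<lambda>x. a + x) = density gauss (\<lambda>x. ennreal (exp (a * x - a\<^sup>2 / 2)))"
proof (rule measure_eqI)
  fix A assume "A \<in> sets (distr gauss gauss (\<lambda>x. a + x))"
  then have A [measurable]: "A \<in> sets borel" by simp
  have "emeasure (distr gauss gauss (\<lambda>x. a + x)) A = (\<integral>\<^sup>+x. indicator A x \<partial>distr gauss gauss (\<lambda>x. a + x))"
    by (rule nn_integral_indicator[symmetric]) simp
  also have "\<dots> = (\<integral>\<^sup>+x. indicator A (a + x) \<partial>gauss)"
    by (rule nn_integral_distr) simp_all
  also have "\<dots> = (\<integral>\<^sup>+x. ennreal (std_normal_density x) * indicator A (a + x) \<partial>lborel)"
    by (rule nn_integral_gauss) measurable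
  also have "\<dots> = (\<integral>\<^sup>+x. ennreal (std_normal_density (x - a)) * indicator A x \<partial>lborel)"
    using nn_integral_real_affine[of "\<lambda>x. ennreal (std_normal_density (x - a)) * indicator A x" 1 a] by simp
  also have "\<dots> = (\<integral>\<^sup>+x. ennreal (std_normal_density x) * (ennreal (exp (a * x - a\<^sup>2 / 2)) * indicator A x) \<partial>lborel)"
  proof (intro nn_integral_cong)
    fix x
    have "std_normal_density (x - a) = std_normal_density x * exp (a * x - a\<^sup>2 / 2)"
      by (simp add: std_normal_density_def exp_add[symmetric] power2_diff field_simps)
    then show "ennreal (std_normal_density (x - a)) * indicator A x
       = ennreal (std_normal_density x) * (ennreal (exp (a * x - a\<^sup>2 / 2)) * indicator A x)"
      by (simp add: ennreal_mult mult.assoc)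
  qed
  also have "\<dots> = (\<integral>\<^sup>+x. ennreal (exp (a * x - a\<^sup>2 / 2)) * indicator A x \<partial>gauss)"
    by (rule nn_integral_gauss[symmetric]) measurable
  also have "\<dots> = emeasure (density gauss (\<lambda>x. ennreal (exp (a * x - a\<^sup>2 / 2)))) A"
    by (rule emeasure_density[symmetric]) auto
  finally show "emeasure (distr gauss gauss (\<lambda>x. a + x)) A = emeasure (density gauss (\<lambda>x. ennreal (exp (a * x - a\<^sup>2 / 2)))) A" .
qed simp

text \<open>By uniqueness of product measures it suffices that both sides agree on boxes with the
  product of the image measures. Applied twice: to the coordinates of one noise vector and to the
  family of noise vectors.\<close>

lemma distr_PiM_density:
  assumes I: "finite I" and M: "\<And>i. prob_space (M i)"
    and T [measurable]: "\<And>i. i \<in> I \<Longrightarrow> T i \<in> M i \<rightarrow>\<^sub>M M i" and g [measurable]: "\<And>i. i \<in> I \<Longrightarrow> g i \<in> borel_measurable (M i)"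
    and eq: "\<And>i. i \<in> I \<Longrightarrow> distr (M i) (M i) (T i) = density (M i) (g i)"
  shows "distr (Pi\<^sub>M I M) (Pi\<^sub>M I M) (\<lambda>x. \<lambda>i\<in>I. T i (x i)) = density (Pi\<^sub>M I M) (\<lambda>x. \<Prod>i\<in>I. g i (x i))"
proof -
  \<comment> \<open>Indices outside \<open>I\<close> keep \<open>M i\<close>, since
    \<open>product_sigma_finite\<close> speaks about every index.\<close>
  define N where "N i = (if i \<in> I then distr (M i) (M i) (T i) else M i)" for i
  have setsN: "sets (N i) = sets (M i)" for i by (simp add: N_def)
  have "prob_space (N i)" for i
    using M T by (auto simp: N_def intro: prob_space.prob_space_distr)
  then interpret N: product_sigma_finite N
    by (simp add: product_sigma_finite_def prob_space_imp_sigma_finite)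
  interpret M: product_sigma_finite M
    using M by (simp add: product_sigma_finite_def prob_space_imp_sigma_finite)
  have sP: "sets (Pi\<^sub>M I M) = sets (Pi\<^sub>M I N)" by (rule sets_PiM_cong) (auto simp: setsN)
  let ?T = "\<lambda>x. \<lambda>i\<in>I. T i (x i)"
  have mT [measurable]: "?T \<in> Pi\<^sub>M I M \<rightarrow>\<^sub>M Pi\<^sub>M I M"
  proof (rule measurable_restrict)
    fix i assume i: "i \<in> I"
    show "(\<lambda>x. T i (x i)) \<in> Pi\<^sub>M I M \<rightarrow>\<^sub>M M i"
      by (rule measurable_compose[OF measurable_component_singleton[OF i, of M] T[OF i]])
  qed
  have 1: "distr (Pi\<^sub>M I M) (Pi\<^sub>M I M) ?T = Pi\<^sub>M I N"
  proof (rule N.PiM_eqI[OF I])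
    fix A assume "\<And>i. i \<in> I \<Longrightarrow> A i \<in> sets (N i)"
    then have A: "\<And>i. i \<in> I \<Longrightarrow> A i \<in> sets (M i)" by (simp add: setsN)
    have "?T -` (Pi\<^sub>E I A) \<inter> space (Pi\<^sub>M I M) = (\<Pi>\<^sub>E i\<in>I. T i -` A i \<inter> space (M i))"
      by (auto simp: space_PiM PiE_iff extensional_def)
    then have "emeasure (distr (Pi\<^sub>M I M) (Pi\<^sub>M I M) ?T) (Pi\<^sub>E I A) = emeasure (Pi\<^sub>M I M) (\<Pi>\<^sub>E i\<in>I. T i -` A i \<inter> space (M i))"
      using A I by (subst emeasure_distr) (auto intro: sets_PiM_I_finite)
    also have "\<dots> = (\<Prod>i\<in>I. emeasure (M i) (T i -` A i \<inter> space (M i)))"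
      using A by (intro M.emeasure_PiM I) (auto intro: measurable_sets[OF T])
    also have "\<dots> = (\<Prod>i\<in>I. emeasure (N i) (A i))"
      using A by (intro prod.cong refl) (simp add: N_def emeasure_distr T)
    finally show "emeasure (distr (Pi\<^sub>M I M) (Pi\<^sub>M I M) ?T) (Pi\<^sub>E I A) = (\<Prod>i\<in>I. emeasure (N i) (A i))" .
  qed (simp add: sP)
  have mg: "(\<lambda>x. \<Prod>i\<in>I. g i (x i)) \<in> borel_measurable (Pi\<^sub>M I M)"
  proof (rule borel_measurable_prod_ennreal)
    fix i assume i: "i \<in> I"
    show "(\<lambda>x. g i (x i)) \<in> borel_measurable (Pi\<^sub>M I M)"
      by (rule measurable_compose[OF measurable_component_singleton[OF i, of M] g[OF i]])
  qed
  have 2: "density (Pi\<^sub>M I M) (\<lambda>x. \<Prod>i\<in>I. g i (x i)) = Pi\<^sub>M I N"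
  proof (rule N.PiM_eqI[OF I])
    fix A assume "\<And>i. i \<in> I \<Longrightarrow> A i \<in> sets (N i)"
    then have A: "\<And>i. i \<in> I \<Longrightarrow> A i \<in> sets (M i)" by (simp add: setsN)
    have "emeasure (density (Pi\<^sub>M I M) (\<lambda>x. \<Prod>i\<in>I. g i (x i))) (Pi\<^sub>E I A)
       = (\<integral>\<^sup>+x. (\<Prod>i\<in>I. g i (x i)) * indicator (Pi\<^sub>E I A) x \<partial>Pi\<^sub>M I M)"
      using A I by (intro emeasure_density mg sets_PiM_I_finite) auto
    also have "\<dots> = (\<integral>\<^sup>+x. (\<Prod>i\<in>I. g i (x i) * indicator (A i) (x i)) \<partial>Pi\<^sub>M I M)"
    proof (intro nn_integral_cong)
      fix x assume "x \<in> space (Pi\<^sub>M I M)"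
      then have "x \<in> extensional I" by (auto simp: space_PiM PiE_iff)
      then have "indicator (Pi\<^sub>E I A) x = (\<Prod>i\<in>I. indicator (A i) (x i) :: ennreal)"
        using I by (auto simp: indicator_def PiE_iff prod_zero_iff)
      then show "(\<Prod>i\<in>I. g i (x i)) * indicator (Pi\<^sub>E I A) x = (\<Prod>i\<in>I. g i (x i) * indicator (A i) (x i))"
        by (simp add: prod.distrib)
    qed
    also have "\<dots> = (\<Prod>i\<in>I. \<integral>\<^sup>+x. g i x * indicator (A i) x \<partial>M i)"
      using A g by (intro M.product_nn_integral_prod I) auto
    also have "\<dots> = (\<Prod>i\<in>I. emeasure (N i) (A i))"
      using A by (intro prod.cong refl) (simp add: N_def eq emeasure_density g)
    finally show "emeasure (density (Pi\<^sub>M I M) (\<lambda>x. \<Prod>i\<in>I. g i (x i))) (Pi\<^sub>E I A) = (\<Prod>i\<in>I. emeasure (N i) (A i))" .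
  qed (simp add: sP)
  show ?thesis using 1 2 by simp
qed

lemma distr_std_gaussian_shift:
  "distr (std_gaussian p) (std_gaussian p) (\<lambda>z. \<lambda>r\<in>{1..p}. a r + z r)
    = density (std_gaussian p) (\<lambda>z. \<Prod>r\<in>{1..p}. ennreal (exp (a r * z r - (a r)\<^sup>2 / 2)))"
  unfolding std_gaussian_def
  by (rule distr_PiM_density) (auto simp: prob_space_gauss distr_gauss_shift)

lemma distr_noise_shift:
  "distr (noise_law n p) (noise_law n p) (\<lambda>Z. \<lambda>i\<in>{1..n}. \<lambda>r\<in>{1..p}. a i r + Z i r)
    = density (noise_law n p) (\<lambda>Z. \<Prod>i\<in>{1..n}. \<Prod>r\<in>{1..p}. ennreal (exp (a i r * Z i r - (a i r)\<^sup>2 / 2)))"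
  unfolding noise_law_def
proof (rule distr_PiM_density)
  show "(\<lambda>z. \<lambda>r\<in>{1..p}. a i r + z r) \<in> std_gaussian p \<rightarrow>\<^sub>M std_gaussian p" for i
  proof -
    have "(\<lambda>z. \<lambda>r\<in>{1..p}. a i r + z r) \<in> std_gaussian p \<rightarrow>\<^sub>M (\<Pi>\<^sub>M r\<in>{1..p}. gauss)"
      by (intro measurable_restrict) simp
    then show ?thesis by (simp add: std_gaussian_def)
  qed
  show "(\<lambda>z. \<Prod>r\<in>{1..p}. ennreal (exp (a i r * z r - (a i r)\<^sup>2 / 2))) \<in> borel_measurable (std_gaussian p)" for i
    by measurable
  show "distr (std_gaussian p) (std_gaussian p) (\<lambda>z. \<lambda>r\<in>{1..p}. a i r + z r)
    = density (std_gaussian p) (\<lambda>z. \<Prod>r\<in>{1..p}. ennreal (exp (a i r * z r - (a i r)\<^sup>2 / 2)))" for i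
    by (rule distr_std_gaussian_shift)
qed (auto simp: prob_space_std_gaussian)

lemma nn_integral_std_gaussian_prod:
  assumes "\<And>r. r \<in> {1..p} \<Longrightarrow> f r \<in> borel_measurable borel"
  shows "(\<integral>\<^sup>+u. (\<Prod>r\<in>{1..p}. f r (u r)) \<partial>std_gaussian p) = (\<Prod>r\<in>{1..p}. \<integral>\<^sup>+x. f r x \<partial>gauss)"
  unfolding std_gaussian_def
  by (rule product_sigma_finite.product_nn_integral_prod[OF product_sigma_finite_gauss]) (use assms in auto)

lemma nn_integral_noise_prod:
  assumes "\<And>i r. i \<in> {1..n} \<Longrightarrow> r \<in> {1..p} \<Longrightarrow> f i r \<in> borel_measurable borel"
  shows "(\<integral>\<^sup>+Z. (\<Prod>i\<in>{1..n}. \<Prod>r\<in>{1..p}. f i r (Z i r)) \<partial>noise_law n p)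
    = (\<Prod>i\<in>{1..n}. \<Prod>r\<in>{1..p}. \<integral>\<^sup>+x. f i r x \<partial>gauss)"
proof -
  have m: "(\<lambda>z. \<Prod>r\<in>{1..p}. f i r (z r)) \<in> borel_measurable (std_gaussian p)" if "i \<in> {1..n}" for i
    using assms[OF that] by (intro borel_measurable_prod_ennreal) (auto intro: measurable_compose[OF measurable_std_gaussian_component])
  have "(\<integral>\<^sup>+Z. (\<Prod>i\<in>{1..n}. \<Prod>r\<in>{1..p}. f i r (Z i r)) \<partial>noise_law n p)
    = (\<Prod>i\<in>{1..n}. \<integral>\<^sup>+z. (\<Prod>r\<in>{1..p}. f i r (z r)) \<partial>std_gaussian p)"
    unfolding noise_law_def
    by (rule product_sigma_finite.product_nn_integral_prod[OF product_sigma_finite_std_gaussian]) (use m in auto)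
  also have "\<dots> = (\<Prod>i\<in>{1..n}. \<Prod>r\<in>{1..p}. \<integral>\<^sup>+x. f i r x \<partial>gauss)"
    by (intro prod.cong refl nn_integral_std_gaussian_prod assms) auto
  finally show ?thesis .
qed

lemma nn_integral_gauss_likelihoods:
  "(\<integral>\<^sup>+x. ennreal (exp (a * x - a\<^sup>2 / 2)) * ennreal (exp (b * x - b\<^sup>2 / 2)) \<partial>gauss) = ennreal (exp (a * b))"
proof -
  have "(\<integral>\<^sup>+x. ennreal (exp (a * x - a\<^sup>2 / 2)) * ennreal (exp (b * x - b\<^sup>2 / 2)) \<partial>gauss)
     = (\<integral>\<^sup>+x. ennreal (exp (- (a\<^sup>2 + b\<^sup>2) / 2)) * ennreal (exp ((a + b) * x)) \<partial>gauss)"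
    by (intro nn_integral_cong) (simp add: ennreal_mult[symmetric] exp_add[symmetric] field_simps)
  also have "\<dots> = ennreal (exp (- (a\<^sup>2 + b\<^sup>2) / 2)) * ennreal (exp ((a + b)\<^sup>2 / 2))"
    by (subst nn_integral_cmult) (auto simp: nn_integral_gauss_exp)
  also have "\<dots> = ennreal (exp (a * b))"
    by (simp add: ennreal_mult[symmetric] exp_add[symmetric] power2_sum field_simps)
  finally show ?thesis .
qed

text \<open>\<open>cosh x \<le> exp (x^2 / 2)\<close>, the subgaussian bound for a random sign. It
  is the analytic inequality behind Hoeffding's lemma for success probability 1/2 and an interval of
  length \<open>2 * x\<close>; evenness covers negative \<open>x\<close>.\<close>

lemma half_exp_sum_le: "(exp x + exp (- x)) / 2 \<le> exp (x\<^sup>2 / 2)" for x :: real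
proof -
  have main: "(exp x + exp (- x)) / 2 \<le> exp (x\<^sup>2 / 2)" if "x \<ge> 0" for x :: real
  proof -
    have pos: "1 + (1 / 2) * (exp (2 * x) - 1) > 0" by (simp add: field_simps add_pos_pos)
    have "- (2 * x) * (1 / 2) + ln (1 + (1 / 2) * (exp (2 * x) - 1)) \<le> (2 * x)\<^sup>2 / 8"
      by (rule Hoeffdings_lemma_aux) (use that in auto)
    then have "- x + ln (1 + (1 / 2) * (exp (2 * x) - 1)) \<le> x\<^sup>2 / 2" by (simp add: power_mult_distrib)
    then have le: "exp (- x + ln (1 + (1 / 2) * (exp (2 * x) - 1))) \<le> exp (x\<^sup>2 / 2)" by simp
    have eq: "exp (- x + ln (1 + (1 / 2) * (exp (2 * x) - 1))) = (exp x + exp (- x)) / 2"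
    proof -
      have "exp (- x + ln (1 + (1 / 2) * (exp (2 * x) - 1))) = exp (- x) * (1 + (1 / 2) * (exp (2 * x) - 1))"
        using pos by (simp only: exp_add exp_ln)
      also have "\<dots> = (exp (- x) + exp (- x) * exp (2 * x)) / 2" by (simp add: field_simps)
      also have "exp (- x) * exp (2 * x) = exp x" by (simp add: exp_add[symmetric])
      finally show ?thesis by (simp add: add.commute)
    qed
    show ?thesis using le unfolding eq .
  qed
  show ?thesis
  proof (cases "x \<ge> 0")
    case True then show ?thesis by (rule main)
  next
    case False
    then show ?thesis using main[of "- x"] by (simp add: add.commute)
  qed
qed

lemma PiE_dflt_undefined: "PiE_dflt A undefined B = Pi\<^sub>E A B"
  unfolding PiE_dflt_def PiE_def Pi_def extensional_def by blast

lemma labels_pmf_eq: "labels_pmf n = Pi_pmf {1..n} undefined (\<lambda>_. pmf_of_set {-1, 1})"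
  using Pi_pmf_of_set[of "{1..n}" "\<lambda>_. {-1, 1 :: real}" undefined]
  by (simp add: labels_pmf_def PiE_dflt_undefined)

lemma expectation_exp_sign: "(\<integral>\<^sup>+s. ennreal (exp (x * s)) \<partial>measure_pmf (pmf_of_set {-1, 1})) \<le> ennreal (exp (x\<^sup>2 / 2))"
proof -
  have "(\<integral>\<^sup>+s. ennreal (exp (x * s)) \<partial>measure_pmf (pmf_of_set {-1, 1})) = (\<Sum>s\<in>{-1, 1}. ennreal (exp (x * s))) / ennreal 2"
    by (subst nn_integral_pmf_of_set) auto
  also have "(\<Sum>s\<in>{-1, 1}. ennreal (exp (x * s))) = ennreal (exp x + exp (- x))"
    by (simp add: add.commute)
  also have "ennreal (exp x + exp (- x)) / ennreal 2 = ennreal ((exp x + exp (- x)) / 2)"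
    by (rule divide_ennreal) (auto intro: add_nonneg_nonneg)
  also have "\<dots> \<le> ennreal (exp (x\<^sup>2 / 2))" by (intro ennreal_leI half_exp_sum_le)
  finally show ?thesis .
qed

text \<open>Linearizing the square with a Gaussian variable decouples the spins.\<close>

lemma nn_integral_overlap_le:
  assumes \<theta>: "0 \<le> \<theta>" "\<theta> < 1" and n: "n > 0" and \<tau>: "\<tau> \<in> {1..n} \<rightarrow>\<^sub>E {-1, 1}"
  shows "(\<integral>\<^sup>+\<sigma>. ennreal (exp (\<theta> * (\<Sum>i\<in>{1..n}. \<sigma> i * \<tau> i)\<^sup>2 / (2 * real n))) \<partial>measure_pmf (labels_pmf n)) \<le> ennreal (1 / sqrt (1 - \<theta>))"
proof -
  let ?s = "sqrt (\<theta> / real n)"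
  have sq: "?s\<^sup>2 = \<theta> / real n" using \<theta> by simp
  interpret P: pair_sigma_finite gauss "measure_pmf (labels_pmf n)"
    using prob_space_imp_sigma_finite[OF prob_space_gauss] prob_space_imp_sigma_finite[OF prob_space_measure_pmf]
    by (rule pair_sigma_finite.intro)
  let ?S = "\<lambda>\<sigma>. \<Sum>i\<in>{1..n}. \<sigma> i * \<tau> i"
  have "(\<integral>\<^sup>+\<sigma>. ennreal (exp (\<theta> * (?S \<sigma>)\<^sup>2 / (2 * real n))) \<partial>measure_pmf (labels_pmf n))
     = (\<integral>\<^sup>+\<sigma>. (\<integral>\<^sup>+g. ennreal (exp ((?s * ?S \<sigma>) * g)) \<partial>gauss) \<partial>measure_pmf (labels_pmf n))"
    unfolding nn_integral_gauss_exp using sq by (intro nn_integral_cong) (simp add: power_mult_distrib)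
  also have "\<dots> = (\<Sum>\<sigma>\<in>set_pmf (labels_pmf n). (\<integral>\<^sup>+g. ennreal (exp ((?s * ?S \<sigma>) * g)) \<partial>gauss) * ennreal (pmf (labels_pmf n) \<sigma>))"
    by (rule nn_integral_measure_pmf_finite[OF finite_set_labels]) simp
  also have "\<dots> = (\<integral>\<^sup>+g. (\<Sum>\<sigma>\<in>set_pmf (labels_pmf n). ennreal (exp ((?s * ?S \<sigma>) * g)) * ennreal (pmf (labels_pmf n) \<sigma>)) \<partial>gauss)"
    by (subst nn_integral_sum) (auto simp: nn_integral_multc)
  also have "\<dots> = (\<integral>\<^sup>+g. (\<integral>\<^sup>+\<sigma>. ennreal (exp ((?s * ?S \<sigma>) * g)) \<partial>measure_pmf (labels_pmf n)) \<partial>gauss)"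
    by (intro nn_integral_cong nn_integral_measure_pmf_finite[OF finite_set_labels, symmetric]) simp
  also have "\<dots> \<le> (\<integral>\<^sup>+g. ennreal (exp (\<theta> * g\<^sup>2 / 2)) \<partial>gauss)"
  proof (rule nn_integral_mono)
    fix g
    have "(\<integral>\<^sup>+\<sigma>. ennreal (exp ((?s * ?S \<sigma>) * g)) \<partial>measure_pmf (labels_pmf n))
        = (\<integral>\<^sup>+\<sigma>. (\<Prod>i\<in>{1..n}. ennreal (exp ((?s * \<tau> i * g) * \<sigma> i))) \<partial>measure_pmf (labels_pmf n))"
    proof (intro nn_integral_cong)
      fix \<sigma>
      have "(?s * ?S \<sigma>) * g = (\<Sum>i\<in>{1..n}. (?s * \<tau> i * g) * \<sigma> i)"
        by (simp add: sum_distrib_left sum_distrib_right mult_ac)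
      then show "ennreal (exp ((?s * ?S \<sigma>) * g)) = (\<Prod>i\<in>{1..n}. ennreal (exp ((?s * \<tau> i * g) * \<sigma> i)))"
        by (simp add: exp_sum prod_ennreal)
    qed
    also have "\<dots> = (\<Prod>i\<in>{1..n}. \<integral>\<^sup>+s. ennreal (exp ((?s * \<tau> i * g) * s)) \<partial>measure_pmf (pmf_of_set {-1, 1}))"
      unfolding labels_pmf_eq by (rule nn_integral_prod_Pi_pmf) simp
    \<comment> \<open>One factor per sign, at most \<open>exp (\<theta> * g^2 / (2 * n))\<close>
      because \<open>\<tau> i\<close> squares to 1. The \<open>n\<close> factors multiply to
      \<open>exp (\<theta> * g^2 / 2)\<close>, whose Gaussian integral is finite for
      \<open>\<theta> < 1\<close>.\<close>
    also have "\<dots> \<le> (\<Prod>i\<in>{1..n}. ennreal (exp ((?s * \<tau> i * g)\<^sup>2 / 2)))"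
      by (intro prod_mono_ennreal expectation_exp_sign)
    also have "\<dots> = (\<Prod>i\<in>{1..n}. ennreal (exp (\<theta> / real n * g\<^sup>2 / 2)))"
    proof (intro prod.cong refl)
      fix i assume "i \<in> {1..n}"
      then have "(?s * \<tau> i * g)\<^sup>2 = \<theta> / real n * g\<^sup>2"
        by (simp only: power_mult_distrib sq square_sign[OF \<tau>] mult_1_right)
      then show "ennreal (exp ((?s * \<tau> i * g)\<^sup>2 / 2)) = ennreal (exp (\<theta> / real n * g\<^sup>2 / 2))" by simp
    qed
    also have "\<dots> = ennreal (exp (\<theta> * g\<^sup>2 / 2))"
      using n by (simp add: ennreal_power exp_of_nat_mult[symmetric])
    finally show "(\<integral>\<^sup>+\<sigma>. ennreal (exp ((?s * ?S \<sigma>) * g)) \<partial>measure_pmf (labels_pmf n)) \<le> ennreal (exp (\<theta> * g\<^sup>2 / 2))" .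
  qed
  also have "\<dots> = ennreal (1 / sqrt (1 - \<theta>))" by (rule nn_integral_gauss_exp_square[OF \<theta>(2)])
  finally show ?thesis .
qed

section \<open>The planted law as a mixture of densities against the null law\<close>

definition graph_obs :: "nat \<Rightarrow> nat \<Rightarrow> (nat \<Rightarrow> nat \<times> nat \<Rightarrow> bool) \<Rightarrow> nat \<Rightarrow> nat \<times> nat \<Rightarrow> nat" where
  "graph_obs m n G = (\<lambda>k\<in>{1..m}. adjacency n (G k))"

text \<open>The density of the feature matrix, given the labels and \<open>u\<close>, against pure
  noise. Values in \<open>ennreal\<close> avoid integrability conditions when integrals are
  exchanged.\<close>

definition likelihood :: "nat \<Rightarrow> nat \<Rightarrow> real \<Rightarrow> (nat \<Rightarrow> real) \<Rightarrow> (nat \<Rightarrow> real) \<Rightarrow> (nat \<Rightarrow> nat \<Rightarrow> real) \<Rightarrow> ennreal" where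
  "likelihood n p \<mu> \<sigma> u Z = (\<Prod>i\<in>{1..n}. \<Prod>r\<in>{1..p}. ennreal (exp (sqrt (\<mu> / real n) * \<sigma> i * u r * Z i r
     - (sqrt (\<mu> / real n) * \<sigma> i * u r)\<^sup>2 / 2)))"

lemma sets_noise_law: "sets (noise_law n p) = sets (\<Pi>\<^sub>M i\<in>{1..n}. \<Pi>\<^sub>M r\<in>{1..p}. borel)"
  unfolding noise_law_def std_gaussian_def by (intro sets_PiM_cong refl) simp

lemma measurable_noise_shift:
  "(\<lambda>Z. \<lambda>i\<in>{1..n}. \<lambda>r\<in>{1..p}. a i r + Z i r) \<in> noise_law n p \<rightarrow>\<^sub>M noise_law n p"
proof -
  have "(\<lambda>Z. \<lambda>i\<in>{1..n}. \<lambda>r\<in>{1..p}. a i r + Z i r) \<in> noise_law n p \<rightarrow>\<^sub>M (\<Pi>\<^sub>M i\<in>{1..n}. \<Pi>\<^sub>M r\<in>{1..p}. borel)"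
    by (intro measurable_restrict) measurable
  then show ?thesis by (simp add: measurable_cong_sets[OF refl sets_noise_law])
qed

lemma measurable_obs_pair [measurable]:
  "(\<lambda>Z. (graph_obs m n G, Z)) \<in> noise_law n p \<rightarrow>\<^sub>M obs_space m n p"
  unfolding obs_space_def
proof (rule measurable_Pair)
  show "(\<lambda>Z. graph_obs m n G) \<in> noise_law n p \<rightarrow>\<^sub>M (\<Pi>\<^sub>M k\<in>{1..m}. \<Pi>\<^sub>M ij\<in>{1..n} \<times> {1..n}. count_space {0, 1})"
    by (intro measurable_const) (auto simp: graph_obs_def space_PiM PiE_iff extensional_def adjacency_def)
  show "(\<lambda>Z. Z) \<in> noise_law n p \<rightarrow>\<^sub>M (\<Pi>\<^sub>M i\<in>{1..n}. \<Pi>\<^sub>M r\<in>{1..p}. borel)"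
    by (rule measurable_ident_sets[OF sets_noise_law])
qed

lemma measurable_likelihood [measurable]:
  "(\<lambda>x. likelihood n p \<mu> \<sigma> (fst x) (snd x)) \<in> borel_measurable (std_gaussian p \<Otimes>\<^sub>M noise_law n p)"
proof -
  have [measurable]: "(\<lambda>x. snd x i r) \<in> borel_measurable (std_gaussian p \<Otimes>\<^sub>M noise_law n p)"
    if "i \<in> {1..n}" "r \<in> {1..p}" for i r
    by (rule measurable_compose[OF measurable_snd measurable_noise_component[OF that]])
  have [measurable]: "(\<lambda>x. fst x r) \<in> borel_measurable (std_gaussian p \<Otimes>\<^sub>M noise_law n p)"
    if "r \<in> {1..p}" for r
    by (rule measurable_compose[OF measurable_fst measurable_std_gaussian_component[OF that]])
  show ?thesis unfolding likelihood_def by measurable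
qed

lemma measurable_likelihood_noise [measurable]: "likelihood n p \<mu> \<sigma> u \<in> borel_measurable (noise_law n p)"
  unfolding likelihood_def by measurable

lemma measurable_likelihood_latent [measurable]: "(\<lambda>u. likelihood n p \<mu> \<sigma> u Z) \<in> borel_measurable (std_gaussian p)"
  unfolding likelihood_def by measurable

lemma nn_integral_feature_matrix:
  assumes [measurable]: "h \<in> borel_measurable (noise_law n p)"
  shows "(\<integral>\<^sup>+Z. h (feature_matrix n p \<mu> \<sigma> u Z) \<partial>noise_law n p) = (\<integral>\<^sup>+Z. likelihood n p \<mu> \<sigma> u Z * h Z \<partial>noise_law n p)"
proof -
  let ?a = "\<lambda>i r. sqrt (\<mu> / real n) * \<sigma> i * u r"
  have "(\<integral>\<^sup>+Z. h (feature_matrix n p \<mu> \<sigma> u Z) \<partial>noise_law n p)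
     = (\<integral>\<^sup>+Z. h Z \<partial>distr (noise_law n p) (noise_law n p) (\<lambda>Z. \<lambda>i\<in>{1..n}. \<lambda>r\<in>{1..p}. ?a i r + Z i r))"
    unfolding feature_matrix_def by (rule nn_integral_distr[OF measurable_noise_shift, symmetric]) simp
  also have "\<dots> = (\<integral>\<^sup>+Z. h Z \<partial>density (noise_law n p) (likelihood n p \<mu> \<sigma> u))"
    unfolding distr_noise_shift likelihood_def[abs_def] ..
  also have "\<dots> = (\<integral>\<^sup>+Z. likelihood n p \<mu> \<sigma> u Z * h Z \<partial>noise_law n p)"
    by (rule nn_integral_density) measurable
  finally show ?thesis .
qed

lemma nn_integral_likelihood: "(\<integral>\<^sup>+Z. likelihood n p \<mu> \<sigma> u Z \<partial>noise_law n p) = 1"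
  using nn_integral_feature_matrix[of "\<lambda>_. 1" n p \<mu> \<sigma> u] prob_space.emeasure_space_1[OF prob_space_noise_law]
  by simp

text \<open>After the change of measure \<open>Z\<close> is the observed matrix itself, distributed
  as pure noise; the labels and \<open>u\<close> act on the features only through the
  likelihood.\<close>

lemma emeasure_csbm_law:
  assumes E [measurable]: "E \<in> sets (obs_space m n p)"
  shows "emeasure (csbm_law m n p d l \<mu>) E
    = (\<integral>\<^sup>+\<sigma>. \<integral>\<^sup>+G. \<integral>\<^sup>+u. \<integral>\<^sup>+Z. likelihood n p \<mu> \<sigma> u Z * indicator E (graph_obs m n G, Z)
        \<partial>noise_law n p \<partial>std_gaussian p \<partial>measure_pmf (multilayer_sbm_pmf m n d l \<sigma>) \<partial>measure_pmf (labels_pmf n))"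
proof -
  interpret Z: prob_space "noise_law n p" by (rule prob_space_noise_law)
  let ?P = "labelled_graphs_pmf m n d l" and ?N = "std_gaussian p \<Otimes>\<^sub>M noise_law n p"
  interpret N: prob_space ?N
    by (intro prob_space_pair prob_space_std_gaussian prob_space_noise_law)
  have latent: "latent_law m n p d l = measure_pmf ?P \<Otimes>\<^sub>M ?N"
    by (simp add: latent_law_def noise_law_def)
  have m: "(\<lambda>x. indicator E (observe m n p \<mu> x) :: ennreal) \<in> borel_measurable (measure_pmf ?P \<Otimes>\<^sub>M ?N)"
    unfolding latent[symmetric] by measurable
  have "emeasure (csbm_law m n p d l \<mu>) E = (\<integral>\<^sup>+x. indicator E x \<partial>csbm_law m n p d l \<mu>)"
    by (rule nn_integral_indicator[symmetric]) (simp add: sets_csbm_law)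
  also have "\<dots> = (\<integral>\<^sup>+x. indicator E (observe m n p \<mu> x) \<partial>latent_law m n p d l)"
    unfolding csbm_law_def by (rule nn_integral_distr[OF measurable_observe]) simp
  also have "\<dots> = (\<integral>\<^sup>+x. \<integral>\<^sup>+y. indicator E (observe m n p \<mu> (x, y)) \<partial>?N \<partial>measure_pmf ?P)"
    unfolding latent by (rule N.nn_integral_fst[symmetric, OF m])
  also have "\<dots> = (\<integral>\<^sup>+x. \<integral>\<^sup>+u. \<integral>\<^sup>+Z. indicator E (observe m n p \<mu> (x, (u, Z))) \<partial>noise_law n p \<partial>std_gaussian p \<partial>measure_pmf ?P)"
  proof (rule nn_integral_cong)
    fix x
    have "(\<lambda>y. indicator E (observe m n p \<mu> (x, y)) :: ennreal) \<in> borel_measurable ?N"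
      by (rule measurable_compose[OF _ m]) simp
    then show "(\<integral>\<^sup>+y. indicator E (observe m n p \<mu> (x, y)) \<partial>?N)
      = (\<integral>\<^sup>+u. \<integral>\<^sup>+Z. indicator E (observe m n p \<mu> (x, (u, Z))) \<partial>noise_law n p \<partial>std_gaussian p)"
      by (rule Z.nn_integral_fst[symmetric])
  qed
  also have "\<dots> = (\<integral>\<^sup>+x. \<integral>\<^sup>+u. \<integral>\<^sup>+Z. likelihood n p \<mu> (fst x) u Z * indicator E (graph_obs m n (snd x), Z)
      \<partial>noise_law n p \<partial>std_gaussian p \<partial>measure_pmf ?P)"
  proof (rule nn_integral_cong, rule nn_integral_cong)
    fix x :: "(nat \<Rightarrow> real) \<times> (nat \<Rightarrow> nat \<times> nat \<Rightarrow> bool)" and u :: "nat \<Rightarrow> real"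
    have o: "observe m n p \<mu> (x, (u, Z)) = (graph_obs m n (snd x), feature_matrix n p \<mu> (fst x) u Z)" for Z
      by (simp add: observe_def graph_obs_def case_prod_beta')
    show "(\<integral>\<^sup>+Z. indicator E (observe m n p \<mu> (x, (u, Z))) \<partial>noise_law n p)
      = (\<integral>\<^sup>+Z. likelihood n p \<mu> (fst x) u Z * indicator E (graph_obs m n (snd x), Z) \<partial>noise_law n p)"
      unfolding o by (rule nn_integral_feature_matrix) measurable
  qed
  also have "\<dots> = (\<integral>\<^sup>+\<sigma>. \<integral>\<^sup>+G. \<integral>\<^sup>+u. \<integral>\<^sup>+Z. likelihood n p \<mu> \<sigma> u Z * indicator E (graph_obs m n G, Z)
        \<partial>noise_law n p \<partial>std_gaussian p \<partial>measure_pmf (multilayer_sbm_pmf m n d l \<sigma>) \<partial>measure_pmf (labels_pmf n))"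
    unfolding labelled_graphs_pmf_def by simp
  finally show ?thesis .
qed

text \<open>The zero labels are a placeholder: with \<open>l = 0\<close> both edge probabilities
  coincide.\<close>

abbreviation null_graphs :: "nat \<Rightarrow> nat \<Rightarrow> (nat \<Rightarrow> real) \<Rightarrow> (nat \<Rightarrow> nat \<times> nat \<Rightarrow> bool) pmf" where
  "null_graphs m n d \<equiv> multilayer_sbm_pmf m n d (\<lambda>_. 0) (\<lambda>_. 0)"

lemma multilayer_null: "multilayer_sbm_pmf m n d (\<lambda>_. 0) \<sigma> = null_graphs m n d"
  unfolding multilayer_sbm_pmf_def sbm_pmf_def a_par_def b_par_def by (simp cong: if_cong)

lemma emeasure_null_law:
  assumes E [measurable]: "E \<in> sets (obs_space m n p)"
  shows "emeasure (csbm_law m n p d (\<lambda>_. 0) 0) E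
    = (\<integral>\<^sup>+G. \<integral>\<^sup>+Z. indicator E (graph_obs m n G, Z) \<partial>noise_law n p \<partial>measure_pmf (null_graphs m n d))"
proof -
  have lik: "likelihood n p 0 \<sigma> u Z = 1" for \<sigma> u Z by (simp add: likelihood_def)
  let ?I = "\<lambda>G. \<integral>\<^sup>+Z. indicator E (graph_obs m n G, Z) \<partial>noise_law n p"
  have "emeasure (csbm_law m n p d (\<lambda>_. 0) 0) E
    = (\<integral>\<^sup>+\<sigma>. \<integral>\<^sup>+G. \<integral>\<^sup>+u. ?I G \<partial>std_gaussian p \<partial>measure_pmf (multilayer_sbm_pmf m n d (\<lambda>_. 0) \<sigma>) \<partial>measure_pmf (labels_pmf n))"
    unfolding emeasure_csbm_law[OF E] lik by simp
  also have "\<dots> = (\<integral>\<^sup>+\<sigma>. \<integral>\<^sup>+G. ?I G \<partial>measure_pmf (null_graphs m n d) \<partial>measure_pmf (labels_pmf n))"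
  proof (rule nn_integral_cong)
    fix \<sigma> :: "nat \<Rightarrow> real"
    show "(\<integral>\<^sup>+G. \<integral>\<^sup>+u. ?I G \<partial>std_gaussian p \<partial>measure_pmf (multilayer_sbm_pmf m n d (\<lambda>_. 0) \<sigma>))
      = (\<integral>\<^sup>+G. ?I G \<partial>measure_pmf (null_graphs m n d))"
      unfolding multilayer_null[of m n d \<sigma>]
      using prob_space.emeasure_space_1[OF prob_space_std_gaussian, of p] by simp
  qed
  finally show ?thesis by simp
qed

lemma pmf_Pi_pmf_density:
  assumes "finite A" "\<And>x y. x \<in> A \<Longrightarrow> pmf (p x) y = \<rho> x y * pmf (p0 x) y"
  shows "pmf (Pi_pmf A d p) f = (\<Prod>x\<in>A. \<rho> x (f x)) * pmf (Pi_pmf A d p0) f"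
  using assms by (auto simp: pmf_Pi prod.distrib)

lemma sum_vertex_pairs: "2 * (\<Sum>(i, j)\<in>vertex_pairs n. x i * x j) = (\<Sum>i\<in>{1..n}. x i)\<^sup>2 - (\<Sum>i\<in>{1..n}. (x i)\<^sup>2)"
  for x :: "nat \<Rightarrow> real"
proof (induction n)
  case 0
  have "vertex_pairs 0 = {}" by (auto simp: vertex_pairs_def)
  then show ?case by simp
next
  case (Suc n)
  have vp: "vertex_pairs (Suc n) = vertex_pairs n \<union> {1..n} \<times> {Suc n}"
    by (auto simp: vertex_pairs_def)
  have "(\<Sum>(i, j)\<in>vertex_pairs (Suc n). x i * x j) = (\<Sum>(i, j)\<in>vertex_pairs n. x i * x j) + (\<Sum>(i, j)\<in>{1..n} \<times> {Suc n}. x i * x j)"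
    unfolding vp by (rule sum.union_disjoint[OF finite_vertex_pairs]) (auto simp: vertex_pairs_def)
  also have "(\<Sum>(i, j)\<in>{1..n} \<times> {Suc n}. x i * x j) = (\<Sum>i\<in>{1..n}. x i) * x (Suc n)"
    by (simp add: sum.cartesian_product[symmetric] sum_distrib_right)
  finally show ?case using Suc by (simp add: power2_sum algebra_simps)
qed

lemma nn_integral_pmf_swap:
  assumes "finite (set_pmf q)" "\<And>s. (\<lambda>x. f x s) \<in> borel_measurable M"
  shows "(\<integral>\<^sup>+s. \<integral>\<^sup>+x. f x s \<partial>M \<partial>measure_pmf q) = (\<integral>\<^sup>+x. \<integral>\<^sup>+s. f x s \<partial>measure_pmf q \<partial>M)"
  using assms by (simp add: nn_integral_measure_pmf_finite nn_integral_sum nn_integral_multc)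

text \<open>From \<open>(F - K)^2 \<ge> 0\<close>. Multiplied by the indicator of an event it bounds
  a planted probability by a multiple of the null probability plus a second moment, and
  \<open>K\<close> balances the two.\<close>

lemma ennreal_young:
  fixes F :: ennreal
  assumes "K > 0"
  shows "F \<le> ennreal (K / 2) + ennreal (1 / (2 * K)) * F\<^sup>2"
proof (cases F)
  case (real x)
  have "0 \<le> (x - K)\<^sup>2 / (2 * K)" using assms by simp
  then have "x \<le> K / 2 + 1 / (2 * K) * x\<^sup>2"
    using assms by (simp add: field_simps power2_eq_square)
  then have "ennreal x \<le> ennreal (K / 2 + 1 / (2 * K) * x\<^sup>2)" by (rule ennreal_leI)
  also have "\<dots> = ennreal (K / 2) + ennreal (1 / (2 * K)) * (ennreal x)\<^sup>2"
    using assms real by (simp add: ennreal_mult[symmetric] ennreal_power)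
  finally show ?thesis using real by simp
next
  case top
  then show ?thesis using assms by (simp add: ennreal_mult_eq_top_iff power2_eq_square)
qed

section \<open>Second moment of the truncated likelihood ratio\<close>

lemma measurable_likelihood_compose [measurable (raw)]:
  assumes "f \<in> M \<rightarrow>\<^sub>M std_gaussian p" "g \<in> M \<rightarrow>\<^sub>M noise_law n p"
  shows "(\<lambda>x. likelihood n p \<mu> \<sigma> (f x) (g x)) \<in> borel_measurable M"
  using measurable_compose[OF measurable_Pair[OF assms] measurable_likelihood] by simp

lemma bernoulli_likelihood_product:
  fixes q q' x :: real
  assumes "0 < x" "x < 1"
  shows "q / x * (q' / x) * x + (1 - q) / (1 - x) * ((1 - q') / (1 - x)) * (1 - x) = 1 + (q - x) * (q' - x) / (x * (1 - x))"
proof -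
  have "q / x * (q' / x) * x + (1 - q) / (1 - x) * ((1 - q') / (1 - x)) * (1 - x) = q * q' / x + (1 - q) * (1 - q') / (1 - x)"
    using assms by simp
  also have "\<dots> = 1 + (q - x) * (q' - x) / (x * (1 - x))"
    using assms by (simp add: divide_simps) (simp add: algebra_simps)
  finally show ?thesis .
qed

text \<open>\<open>\<tau>\<close> is the bound on the squared norm of \<open>u\<close>, later
  \<open>(1 + \<epsilon>) * p\<close>. The condition \<open>d t < n\<close> keeps both states of an
  edge possible under the null law, so that the density ratios make sense.\<close>

locale truncated = planted m n p d l \<mu> 1 for m n p :: nat and d l :: "nat \<Rightarrow> real" and \<mu> :: real +
  fixes \<tau> :: real
  assumes d_less: "\<And>t. t \<in> {1..m} \<Longrightarrow> d t < real n" and \<tau>: "\<tau> \<ge> 0"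
begin

definition edge_ratio :: "(nat \<Rightarrow> real) \<Rightarrow> nat \<Rightarrow> nat \<times> nat \<Rightarrow> bool \<Rightarrow> real" where
  "edge_ratio \<sigma> t e b = (case e of (i, j) \<Rightarrow>
     if b then edge_prob (\<sigma> i = \<sigma> j) t / (d t / real n) else (1 - edge_prob (\<sigma> i = \<sigma> j) t) / (1 - d t / real n))"

definition graph_ratio :: "(nat \<Rightarrow> real) \<Rightarrow> (nat \<Rightarrow> nat \<times> nat \<Rightarrow> bool) \<Rightarrow> real" where
  "graph_ratio \<sigma> G = (\<Prod>t\<in>{1..m}. \<Prod>e\<in>vertex_pairs n. edge_ratio \<sigma> t e (G t e))"

lemma null_prob: "t \<in> {1..m} \<Longrightarrow> 0 < d t / real n" "t \<in> {1..m} \<Longrightarrow> d t / real n < 1"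
  using d d_less n by auto

lemma edge_ratio_nonneg: "t \<in> {1..m} \<Longrightarrow> edge_ratio \<sigma> t e b \<ge> 0"
  using null_prob[of t] edge_prob_bounds[of t] d[of t] unfolding edge_ratio_def
  by (auto split: prod.splits intro!: divide_nonneg_nonneg)

lemma graph_ratio_nonneg: "graph_ratio \<sigma> G \<ge> 0"
  unfolding graph_ratio_def by (intro prod_nonneg edge_ratio_nonneg ballI)

lemma pmf_graph_ratio:
  "pmf (multilayer_sbm_pmf m n d l \<sigma>) G = graph_ratio \<sigma> G * pmf (null_graphs m n d) G"
  unfolding multilayer_sbm_pmf_def graph_ratio_def
proof (rule pmf_Pi_pmf_density)
  fix t g assume t: "t \<in> {1..m}"
  show "pmf (sbm_pmf n (a_par (d t) (l t)) (b_par (d t) (l t)) \<sigma>) g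
     = (\<Prod>e\<in>vertex_pairs n. edge_ratio \<sigma> t e (g e)) * pmf (sbm_pmf n (a_par (d t) 0) (b_par (d t) 0) (\<lambda>_. 0)) g"
    unfolding sbm_pmf_def
  proof (rule pmf_Pi_pmf_density)
    fix e :: "nat \<times> nat" and y
    obtain i j where e: "e = (i, j)" by force
    have q: "(if \<sigma> i = \<sigma> j then a_par (d t) (l t) / real n else b_par (d t) (l t) / real n) = edge_prob (\<sigma> i = \<sigma> j) t"
      by (simp add: edge_prob_def)
    have q0: "a_par (d t) 0 = d t" by (simp add: a_par_def)
    have "pmf (bernoulli_pmf (edge_prob (\<sigma> i = \<sigma> j) t)) y = edge_ratio \<sigma> t (i, j) y * pmf (bernoulli_pmf (d t / real n)) y"
      using null_prob[OF t] edge_prob_bounds[OF t] by (cases y) (auto simp: edge_ratio_def)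
    then show "pmf (case e of (i, j) \<Rightarrow> bernoulli_pmf (if \<sigma> i = \<sigma> j then a_par (d t) (l t) / real n else b_par (d t) (l t) / real n)) y
      = edge_ratio \<sigma> t e y * pmf (case e of (i, j) \<Rightarrow> bernoulli_pmf (if (0::real) = 0 then a_par (d t) 0 / real n else b_par (d t) 0 / real n)) y"
      by (simp only: e prod.case q q0 if_True refl)
  qed simp
qed simp

lemma nn_integral_graphs:
  "(\<integral>\<^sup>+G. f G \<partial>measure_pmf (multilayer_sbm_pmf m n d l \<sigma>)) = (\<integral>\<^sup>+G. ennreal (graph_ratio \<sigma> G) * f G \<partial>measure_pmf (null_graphs m n d))"
  unfolding nn_integral_measure_pmf pmf_graph_ratio
  by (intro nn_integral_cong) (simp add: ennreal_mult graph_ratio_nonneg mult_ac)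

text \<open>The squared deviation \<open>(l t * sqrt (d t) / n)^2\<close> of an edge probability,
  divided by the null variance \<open>x * (1 - x)\<close> of an edge with
  \<open>x = d t / n\<close>.\<close>

definition layer_coupling :: "nat \<Rightarrow> real" where
  "layer_coupling t = (l t)\<^sup>2 / (real n - d t)"

lemma layer_coupling_bounds:
  assumes "t \<in> {1..m}"
  shows "0 \<le> layer_coupling t"
  unfolding layer_coupling_def using d_less[OF assms] by simp

lemma edge_overlap:
  assumes t: "t \<in> {1..m}" and \<sigma>: "\<sigma> \<in> signs" and \<rho>: "\<rho> \<in> signs" and e: "(i, j) \<in> vertex_pairs n"
  shows "(\<integral>\<^sup>+b. ennreal (edge_ratio \<sigma> t (i, j) b) * ennreal (edge_ratio \<rho> t (i, j) b) \<partial>measure_pmf (bernoulli_pmf (d t / real n)))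
    = ennreal (1 + layer_coupling t * (\<sigma> i * \<rho> i * (\<sigma> j * \<rho> j)))"
proof -
  let ?x = "d t / real n" and ?q = "edge_prob (\<sigma> i = \<sigma> j) t" and ?q' = "edge_prob (\<rho> i = \<rho> j) t"
  have ij: "i \<in> {1..n}" "j \<in> {1..n}" using e by (auto simp: vertex_pairs_def)
  note x = null_prob[OF t]
  have dn: "d t > 0" "real n - d t > 0" "real n > 0" using d[OF t] d_less[OF t] n by auto
  have "(\<integral>\<^sup>+b. ennreal (edge_ratio \<sigma> t (i, j) b) * ennreal (edge_ratio \<rho> t (i, j) b) \<partial>measure_pmf (bernoulli_pmf ?x))
     = ennreal (?q / ?x * (?q' / ?x) * ?x + (1 - ?q) / (1 - ?x) * ((1 - ?q') / (1 - ?x)) * (1 - ?x))"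
  proof -
    let ?f = "\<lambda>b. edge_ratio \<sigma> t (i, j) b * edge_ratio \<rho> t (i, j) b"
    have f: "0 \<le> ?f b" for b using edge_ratio_nonneg[OF t] by simp
    have "(\<integral>\<^sup>+b. ennreal (edge_ratio \<sigma> t (i, j) b) * ennreal (edge_ratio \<rho> t (i, j) b) \<partial>measure_pmf (bernoulli_pmf ?x))
       = (\<integral>\<^sup>+b. ennreal (?f b) \<partial>measure_pmf (bernoulli_pmf ?x))"
      by (simp add: ennreal_mult edge_ratio_nonneg[OF t])
    also have "\<dots> = ennreal (?f True) * ennreal ?x + ennreal (?f False) * ennreal (1 - ?x)"
      by (rule nn_integral_bernoulli_pmf) (use x in auto)
    also have "\<dots> = ennreal (?f True * ?x) + ennreal (?f False * (1 - ?x))"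
      using f[of True] f[of False] x by (simp only: ennreal_mult[symmetric] mult_nonneg_nonneg edge_ratio_nonneg[OF t] less_imp_le diff_ge_0_iff_ge)
    also have "\<dots> = ennreal (?f True * ?x + ?f False * (1 - ?x))"
      by (intro ennreal_plus[symmetric] mult_nonneg_nonneg edge_ratio_nonneg[OF t]) (use x in auto)
    finally show ?thesis by (simp only: edge_ratio_def prod.case if_True if_False)
  qed
  also have "?q / ?x * (?q' / ?x) * ?x + (1 - ?q) / (1 - ?x) * ((1 - ?q') / (1 - ?x)) * (1 - ?x)
     = 1 + (?q - ?x) * (?q' - ?x) / (?x * (1 - ?x))"
    by (rule bernoulli_likelihood_product[OF x])
  also have "?q - ?x = \<sigma> i * \<sigma> j * l t * sqrt (d t) / real n"
    using same_sign[OF \<sigma> ij] by (simp add: edge_prob_eq add_divide_distrib)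
  also have "?q' - ?x = \<rho> i * \<rho> j * l t * sqrt (d t) / real n"
    using same_sign[OF \<rho> ij] by (simp add: edge_prob_eq add_divide_distrib)
  also have "?x * (1 - ?x) = d t * (real n - d t) / (real n)\<^sup>2"
    using dn by (simp add: field_simps power2_eq_square)
  also have "\<sigma> i * \<sigma> j * l t * sqrt (d t) / real n * (\<rho> i * \<rho> j * l t * sqrt (d t) / real n)
     = (\<sigma> i * \<rho> i * (\<sigma> j * \<rho> j)) * ((l t)\<^sup>2 * d t) / (real n)\<^sup>2"
  proof -
    have "\<sigma> i * \<sigma> j * l t * sqrt (d t) / real n * (\<rho> i * \<rho> j * l t * sqrt (d t) / real n)
      = (\<sigma> i * \<rho> i * (\<sigma> j * \<rho> j)) * ((l t)\<^sup>2 * (sqrt (d t) * sqrt (d t))) / (real n)\<^sup>2"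
      by (simp add: power2_eq_square mult_ac)
    then show ?thesis using dn by simp
  qed
  also have "(\<sigma> i * \<rho> i * (\<sigma> j * \<rho> j)) * ((l t)\<^sup>2 * d t) / (real n)\<^sup>2 / (d t * (real n - d t) / (real n)\<^sup>2)
     = layer_coupling t * (\<sigma> i * \<rho> i * (\<sigma> j * \<rho> j))"
    unfolding layer_coupling_def using dn by (simp add: field_simps)
  finally show ?thesis .
qed

text \<open>By \<open>1 + y \<le> exp y\<close> the product over pairs becomes the exponential of a
  sum over pairs, which equals \<open>(S^2 - n) / 2\<close>. The diagonal part only lowers the
  exponent and is dropped.\<close>

lemma graph_overlap:
  assumes \<sigma>: "\<sigma> \<in> signs" and \<rho>: "\<rho> \<in> signs"
  defines "S \<equiv> \<Sum>i\<in>{1..n}. \<sigma> i * \<rho> i"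
  shows "(\<integral>\<^sup>+G. ennreal (graph_ratio \<sigma> G) * ennreal (graph_ratio \<rho> G) \<partial>measure_pmf (null_graphs m n d))
    \<le> ennreal (exp ((\<Sum>t\<in>{1..m}. layer_coupling t) * S\<^sup>2 / 2))"
proof -
  let ?f = "\<lambda>t e b. ennreal (edge_ratio \<sigma> t e b) * ennreal (edge_ratio \<rho> t e b)"
  let ?x = "\<lambda>e. case e of (i, j) \<Rightarrow> \<sigma> i * \<rho> i * (\<sigma> j * \<rho> j)"
  have "ennreal (graph_ratio \<sigma> G) * ennreal (graph_ratio \<rho> G) = (\<Prod>t\<in>{1..m}. \<Prod>e\<in>vertex_pairs n. ?f t e (G t e))" for G
  proof -
    have "ennreal (graph_ratio \<sigma> G) = (\<Prod>t\<in>{1..m}. \<Prod>e\<in>vertex_pairs n. ennreal (edge_ratio \<sigma> t e (G t e)))" for \<sigma>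
    proof -
      have "ennreal (graph_ratio \<sigma> G) = (\<Prod>t\<in>{1..m}. ennreal (\<Prod>e\<in>vertex_pairs n. edge_ratio \<sigma> t e (G t e)))"
        unfolding graph_ratio_def by (rule prod_ennreal[symmetric]) (intro prod_nonneg edge_ratio_nonneg ballI)
      also have "\<dots> = (\<Prod>t\<in>{1..m}. \<Prod>e\<in>vertex_pairs n. ennreal (edge_ratio \<sigma> t e (G t e)))"
        by (intro prod.cong refl prod_ennreal[symmetric] edge_ratio_nonneg)
      finally show ?thesis .
    qed
    then show ?thesis by (simp add: prod.distrib)
  qed
  then have "(\<integral>\<^sup>+G. ennreal (graph_ratio \<sigma> G) * ennreal (graph_ratio \<rho> G) \<partial>measure_pmf (null_graphs m n d))
     = (\<integral>\<^sup>+G. (\<Prod>t\<in>{1..m}. \<Prod>e\<in>vertex_pairs n. ?f t e (G t e)) \<partial>measure_pmf (null_graphs m n d))" by simp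
  also have "\<dots> = (\<Prod>t\<in>{1..m}. \<integral>\<^sup>+g. (\<Prod>e\<in>vertex_pairs n. ?f t e (g e))
      \<partial>measure_pmf (sbm_pmf n (a_par (d t) 0) (b_par (d t) 0) (\<lambda>_. 0)))"
    unfolding multilayer_sbm_pmf_def
    by (rule nn_integral_prod_Pi_pmf[where f="\<lambda>t g. \<Prod>e\<in>vertex_pairs n. ?f t e (g e)"]) simp
  also have "\<dots> = (\<Prod>t\<in>{1..m}. \<Prod>e\<in>vertex_pairs n. ennreal (1 + layer_coupling t * ?x e))"
  proof (rule prod.cong[OF refl])
    fix t assume t: "t \<in> {1..m}"
    have "(\<integral>\<^sup>+g. (\<Prod>e\<in>vertex_pairs n. ?f t e (g e)) \<partial>measure_pmf (sbm_pmf n (a_par (d t) 0) (b_par (d t) 0) (\<lambda>_. 0)))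
       = (\<Prod>e\<in>vertex_pairs n. \<integral>\<^sup>+b. ?f t e b \<partial>measure_pmf (case e of (i, j) \<Rightarrow>
            bernoulli_pmf (if (0::real) = 0 then a_par (d t) 0 / real n else b_par (d t) 0 / real n)))"
      unfolding sbm_pmf_def by (rule nn_integral_prod_Pi_pmf) simp
    also have "\<dots> = (\<Prod>e\<in>vertex_pairs n. ennreal (1 + layer_coupling t * ?x e))"
    proof (rule prod.cong[OF refl])
      fix e assume e: "e \<in> vertex_pairs n"
      obtain i j where ij: "e = (i, j)" by force
      have "a_par (d t) 0 = d t" by (simp add: a_par_def)
      then show "(\<integral>\<^sup>+b. ?f t e b \<partial>measure_pmf (case e of (i, j) \<Rightarrow>
            bernoulli_pmf (if (0::real) = 0 then a_par (d t) 0 / real n else b_par (d t) 0 / real n))) = ennreal (1 + layer_coupling t * ?x e)"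
        using edge_overlap[OF t \<sigma> \<rho>, of i j] e unfolding ij prod.case by simp
    qed
    finally show "(\<integral>\<^sup>+g. (\<Prod>e\<in>vertex_pairs n. ?f t e (g e)) \<partial>measure_pmf (sbm_pmf n (a_par (d t) 0) (b_par (d t) 0) (\<lambda>_. 0)))
       = (\<Prod>e\<in>vertex_pairs n. ennreal (1 + layer_coupling t * ?x e))" .
  qed
  also have "\<dots> \<le> (\<Prod>t\<in>{1..m}. \<Prod>e\<in>vertex_pairs n. ennreal (exp (layer_coupling t * ?x e)))"
    by (intro prod_mono_ennreal ennreal_leI exp_ge_add_one_self)
  also have "\<dots> = ennreal (exp (\<Sum>t\<in>{1..m}. \<Sum>e\<in>vertex_pairs n. layer_coupling t * ?x e))"
    by (simp add: prod_ennreal exp_sum prod_nonneg)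
  also have "(\<Sum>t\<in>{1..m}. \<Sum>e\<in>vertex_pairs n. layer_coupling t * ?x e) = (\<Sum>t\<in>{1..m}. layer_coupling t) * (\<Sum>e\<in>vertex_pairs n. ?x e)"
    by (simp add: sum_product)
  also have "(\<Sum>e\<in>vertex_pairs n. ?x e) = (S\<^sup>2 - real n) / 2"
  proof -
    have "(\<Sum>i\<in>{1..n}. (\<sigma> i * \<rho> i)\<^sup>2) = real n"
      by (simp add: power_mult_distrib square_sign[OF \<sigma>] square_sign[OF \<rho>])
    then show ?thesis using sum_vertex_pairs[of "\<lambda>i. \<sigma> i * \<rho> i" n] by (simp add: S_def)
  qed
  also have "ennreal (exp ((\<Sum>t\<in>{1..m}. layer_coupling t) * ((S\<^sup>2 - real n) / 2))) \<le> ennreal (exp ((\<Sum>t\<in>{1..m}. layer_coupling t) * S\<^sup>2 / 2))"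
    unfolding times_divide_eq_right
    by (intro ennreal_leI exp_le_cancel_iff[THEN iffD2] divide_right_mono mult_left_mono sum_nonneg layer_coupling_bounds) auto
  finally show ?thesis .
qed

text \<open>An entry contributes the exponential of the product of its two means. Collecting the
  vertices for a fixed coordinate leaves the overlap of the labellings.\<close>

lemma feature_overlap:
  "(\<integral>\<^sup>+Z. likelihood n p \<mu> \<sigma> u Z * likelihood n p \<mu> \<rho> v Z \<partial>noise_law n p)
    = (\<Prod>r\<in>{1..p}. ennreal (exp (\<mu> / real n * (\<Sum>i\<in>{1..n}. \<sigma> i * \<rho> i) * v r * u r)))"
proof -
  let ?a = "\<lambda>\<sigma> u i r. sqrt (\<mu> / real n) * \<sigma> i * u r"
  let ?L = "\<lambda>\<sigma> u i r z. ennreal (exp (?a \<sigma> u i r * z - (?a \<sigma> u i r)\<^sup>2 / 2))"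
  have "(\<integral>\<^sup>+Z. likelihood n p \<mu> \<sigma> u Z * likelihood n p \<mu> \<rho> v Z \<partial>noise_law n p)
     = (\<integral>\<^sup>+Z. (\<Prod>i\<in>{1..n}. \<Prod>r\<in>{1..p}. ?L \<sigma> u i r (Z i r) * ?L \<rho> v i r (Z i r)) \<partial>noise_law n p)"
    unfolding likelihood_def by (simp only: prod.distrib)
  also have "\<dots> = (\<Prod>i\<in>{1..n}. \<Prod>r\<in>{1..p}. \<integral>\<^sup>+z. ?L \<sigma> u i r z * ?L \<rho> v i r z \<partial>gauss)"
    by (rule nn_integral_noise_prod) measurable
  also have "\<dots> = (\<Prod>i\<in>{1..n}. \<Prod>r\<in>{1..p}. ennreal (exp (\<mu> / real n * (\<sigma> i * \<rho> i) * v r * u r)))"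
  proof (intro prod.cong refl)
    fix i r
    have "?a \<sigma> u i r * ?a \<rho> v i r = (sqrt (\<mu> / real n) * sqrt (\<mu> / real n)) * (\<sigma> i * \<rho> i) * v r * u r"
      by (simp only: mult_ac)
    also have "sqrt (\<mu> / real n) * sqrt (\<mu> / real n) = \<mu> / real n" using \<mu> by simp
    finally show "(\<integral>\<^sup>+z. ?L \<sigma> u i r z * ?L \<rho> v i r z \<partial>gauss) = ennreal (exp (\<mu> / real n * (\<sigma> i * \<rho> i) * v r * u r))"
      unfolding nn_integral_gauss_likelihoods by simp
  qed
  also have "\<dots> = (\<Prod>r\<in>{1..p}. \<Prod>i\<in>{1..n}. ennreal (exp (\<mu> / real n * (\<sigma> i * \<rho> i) * v r * u r)))"
    by (rule prod.swap)
  also have "\<dots> = (\<Prod>r\<in>{1..p}. ennreal (exp (\<mu> / real n * (\<Sum>i\<in>{1..n}. \<sigma> i * \<rho> i) * v r * u r)))"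
    by (intro prod.cong refl) (simp add: prod_ennreal exp_sum[symmetric] sum_distrib_left sum_distrib_right mult_ac)
  finally show ?thesis .
qed

section \<open>Truncation of the latent vector\<close>

definition small :: "(nat \<Rightarrow> real) \<Rightarrow> ennreal" where
  "small u = indicator {u. (\<Sum>r\<in>{1..p}. (u r)\<^sup>2) \<le> \<tau>} u"

lemma measurable_small [measurable]: "small \<in> borel_measurable (std_gaussian p)"
  unfolding small_def by measurable

definition truncated_likelihood :: "(nat \<Rightarrow> real) \<Rightarrow> (nat \<Rightarrow> nat \<Rightarrow> real) \<Rightarrow> ennreal" where
  "truncated_likelihood \<sigma> Z = (\<integral>\<^sup>+u. small u * likelihood n p \<mu> \<sigma> u Z \<partial>std_gaussian p)"

lemma measurable_truncated_likelihood [measurable]: "truncated_likelihood \<sigma> \<in> borel_measurable (noise_law n p)"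
proof -
  interpret U: prob_space "std_gaussian p" by (rule prob_space_std_gaussian)
  show ?thesis unfolding truncated_likelihood_def[abs_def] by measurable
qed

text \<open>For fixed \<open>v\<close>, the integral over all \<open>u\<close> is
  \<open>exp ((\<mu> / n * S)^2 * |v|^2 / 2)\<close>, finite but not always integrable in
  \<open>v\<close>. Truncating \<open>v\<close> bounds its squared norm by \<open>\<tau>\<close>,
  which yields the same quadratic exponent in \<open>S\<close> as the graphs do.\<close>

lemma truncated_overlap:
  fixes \<sigma> \<rho> :: "nat \<Rightarrow> real"
  defines "S \<equiv> \<Sum>i\<in>{1..n}. \<sigma> i * \<rho> i"
  shows "(\<integral>\<^sup>+Z. truncated_likelihood \<sigma> Z * truncated_likelihood \<rho> Z \<partial>noise_law n p)
    \<le> ennreal (exp ((\<mu> / real n * S)\<^sup>2 * \<tau> / 2))"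
proof -
  interpret U: prob_space "std_gaussian p" by (rule prob_space_std_gaussian)
  interpret Z: prob_space "noise_law n p" by (rule prob_space_noise_law)
  interpret P: pair_sigma_finite "std_gaussian p" "noise_law n p" ..
  let ?l = "likelihood n p \<mu>" and ?K = "ennreal (exp ((\<mu> / real n * S)\<^sup>2 * \<tau> / 2))"
  have "(\<integral>\<^sup>+Z. truncated_likelihood \<sigma> Z * truncated_likelihood \<rho> Z \<partial>noise_law n p)
     = (\<integral>\<^sup>+Z. \<integral>\<^sup>+v. truncated_likelihood \<sigma> Z * (small v * ?l \<rho> v Z) \<partial>std_gaussian p \<partial>noise_law n p)"
    unfolding truncated_likelihood_def[of \<rho>]
    by (rule nn_integral_cong, rule nn_integral_cmult[symmetric]) measurable
  also have "\<dots> = (\<integral>\<^sup>+v. \<integral>\<^sup>+Z. truncated_likelihood \<sigma> Z * (small v * ?l \<rho> v Z) \<partial>noise_law n p \<partial>std_gaussian p)"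
    by (rule P.Fubini') measurable
  also have "\<dots> \<le> (\<integral>\<^sup>+v. ?K \<partial>std_gaussian p)"
  proof (rule nn_integral_mono)
    fix v
    have eq: "(\<integral>\<^sup>+Z. truncated_likelihood \<sigma> Z * (small v * ?l \<rho> v Z) \<partial>noise_law n p)
       = small v * (\<integral>\<^sup>+Z. \<integral>\<^sup>+u. small u * ?l \<sigma> u Z * ?l \<rho> v Z \<partial>std_gaussian p \<partial>noise_law n p)"
    proof -
      have "(\<integral>\<^sup>+Z. truncated_likelihood \<sigma> Z * (small v * ?l \<rho> v Z) \<partial>noise_law n p)
         = (\<integral>\<^sup>+Z. small v * (truncated_likelihood \<sigma> Z * ?l \<rho> v Z) \<partial>noise_law n p)"
        by (simp only: mult_ac)
      also have "\<dots> = small v * (\<integral>\<^sup>+Z. truncated_likelihood \<sigma> Z * ?l \<rho> v Z \<partial>noise_law n p)"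
        by (rule nn_integral_cmult) measurable
      also have "(\<integral>\<^sup>+Z. truncated_likelihood \<sigma> Z * ?l \<rho> v Z \<partial>noise_law n p)
         = (\<integral>\<^sup>+Z. \<integral>\<^sup>+u. small u * ?l \<sigma> u Z * ?l \<rho> v Z \<partial>std_gaussian p \<partial>noise_law n p)"
        unfolding truncated_likelihood_def
        by (rule nn_integral_cong, rule nn_integral_multc[symmetric]) measurable
      finally show ?thesis .
    qed
    have "(\<integral>\<^sup>+Z. \<integral>\<^sup>+u. small u * ?l \<sigma> u Z * ?l \<rho> v Z \<partial>std_gaussian p \<partial>noise_law n p)
       = (\<integral>\<^sup>+u. \<integral>\<^sup>+Z. small u * ?l \<sigma> u Z * ?l \<rho> v Z \<partial>noise_law n p \<partial>std_gaussian p)"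
      by (rule P.Fubini') measurable
    also have "\<dots> \<le> (\<integral>\<^sup>+u. (\<integral>\<^sup>+Z. ?l \<sigma> u Z * ?l \<rho> v Z \<partial>noise_law n p) \<partial>std_gaussian p)"
    proof (rule nn_integral_mono, rule nn_integral_mono)
      fix u Z
      have "small u \<le> 1" by (simp add: small_def indicator_def)
      then show "small u * ?l \<sigma> u Z * ?l \<rho> v Z \<le> ?l \<sigma> u Z * ?l \<rho> v Z"
        using mult_right_mono[of "small u" 1 "?l \<sigma> u Z * ?l \<rho> v Z"] by (simp add: mult.assoc)
    qed
    also have "\<dots> = (\<integral>\<^sup>+u. (\<Prod>r\<in>{1..p}. ennreal (exp (\<mu> / real n * S * v r * u r))) \<partial>std_gaussian p)"
      unfolding feature_overlap S_def ..
    also have "\<dots> = (\<Prod>r\<in>{1..p}. \<integral>\<^sup>+x. ennreal (exp (\<mu> / real n * S * v r * x)) \<partial>gauss)"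
      by (rule nn_integral_std_gaussian_prod) measurable
    also have "\<dots> = (\<Prod>r\<in>{1..p}. ennreal (exp ((\<mu> / real n * S * v r)\<^sup>2 / 2)))"
      by (intro prod.cong refl nn_integral_gauss_exp)
    also have "\<dots> = ennreal (exp (\<Sum>r\<in>{1..p}. (\<mu> / real n * S * v r)\<^sup>2 / 2))"
      by (simp add: prod_ennreal exp_sum)
    also have "(\<Sum>r\<in>{1..p}. (\<mu> / real n * S * v r)\<^sup>2 / 2) = (\<mu> / real n * S)\<^sup>2 * (\<Sum>r\<in>{1..p}. (v r)\<^sup>2) / 2"
      by (simp only: power_mult_distrib[of _ "v _"] sum_distrib_left sum_divide_distrib)
    finally have "(\<integral>\<^sup>+Z. truncated_likelihood \<sigma> Z * (small v * ?l \<rho> v Z) \<partial>noise_law n p)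
       \<le> small v * ennreal (exp ((\<mu> / real n * S)\<^sup>2 * (\<Sum>r\<in>{1..p}. (v r)\<^sup>2) / 2))"
      unfolding eq by (intro mult_left_mono) simp_all
    also have "\<dots> \<le> ?K"
    proof (cases "(\<Sum>r\<in>{1..p}. (v r)\<^sup>2) \<le> \<tau>")
      case True
      then have "(\<mu> / real n * S)\<^sup>2 * (\<Sum>r\<in>{1..p}. (v r)\<^sup>2) / 2 \<le> (\<mu> / real n * S)\<^sup>2 * \<tau> / 2"
        by (intro divide_right_mono mult_left_mono) auto
      then show ?thesis using True by (simp add: small_def ennreal_leI del: times_divide_eq_left)
    next
      case False
      then show ?thesis by (simp add: small_def)
    qed
    finally show "(\<integral>\<^sup>+Z. truncated_likelihood \<sigma> Z * (small v * ?l \<rho> v Z) \<partial>noise_law n p) \<le> ?K" .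
  qed
  also have "\<dots> = ?K" using U.emeasure_space_1 by simp
  finally show ?thesis .
qed

end

lemma std_gaussian_norm_tail:
  assumes \<epsilon>: "\<epsilon> > 0"
  shows "emeasure (std_gaussian p) {u \<in> space (std_gaussian p). \<not> (\<Sum>r\<in>{1..p}. (u r)\<^sup>2) \<le> (1 + \<epsilon>) * real p}
    \<le> ennreal (sqrt ((1 + \<epsilon>) * exp (- \<epsilon>)) ^ p)"
proof -
  \<comment> \<open>The tilt that minimizes Chernoff's exponent. It turns
    \<open>exp (- t * (1 + \<epsilon>) / 2) / sqrt (1 - t)\<close>, the bound per coordinate, into
    \<open>sqrt ((1 + \<epsilon>) * exp (- \<epsilon>))\<close>.\<close>
  define t where "t = \<epsilon> / (1 + \<epsilon>)"
  have t: "0 < t" "t < 1" "1 - t = 1 / (1 + \<epsilon>)" "t * (1 + \<epsilon>) = \<epsilon>"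
    using \<epsilon> by (auto simp: t_def field_simps)
  let ?A = "{u \<in> space (std_gaussian p). \<not> (\<Sum>r\<in>{1..p}. (u r)\<^sup>2) \<le> (1 + \<epsilon>) * real p}"
  have A: "?A \<in> sets (std_gaussian p)" by measurable
  have "emeasure (std_gaussian p) ?A = (\<integral>\<^sup>+u. indicator ?A u \<partial>std_gaussian p)"
    using A by simp
  also have "\<dots> \<le> (\<integral>\<^sup>+u. (\<Prod>r\<in>{1..p}. ennreal (exp (- \<epsilon> / 2)) * ennreal (exp (t * (u r)\<^sup>2 / 2))) \<partial>std_gaussian p)"
  proof (rule nn_integral_mono)
    fix u
    have "(\<Prod>r\<in>{1..p}. ennreal (exp (- \<epsilon> / 2)) * ennreal (exp (t * (u r)\<^sup>2 / 2)))
       = ennreal (\<Prod>r\<in>{1..p}. exp (- \<epsilon> / 2 + t * (u r)\<^sup>2 / 2))"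
      by (simp add: ennreal_mult[symmetric] exp_add[symmetric] prod_ennreal)
    also have "(\<Prod>r\<in>{1..p}. exp (- \<epsilon> / 2 + t * (u r)\<^sup>2 / 2)) = exp (\<Sum>r\<in>{1..p}. - \<epsilon> / 2 + t * (u r)\<^sup>2 / 2)"
      by (simp add: exp_sum)
    also have "(\<Sum>r\<in>{1..p}. - \<epsilon> / 2 + t * (u r)\<^sup>2 / 2) = t / 2 * ((\<Sum>r\<in>{1..p}. (u r)\<^sup>2) - (1 + \<epsilon>) * real p)"
    proof -
      have "(\<Sum>r\<in>{1..p}. - \<epsilon> / 2 + t * (u r)\<^sup>2 / 2) = real p * (- (t * (1 + \<epsilon>)) / 2) + t / 2 * (\<Sum>r\<in>{1..p}. (u r)\<^sup>2)"
        unfolding sum.distrib t(4) by (simp add: sum_distrib_left)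
      also have "\<dots> = t / 2 * ((\<Sum>r\<in>{1..p}. (u r)\<^sup>2) - (1 + \<epsilon>) * real p)"
        by (simp add: field_simps)
      finally show ?thesis .
    qed
    finally have eq: "(\<Prod>r\<in>{1..p}. ennreal (exp (- \<epsilon> / 2)) * ennreal (exp (t * (u r)\<^sup>2 / 2)))
       = ennreal (exp (t / 2 * ((\<Sum>r\<in>{1..p}. (u r)\<^sup>2) - (1 + \<epsilon>) * real p)))" .
    show "indicator ?A u \<le> (\<Prod>r\<in>{1..p}. ennreal (exp (- \<epsilon> / 2)) * ennreal (exp (t * (u r)\<^sup>2 / 2)))"
    proof (cases "u \<in> ?A")
      case True
      then have "1 \<le> exp (t / 2 * ((\<Sum>r\<in>{1..p}. (u r)\<^sup>2) - (1 + \<epsilon>) * real p))" using t by simp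
      then show ?thesis unfolding eq using True by (simp add: ennreal_ge_1)
    qed simp
  qed
  also have "\<dots> = (\<Prod>r\<in>{1..p}. \<integral>\<^sup>+x. ennreal (exp (- \<epsilon> / 2)) * ennreal (exp (t * x\<^sup>2 / 2)) \<partial>gauss)"
    by (rule nn_integral_std_gaussian_prod) measurable
  also have "\<dots> = (\<Prod>r\<in>{1..p}. ennreal (sqrt ((1 + \<epsilon>) * exp (- \<epsilon>))))"
  proof (rule prod.cong[OF refl])
    have "(\<integral>\<^sup>+x. ennreal (exp (- \<epsilon> / 2)) * ennreal (exp (t * x\<^sup>2 / 2)) \<partial>gauss) = ennreal (exp (- \<epsilon> / 2)) * ennreal (1 / sqrt (1 - t))"
      by (subst nn_integral_cmult) (auto simp: nn_integral_gauss_exp_square t)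
    also have "\<dots> = ennreal (exp (- \<epsilon> / 2) * sqrt (1 + \<epsilon>))"
      unfolding t(3) using \<epsilon> by (simp add: ennreal_mult[symmetric] real_sqrt_divide)
    also have "exp (- \<epsilon> / 2) * sqrt (1 + \<epsilon>) = sqrt ((1 + \<epsilon>) * exp (- \<epsilon>))"
    proof -
      have "exp (- \<epsilon> / 2) = sqrt (exp (- \<epsilon>))"
        by (rule real_sqrt_unique[symmetric]) (auto simp: power2_eq_square exp_add[symmetric])
      then show ?thesis by (simp add: real_sqrt_mult)
    qed
    finally show "(\<integral>\<^sup>+x. ennreal (exp (- \<epsilon> / 2)) * ennreal (exp (t * x\<^sup>2 / 2)) \<partial>gauss) = ennreal (sqrt ((1 + \<epsilon>) * exp (- \<epsilon>)))" .
  qed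
  also have "\<dots> = ennreal (sqrt ((1 + \<epsilon>) * exp (- \<epsilon>)) ^ p)"
    using \<epsilon> by (simp add: ennreal_power)
  finally show ?thesis .
qed

section \<open>The truncated likelihood ratio averaged over the labels\<close>

context truncated
begin

definition mixture :: "(nat \<Rightarrow> nat \<times> nat \<Rightarrow> bool) \<Rightarrow> (nat \<Rightarrow> nat \<Rightarrow> real) \<Rightarrow> ennreal" where
  "mixture G Z = (\<integral>\<^sup>+\<sigma>. ennreal (graph_ratio \<sigma> G) * truncated_likelihood \<sigma> Z \<partial>measure_pmf (labels_pmf n))"

text \<open>The coefficient of \<open>S^2 / (2 * n)\<close> in the joint exponent of graphs and
  features. For \<open>\<tau> = (1 + \<epsilon>) * p\<close> its feature part tends to
  \<open>(1 + \<epsilon>) * \<mu>^2 / \<gamma>\<close>.\<close>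

definition rate :: real where
  "rate = (\<Sum>t\<in>{1..m}. (l t)\<^sup>2 * real n / (real n - d t)) + \<mu>\<^sup>2 * \<tau> / real n"

lemma rate_nonneg: "rate \<ge> 0"
  unfolding rate_def using d_less \<tau> by (intro add_nonneg_nonneg sum_nonneg) (auto simp: less_imp_le)

lemma measurable_mixture [measurable]: "mixture G \<in> borel_measurable (noise_law n p)"
  unfolding mixture_def[abs_def] by (simp add: nn_integral_measure_pmf_finite finite_set_labels)

text \<open>Squaring the average over labels introduces a second, independent labelling
  \<open>\<rho>\<close>. With the label averages moved outside, graphs and noise integrate to the
  two overlap bounds, and the average over \<open>\<sigma>\<close> for fixed \<open>\<rho>\<close>
  is \<open>nn_integral_overlap_le\<close>.\<close>

lemma mixture_second_moment:
  assumes "rate < 1"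
  shows "(\<integral>\<^sup>+G. \<integral>\<^sup>+Z. (mixture G Z)\<^sup>2 \<partial>noise_law n p \<partial>measure_pmf (null_graphs m n d)) \<le> ennreal (1 / sqrt (1 - rate))"
proof -
  let ?L = "measure_pmf (labels_pmf n)" and ?N = "measure_pmf (null_graphs m n d)"
  let ?r = "\<lambda>\<sigma> \<rho> G. ennreal (graph_ratio \<sigma> G) * ennreal (graph_ratio \<rho> G)"
  let ?t = "\<lambda>\<sigma> \<rho> Z. truncated_likelihood \<sigma> Z * truncated_likelihood \<rho> Z"
  have sq: "(mixture G Z)\<^sup>2 = (\<integral>\<^sup>+\<rho>. \<integral>\<^sup>+\<sigma>. ?r \<sigma> \<rho> G * ?t \<sigma> \<rho> Z \<partial>?L \<partial>?L)" for G Z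
  proof -
    have "(mixture G Z)\<^sup>2 = (\<integral>\<^sup>+\<rho>. mixture G Z * (ennreal (graph_ratio \<rho> G) * truncated_likelihood \<rho> Z) \<partial>?L)"
      unfolding power2_eq_square by (subst (2) mixture_def) (simp add: nn_integral_cmult)
    also have "\<dots> = (\<integral>\<^sup>+\<rho>. \<integral>\<^sup>+\<sigma>. ?r \<sigma> \<rho> G * ?t \<sigma> \<rho> Z \<partial>?L \<partial>?L)"
    proof (rule nn_integral_cong)
      fix \<rho>
      have "mixture G Z * (ennreal (graph_ratio \<rho> G) * truncated_likelihood \<rho> Z)
         = (\<integral>\<^sup>+\<sigma>. ennreal (graph_ratio \<sigma> G) * truncated_likelihood \<sigma> Z * (ennreal (graph_ratio \<rho> G) * truncated_likelihood \<rho> Z) \<partial>?L)"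
        unfolding mixture_def by (rule nn_integral_multc[symmetric]) simp
      then show "mixture G Z * (ennreal (graph_ratio \<rho> G) * truncated_likelihood \<rho> Z) = (\<integral>\<^sup>+\<sigma>. ?r \<sigma> \<rho> G * ?t \<sigma> \<rho> Z \<partial>?L)"
        by (simp only: mult_ac)
    qed
    finally show ?thesis .
  qed
  have "(\<integral>\<^sup>+G. \<integral>\<^sup>+Z. (mixture G Z)\<^sup>2 \<partial>noise_law n p \<partial>?N)
     = (\<integral>\<^sup>+G. \<integral>\<^sup>+\<rho>. \<integral>\<^sup>+\<sigma>. ?r \<sigma> \<rho> G * (\<integral>\<^sup>+Z. ?t \<sigma> \<rho> Z \<partial>noise_law n p) \<partial>?L \<partial>?L \<partial>?N)"
  proof (rule nn_integral_cong)
    fix G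
    have "(\<integral>\<^sup>+Z. (mixture G Z)\<^sup>2 \<partial>noise_law n p) = (\<integral>\<^sup>+\<rho>. \<integral>\<^sup>+Z. \<integral>\<^sup>+\<sigma>. ?r \<sigma> \<rho> G * ?t \<sigma> \<rho> Z \<partial>?L \<partial>noise_law n p \<partial>?L)"
      unfolding sq
    proof (rule nn_integral_pmf_swap[symmetric, OF finite_set_labels])
      show "(\<lambda>Z. \<integral>\<^sup>+\<sigma>. ?r \<sigma> \<rho> G * ?t \<sigma> \<rho> Z \<partial>?L) \<in> borel_measurable (noise_law n p)" for \<rho>
        by (simp add: nn_integral_measure_pmf_finite finite_set_labels)
    qed
    also have "\<dots> = (\<integral>\<^sup>+\<rho>. \<integral>\<^sup>+\<sigma>. \<integral>\<^sup>+Z. ?r \<sigma> \<rho> G * ?t \<sigma> \<rho> Z \<partial>noise_law n p \<partial>?L \<partial>?L)"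
      by (rule nn_integral_cong, rule nn_integral_pmf_swap[symmetric, OF finite_set_labels]) measurable
    also have "\<dots> = (\<integral>\<^sup>+\<rho>. \<integral>\<^sup>+\<sigma>. ?r \<sigma> \<rho> G * (\<integral>\<^sup>+Z. ?t \<sigma> \<rho> Z \<partial>noise_law n p) \<partial>?L \<partial>?L)"
      by (rule nn_integral_cong, rule nn_integral_cong, rule nn_integral_cmult) measurable
    finally show "(\<integral>\<^sup>+Z. (mixture G Z)\<^sup>2 \<partial>noise_law n p)
      = (\<integral>\<^sup>+\<rho>. \<integral>\<^sup>+\<sigma>. ?r \<sigma> \<rho> G * (\<integral>\<^sup>+Z. ?t \<sigma> \<rho> Z \<partial>noise_law n p) \<partial>?L \<partial>?L)" .
  qed
  also have "\<dots> = (\<integral>\<^sup>+\<rho>. \<integral>\<^sup>+G. \<integral>\<^sup>+\<sigma>. ?r \<sigma> \<rho> G * (\<integral>\<^sup>+Z. ?t \<sigma> \<rho> Z \<partial>noise_law n p) \<partial>?L \<partial>?N \<partial>?L)"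
    by (rule nn_integral_pmf_swap[symmetric, OF finite_set_labels]) simp
  also have "\<dots> = (\<integral>\<^sup>+\<rho>. \<integral>\<^sup>+\<sigma>. \<integral>\<^sup>+G. ?r \<sigma> \<rho> G * (\<integral>\<^sup>+Z. ?t \<sigma> \<rho> Z \<partial>noise_law n p) \<partial>?N \<partial>?L \<partial>?L)"
    by (rule nn_integral_cong, rule nn_integral_pmf_swap[symmetric, OF finite_set_labels]) simp
  also have "\<dots> = (\<integral>\<^sup>+\<rho>. \<integral>\<^sup>+\<sigma>. (\<integral>\<^sup>+G. ?r \<sigma> \<rho> G \<partial>?N) * (\<integral>\<^sup>+Z. ?t \<sigma> \<rho> Z \<partial>noise_law n p) \<partial>?L \<partial>?L)"
    by (rule nn_integral_cong, rule nn_integral_cong, rule nn_integral_multc) simp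
  also have "\<dots> \<le> (\<integral>\<^sup>+\<rho>. \<integral>\<^sup>+\<sigma>. ennreal (exp (rate * (\<Sum>i\<in>{1..n}. \<sigma> i * \<rho> i)\<^sup>2 / (2 * real n))) \<partial>?L \<partial>?L)"
  proof (rule nn_integral_mono_AE, rule AE_pmfI, rule nn_integral_mono_AE, rule AE_pmfI)
    fix \<rho> \<sigma> assume "\<rho> \<in> set_pmf (labels_pmf n)" "\<sigma> \<in> set_pmf (labels_pmf n)"
    then have \<rho>: "\<rho> \<in> signs" and \<sigma>: "\<sigma> \<in> signs" by (auto simp: set_labels)
    let ?S = "\<Sum>i\<in>{1..n}. \<sigma> i * \<rho> i"
    have "(\<integral>\<^sup>+G. ?r \<sigma> \<rho> G \<partial>?N) * (\<integral>\<^sup>+Z. ?t \<sigma> \<rho> Z \<partial>noise_law n p)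
      \<le> ennreal (exp ((\<Sum>t\<in>{1..m}. layer_coupling t) * ?S\<^sup>2 / 2)) * ennreal (exp ((\<mu> / real n * ?S)\<^sup>2 * \<tau> / 2))"
      by (intro mult_mono graph_overlap truncated_overlap \<sigma> \<rho>) auto
    also have "\<dots> = ennreal (exp (rate * ?S\<^sup>2 / (2 * real n)))"
    proof -
      have "(\<Sum>t\<in>{1..m}. layer_coupling t) = (\<Sum>t\<in>{1..m}. (l t)\<^sup>2 * real n / (real n - d t)) / real n"
        using n by (simp add: layer_coupling_def sum_divide_distrib)
      then have "(\<Sum>t\<in>{1..m}. layer_coupling t) * ?S\<^sup>2 / 2 + (\<mu> / real n * ?S)\<^sup>2 * \<tau> / 2 = rate * ?S\<^sup>2 / (2 * real n)"
        unfolding rate_def using n by (simp add: field_simps power2_eq_square)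
      then show ?thesis by (simp add: ennreal_mult[symmetric] exp_add[symmetric])
    qed
    finally show "(\<integral>\<^sup>+G. ?r \<sigma> \<rho> G \<partial>?N) * (\<integral>\<^sup>+Z. ?t \<sigma> \<rho> Z \<partial>noise_law n p)
      \<le> ennreal (exp (rate * ?S\<^sup>2 / (2 * real n)))" .
  qed
  also have "\<dots> \<le> (\<integral>\<^sup>+\<rho>. ennreal (1 / sqrt (1 - rate)) \<partial>?L)"
    by (rule nn_integral_mono_AE, rule AE_pmfI, rule nn_integral_overlap_le[OF rate_nonneg assms n]) (simp add: set_labels)
  also have "\<dots> = ennreal (1 / sqrt (1 - rate))" by simp
  finally show ?thesis .
qed

definition tail :: ennreal where
  "tail = emeasure (std_gaussian p) {u \<in> space (std_gaussian p). \<not> (\<Sum>r\<in>{1..p}. (u r)\<^sup>2) \<le> \<tau>}"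

text \<open>Where \<open>u\<close> is too long, the indicator of \<open>E\<close> is bounded by 1
  and the likelihood integrates to 1, so this part costs at most the probability
  \<open>tail\<close>. Elsewhere the truncation changes nothing.\<close>

lemma law_le_mixture:
  assumes E [measurable]: "E \<in> sets (obs_space m n p)"
  shows "emeasure (csbm_law m n p d l \<mu>) E
    \<le> (\<integral>\<^sup>+G. \<integral>\<^sup>+Z. indicator E (graph_obs m n G, Z) * mixture G Z \<partial>noise_law n p \<partial>measure_pmf (null_graphs m n d)) + tail"
proof -
  interpret U: prob_space "std_gaussian p" by (rule prob_space_std_gaussian)
  interpret Z: prob_space "noise_law n p" by (rule prob_space_noise_law)
  interpret P: pair_sigma_finite "std_gaussian p" "noise_law n p" ..
  let ?L = "measure_pmf (labels_pmf n)" and ?N = "measure_pmf (null_graphs m n d)"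
  let ?I = "\<lambda>G Z. indicator E (graph_obs m n G, Z) :: ennreal" and ?l = "likelihood n p \<mu>"
  have mI [measurable]: "?I G \<in> borel_measurable (noise_law n p)" for G by measurable
  have inner: "(\<integral>\<^sup>+u. \<integral>\<^sup>+Z. ?l \<sigma> u Z * ?I G Z \<partial>noise_law n p \<partial>std_gaussian p)
     \<le> (\<integral>\<^sup>+Z. ?I G Z * truncated_likelihood \<sigma> Z \<partial>noise_law n p) + tail" for \<sigma> G
  proof -
    let ?B = "{u \<in> space (std_gaussian p). \<not> (\<Sum>r\<in>{1..p}. (u r)\<^sup>2) \<le> \<tau>}"
    have B: "?B \<in> sets (std_gaussian p)" by measurable
    have "(\<integral>\<^sup>+u. \<integral>\<^sup>+Z. ?l \<sigma> u Z * ?I G Z \<partial>noise_law n p \<partial>std_gaussian p)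
      \<le> (\<integral>\<^sup>+u. (\<integral>\<^sup>+Z. ?I G Z * (small u * ?l \<sigma> u Z) \<partial>noise_law n p) + indicator ?B u \<partial>std_gaussian p)"
    proof (rule nn_integral_mono)
      fix u assume u: "u \<in> space (std_gaussian p)"
      show "(\<integral>\<^sup>+Z. ?l \<sigma> u Z * ?I G Z \<partial>noise_law n p) \<le> (\<integral>\<^sup>+Z. ?I G Z * (small u * ?l \<sigma> u Z) \<partial>noise_law n p) + indicator ?B u"
      proof (cases "u \<in> ?B")
        case True
        have "(\<integral>\<^sup>+Z. ?l \<sigma> u Z * ?I G Z \<partial>noise_law n p) \<le> (\<integral>\<^sup>+Z. ?l \<sigma> u Z \<partial>noise_law n p)"
          by (rule nn_integral_mono) (simp add: indicator_def)
        also have "\<dots> = indicator ?B u" using True by (simp add: nn_integral_likelihood)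
        finally show ?thesis by (rule order_trans) simp
      next
        case False
        then have s: "small u = 1" using u by (simp add: small_def)
        show ?thesis unfolding s by (simp add: mult.commute)
      qed
    qed
    also have "\<dots> = (\<integral>\<^sup>+u. \<integral>\<^sup>+Z. ?I G Z * (small u * ?l \<sigma> u Z) \<partial>noise_law n p \<partial>std_gaussian p) + tail"
      unfolding tail_def nn_integral_indicator[OF B, symmetric]
      by (rule nn_integral_add[OF _ borel_measurable_indicator[OF B]]) measurable
    also have "(\<integral>\<^sup>+u. \<integral>\<^sup>+Z. ?I G Z * (small u * ?l \<sigma> u Z) \<partial>noise_law n p \<partial>std_gaussian p)
       = (\<integral>\<^sup>+Z. \<integral>\<^sup>+u. ?I G Z * (small u * ?l \<sigma> u Z) \<partial>std_gaussian p \<partial>noise_law n p)"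
      by (rule P.Fubini'[symmetric]) measurable
    also have "\<dots> = (\<integral>\<^sup>+Z. ?I G Z * truncated_likelihood \<sigma> Z \<partial>noise_law n p)"
      unfolding truncated_likelihood_def by (rule nn_integral_cong, rule nn_integral_cmult) measurable
    finally show ?thesis .
  qed
  have "emeasure (csbm_law m n p d l \<mu>) E
    \<le> (\<integral>\<^sup>+\<sigma>. \<integral>\<^sup>+G. (\<integral>\<^sup>+Z. ?I G Z * truncated_likelihood \<sigma> Z \<partial>noise_law n p) + tail \<partial>measure_pmf (multilayer_sbm_pmf m n d l \<sigma>) \<partial>?L)"
    unfolding emeasure_csbm_law[OF E] by (rule nn_integral_mono, rule nn_integral_mono, rule inner)
  also have "\<dots> = (\<integral>\<^sup>+\<sigma>. \<integral>\<^sup>+G. (\<integral>\<^sup>+Z. ?I G Z * truncated_likelihood \<sigma> Z \<partial>noise_law n p) \<partial>measure_pmf (multilayer_sbm_pmf m n d l \<sigma>) \<partial>?L) + tail"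
    by (simp add: nn_integral_add)
  also have "(\<integral>\<^sup>+\<sigma>. \<integral>\<^sup>+G. (\<integral>\<^sup>+Z. ?I G Z * truncated_likelihood \<sigma> Z \<partial>noise_law n p) \<partial>measure_pmf (multilayer_sbm_pmf m n d l \<sigma>) \<partial>?L)
     = (\<integral>\<^sup>+\<sigma>. \<integral>\<^sup>+G. ennreal (graph_ratio \<sigma> G) * (\<integral>\<^sup>+Z. ?I G Z * truncated_likelihood \<sigma> Z \<partial>noise_law n p) \<partial>?N \<partial>?L)"
    unfolding nn_integral_graphs ..
  also have "\<dots> = (\<integral>\<^sup>+G. \<integral>\<^sup>+\<sigma>. ennreal (graph_ratio \<sigma> G) * (\<integral>\<^sup>+Z. ?I G Z * truncated_likelihood \<sigma> Z \<partial>noise_law n p) \<partial>?L \<partial>?N)"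
    by (rule nn_integral_pmf_swap[OF finite_set_labels]) simp
  also have "\<dots> = (\<integral>\<^sup>+G. \<integral>\<^sup>+Z. ?I G Z * mixture G Z \<partial>noise_law n p \<partial>?N)"
  proof (rule nn_integral_cong)
    fix G
    have "(\<integral>\<^sup>+\<sigma>. ennreal (graph_ratio \<sigma> G) * (\<integral>\<^sup>+Z. ?I G Z * truncated_likelihood \<sigma> Z \<partial>noise_law n p) \<partial>?L)
       = (\<integral>\<^sup>+\<sigma>. \<integral>\<^sup>+Z. ennreal (graph_ratio \<sigma> G) * (?I G Z * truncated_likelihood \<sigma> Z) \<partial>noise_law n p \<partial>?L)"
      by (rule nn_integral_cong, rule nn_integral_cmult[symmetric]) measurable
    also have "\<dots> = (\<integral>\<^sup>+Z. \<integral>\<^sup>+\<sigma>. ennreal (graph_ratio \<sigma> G) * (?I G Z * truncated_likelihood \<sigma> Z) \<partial>?L \<partial>noise_law n p)"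
      by (rule nn_integral_pmf_swap[OF finite_set_labels]) measurable
    also have "\<dots> = (\<integral>\<^sup>+Z. \<integral>\<^sup>+\<sigma>. ?I G Z * (ennreal (graph_ratio \<sigma> G) * truncated_likelihood \<sigma> Z) \<partial>?L \<partial>noise_law n p)"
      by (simp only: mult_ac)
    also have "\<dots> = (\<integral>\<^sup>+Z. ?I G Z * mixture G Z \<partial>noise_law n p)"
      unfolding mixture_def by (rule nn_integral_cong, rule nn_integral_cmult) simp
    finally show "(\<integral>\<^sup>+\<sigma>. ennreal (graph_ratio \<sigma> G) * (\<integral>\<^sup>+Z. ?I G Z * truncated_likelihood \<sigma> Z \<partial>noise_law n p) \<partial>?L)
      = (\<integral>\<^sup>+Z. ?I G Z * mixture G Z \<partial>noise_law n p)" .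
  qed
  finally show ?thesis .
qed

text \<open>Young's inequality for \<open>mixture\<close> on \<open>E\<close>: the first term
  integrates to the null probability, the second is controlled by the second moment. A bound on
  \<open>rate\<close> away from 1, uniform in \<open>n\<close>, together with a vanishing
  \<open>tail\<close> then gives contiguity.\<close>

lemma law_le_null:
  assumes E [measurable]: "E \<in> sets (obs_space m n p)" and K: "K > 0" and rate: "rate < 1"
  shows "emeasure (csbm_law m n p d l \<mu>) E
    \<le> ennreal (K / 2) * emeasure (csbm_law m n p d (\<lambda>_. 0) 0) E + ennreal (1 / (2 * K)) * ennreal (1 / sqrt (1 - rate)) + tail"
proof -
  let ?N = "measure_pmf (null_graphs m n d)"
  let ?I = "\<lambda>G Z. indicator E (graph_obs m n G, Z) :: ennreal"
  have [measurable]: "?I G \<in> borel_measurable (noise_law n p)" for G by measurable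
  have "(\<integral>\<^sup>+G. \<integral>\<^sup>+Z. ?I G Z * mixture G Z \<partial>noise_law n p \<partial>?N)
     \<le> (\<integral>\<^sup>+G. \<integral>\<^sup>+Z. ennreal (K / 2) * ?I G Z + ennreal (1 / (2 * K)) * (mixture G Z)\<^sup>2 \<partial>noise_law n p \<partial>?N)"
    by (rule nn_integral_mono, rule nn_integral_mono) (use ennreal_young[OF K] in \<open>auto simp: indicator_def\<close>)
  also have "\<dots> = ennreal (K / 2) * (\<integral>\<^sup>+G. \<integral>\<^sup>+Z. ?I G Z \<partial>noise_law n p \<partial>?N)
      + ennreal (1 / (2 * K)) * (\<integral>\<^sup>+G. \<integral>\<^sup>+Z. (mixture G Z)\<^sup>2 \<partial>noise_law n p \<partial>?N)"
    by (simp add: nn_integral_add nn_integral_cmult)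
  also have "\<dots> \<le> ennreal (K / 2) * emeasure (csbm_law m n p d (\<lambda>_. 0) 0) E + ennreal (1 / (2 * K)) * ennreal (1 / sqrt (1 - rate))"
    unfolding emeasure_null_law[OF E] by (intro add_left_mono mult_left_mono mixture_second_moment rate) simp
  finally show ?thesis using law_le_mixture[OF E] by (meson add_right_mono order_trans)
qed

end

section \<open>Contiguity below the threshold\<close>

lemma csbm_contiguous:
  fixes d l :: "nat \<Rightarrow> real" and p :: "nat \<Rightarrow> nat"
  assumes d: "\<And>k. k \<in> {1..m} \<Longrightarrow> d k > 1" and l: "\<And>k. k \<in> {1..m} \<Longrightarrow> l k \<ge> 0"
    and \<mu>: "\<mu> \<ge> 0" and b: "\<And>k. k \<in> {1..m} \<Longrightarrow> b_par (d k) (l k) \<ge> 0"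
    and \<gamma>: "\<gamma> > 0" and lim: "(\<lambda>n. real n / real (p n)) \<longlonglongrightarrow> \<gamma>"
    and snr: "(\<Sum>k=1..m. (l k)\<^sup>2) + \<mu>\<^sup>2 / \<gamma> < 1"
  shows "contiguous (\<lambda>n. csbm_law m n (p n) d l \<mu>) (\<lambda>n. csbm_law m n (p n) d (\<lambda>_. 0) 0)"
  unfolding contiguous_def
proof (intro allI impI)
  let ?Q = "\<lambda>n. csbm_law m n (p n) d l \<mu>" and ?P = "\<lambda>n. csbm_law m n (p n) d (\<lambda>_. 0) 0"
  fix E assume E: "\<forall>n. E n \<in> sets (?P n)" and PE: "(\<lambda>n. measure (?P n) (E n)) \<longlonglongrightarrow> 0"
  define \<eta> where "\<eta> = \<mu>\<^sup>2 / \<gamma>"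
  define s where "s = (\<Sum>k=1..m. (l k)\<^sup>2) + \<eta>"
  have \<eta>: "\<eta> \<ge> 0" using \<gamma> by (simp add: \<eta>_def)
  have s: "s < 1" using snr by (simp add: s_def \<eta>_def)
  \<comment> \<open>Makes \<open>\<epsilon> * \<eta> \<le> (1 - s) / 2\<close>: truncation raises
    the limiting rate from \<open>s\<close> to \<open>s + \<epsilon> * \<eta>\<close>, still below
    1. The summand 1 in the denominator covers \<open>\<mu> = 0\<close>.\<close>
  define \<epsilon> where "\<epsilon> = (1 - s) / (2 * (\<eta> + 1))"
  have \<epsilon>: "\<epsilon> > 0" using s \<eta> by (simp add: \<epsilon>_def)
  have "\<epsilon> * \<eta> \<le> \<epsilon> * (\<eta> + 1)" using \<epsilon> by simp
  also have "\<dots> = (1 - s) / 2"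
    unfolding \<epsilon>_def times_divide_eq_left
    by (rule nonzero_mult_divide_mult_cancel_right) (use \<eta> in linarith)
  finally have le: "\<epsilon> * \<eta> \<le> (1 - s) / 2" .
  have "s + x < 1" if "x \<le> (1 - s) / 2" for x using that s by (simp add: field_simps)
  from this[OF le] have s\<epsilon>: "s + \<epsilon> * \<eta> < 1" .
  define \<theta> where "\<theta> = (1 + (s + \<epsilon> * \<eta>)) / 2"
  have "x < (1 + x) / 2 \<and> (1 + x) / 2 < 1" if "x < 1" for x :: real using that by simp
  from this[OF s\<epsilon>] have \<theta>: "s + \<epsilon> * \<eta> < \<theta>" "\<theta> < 1" unfolding \<theta>_def by blast+
  define C where "C = 1 / sqrt (1 - \<theta>)"
  have C: "C > 0" using \<theta> by (simp add: C_def)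
  \<comment> \<open>The base of the tail bound per coordinate, less than 1 because
    \<open>ln (1 + \<epsilon>) < \<epsilon>\<close>.\<close>
  define q where "q = sqrt ((1 + \<epsilon>) * exp (- \<epsilon>))"
  have q: "0 \<le> q" "q < 1"
  proof -
    have "exp (ln (1 + \<epsilon>)) < exp \<epsilon>" using ln_add_one_self_less_self[OF \<epsilon>] by simp
    then have "1 + \<epsilon> < exp \<epsilon>" using \<epsilon> by (subst (asm) exp_ln) simp_all
    then have "(1 + \<epsilon>) * exp (- \<epsilon>) < exp \<epsilon> * exp (- \<epsilon>)" by (rule mult_strict_right_mono) simp
    then show "0 \<le> q" "q < 1" using \<epsilon> by (simp_all add: q_def exp_add[symmetric])
  qed
  have pn: "(\<lambda>n. real (p n) / real n) \<longlonglongrightarrow> 1 / \<gamma>" by (rule tendsto_p_over_n[OF \<gamma> lim])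
  \<comment> \<open>The tail bound \<open>q ^ p\<close> vanishes as \<open>p\<close> grows, and
    \<open>p\<close> grows because \<open>p / n\<close> has a positive limit.\<close>
  have "filterlim p at_top sequentially"
    unfolding filterlim_at_top
  proof
    fix Z
    have "\<forall>\<^sub>F n in sequentially. real (p n) / real n > 1 / (2 * \<gamma>)"
      by (rule order_tendstoD(1)[OF pn]) (use \<gamma> in \<open>simp add: field_simps\<close>)
    moreover have "\<forall>\<^sub>F n in sequentially. real n \<ge> 2 * \<gamma> * real Z"
      using filterlim_real_sequentially by (simp add: filterlim_at_top)
    ultimately show "\<forall>\<^sub>F n in sequentially. Z \<le> p n"
      using eventually_gt_at_top[of 0]
    proof eventually_elim
      case (elim n)
      have "2 * \<gamma> * real Z \<le> real n" using elim by simp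
      also have "real n < 2 * \<gamma> * real (p n)" using elim \<gamma> by (simp add: field_simps)
      finally show ?case using \<gamma> by simp
    qed
  qed
  then have qlim: "(\<lambda>n. q ^ p n) \<longlonglongrightarrow> 0"
    using filterlim_compose[OF LIMSEQ_power_zero[of q]] q by simp
  have "(\<lambda>n. (\<Sum>t\<in>{1..m}. (l t)\<^sup>2 * (1 / (1 - d t / real n))) + \<mu>\<^sup>2 * (1 + \<epsilon>) * (real (p n) / real n))
     \<longlonglongrightarrow> (\<Sum>t\<in>{1..m}. (l t)\<^sup>2 * (1 / (1 - 0))) + \<mu>\<^sup>2 * (1 + \<epsilon>) * (1 / \<gamma>)"
    by (intro tendsto_intros lim_const_over_n pn) simp
  also have "(\<Sum>t\<in>{1..m}. (l t)\<^sup>2 * (1 / (1 - 0))) + \<mu>\<^sup>2 * (1 + \<epsilon>) * (1 / \<gamma>) = s + \<epsilon> * \<eta>"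
    by (simp add: s_def \<eta>_def algebra_simps)
  finally have rate_ev: "\<forall>\<^sub>F n in sequentially.
      (\<Sum>t\<in>{1..m}. (l t)\<^sup>2 * (1 / (1 - d t / real n))) + \<mu>\<^sup>2 * (1 + \<epsilon>) * (real (p n) / real n) < \<theta>"
    using \<theta>(1) by (rule order_tendstoD(2))
  have big: "\<forall>\<^sub>F n in sequentially. \<forall>t\<in>{1..m}. real n \<ge> a_par (d t) (l t) \<and> real n > d t"
  proof (rule eventually_ball_finite, simp, rule ballI)
    fix t
    show "\<forall>\<^sub>F n in sequentially. real n \<ge> a_par (d t) (l t) \<and> real n > d t"
      by (intro eventually_conj filterlim_at_top[THEN iffD1, rule_format]
          filterlim_at_top_dense[THEN iffD1, rule_format] filterlim_real_sequentially)
  qed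
  show "(\<lambda>n. measure (?Q n) (E n)) \<longlonglongrightarrow> 0"
  proof (rule LIMSEQ_I)
    fix r :: real assume r: "r > 0"
    \<comment> \<open>Splits the error into quarters of \<open>r\<close>: this \<open>K\<close>
      makes the second moment term \<open>r / 4\<close>, a null probability below
      \<open>r / (2 * K)\<close> keeps the first term within \<open>r / 4\<close>, and the tail
      takes another quarter.\<close>
    define K where "K = 2 * C / r"
    have K: "K > 0" "1 / (2 * K) * C = r / 4" using r C by (auto simp: K_def)
    have e1: "\<forall>\<^sub>F n in sequentially. measure (?P n) (E n) < r / (2 * K)"
      using r K by (intro order_tendstoD(2)[OF PE]) auto
    have e2: "\<forall>\<^sub>F n in sequentially. q ^ p n < r / 4"
      using r by (intro order_tendstoD(2)[OF qlim]) auto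
    have "\<forall>\<^sub>F n in sequentially. norm (measure (?Q n) (E n) - 0) < r"
      using e1 e2 rate_ev big eventually_gt_at_top[of 0]
    proof eventually_elim
      case (elim n)
      interpret Q: prob_space "?Q n" by (rule prob_space_csbm_law)
      interpret P: prob_space "?P n" by (rule prob_space_csbm_law)
      interpret truncated m n "p n" d l \<mu> "(1 + \<epsilon>) * real (p n)"
        by unfold_locales (use elim d l b \<mu> \<epsilon> in \<open>auto simp: less_trans[OF zero_less_one]\<close>)
      have "(l t)\<^sup>2 * real n / (real n - d t) = (l t)\<^sup>2 * (1 / (1 - d t / real n))" if "t \<in> {1..m}" for t
        using elim that by (auto simp: field_simps)
      then have rate: "rate < \<theta>"
        unfolding rate_def using elim by (simp add: mult.assoc)
      have Eobs: "E n \<in> sets (obs_space m n (p n))" using E by (simp add: sets_csbm_law)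
      have "tail \<le> ennreal (q ^ p n)"
        unfolding tail_def q_def by (rule std_gaussian_norm_tail[OF \<epsilon>])
      moreover have "ennreal (1 / sqrt (1 - rate)) \<le> ennreal C"
        unfolding C_def using rate \<theta> by (intro ennreal_leI divide_left_mono) auto
      ultimately have "emeasure (?Q n) (E n) \<le> ennreal (K / 2) * emeasure (?P n) (E n) + ennreal (1 / (2 * K)) * ennreal C + ennreal (q ^ p n)"
        using law_le_null[OF Eobs K(1)] rate \<theta>(2)
        by (meson add_mono mult_left_mono order_refl order_trans less_trans zero_le)
      also have "\<dots> = ennreal (K / 2 * measure (?P n) (E n) + r / 4 + q ^ p n)"
        using K C q r unfolding P.emeasure_eq_measure K(2)[symmetric]
        by (simp add: ennreal_mult[symmetric] ennreal_plus[symmetric] del: ennreal_plus)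
      finally have "measure (?Q n) (E n) \<le> K / 2 * measure (?P n) (E n) + r / 4 + q ^ p n"
        unfolding Q.emeasure_eq_measure using K r q
        by (subst (asm) ennreal_le_iff) (auto intro!: add_nonneg_nonneg mult_nonneg_nonneg)
      moreover have "K / 2 * measure (?P n) (E n) \<le> r / 4"
        using elim(1) K by (simp add: field_simps)
      ultimately show ?case using elim(2) r by simp
    qed
    then show "\<exists>no. \<forall>n\<ge>no. norm (measure (?Q n) (E n) - 0) < r" by (simp add: eventually_sequentially)
  qed
qed

theorem theorem2p1:
  fixes m :: nat and d l :: "nat \<Rightarrow> real" and \<mu> \<gamma> :: real and p :: "nat \<Rightarrow> nat"
  assumes "m \<ge> 1"
    and "\<And>k. k \<in> {1..m} \<Longrightarrow> d k > 1"
    and "\<And>k. k \<in> {1..m} \<Longrightarrow> l k \<ge> 0"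
    and "\<mu> \<ge> 0"
    and "\<And>k. k \<in> {1..m} \<Longrightarrow> b_par (d k) (l k) \<ge> 0"
    and "\<gamma> > 0"
    and "(\<lambda>n. real n / real (p n)) \<longlonglongrightarrow> \<gamma>"
  shows "((\<Sum>k=1..m. (l k)\<^sup>2) + \<mu>\<^sup>2 / \<gamma> < 1 \<longrightarrow>
            contiguous (\<lambda>n. csbm_law m n (p n) d l \<mu>) (\<lambda>n. csbm_law m n (p n) d (\<lambda>_. 0) 0)) \<and>
         ((\<Sum>k=1..m. (l k)\<^sup>2) + \<mu>\<^sup>2 / \<gamma> > 1 \<longrightarrow>
            asymp_mutually_singular (\<lambda>n. csbm_law m n (p n) d l \<mu>) (\<lambda>n. csbm_law m n (p n) d (\<lambda>_. 0) 0))"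
proof (intro conjI impI)
  assume "(\<Sum>k=1..m. (l k)\<^sup>2) + \<mu>\<^sup>2 / \<gamma> < 1"
  then show "contiguous (\<lambda>n. csbm_law m n (p n) d l \<mu>) (\<lambda>n. csbm_law m n (p n) d (\<lambda>_. 0) 0)"
    by (rule csbm_contiguous[where \<gamma>=\<gamma>, rotated -1]) (fact assms)+
next
  assume "(\<Sum>k=1..m. (l k)\<^sup>2) + \<mu>\<^sup>2 / \<gamma> > 1"
  then show "asymp_mutually_singular (\<lambda>n. csbm_law m n (p n) d l \<mu>) (\<lambda>n. csbm_law m n (p n) d (\<lambda>_. 0) 0)"
    by (rule csbm_singular[where \<gamma>=\<gamma>, rotated -1]) (fact assms)+
qed

end
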